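(* For $n\ge 1$ let $C(S^1)^{(n)}$ be the Toeplitz operator system of $n\times n$ Toeplitz matrices, let $d_n$ be the distance on its state space $\mathcal{S}(C(S^1)^{(n)})$ defined by the operator system spectral triple $(C(S^1)^{(n)},P_nL^2(S^1),P_nDP_n)$, and let $d$ be the distance on $\mathcal{S}(C(S^1))$ defined by the spectral triple $(C^\infty(S^1),L^2(S^1),D=-i\frac{d}{dx})$. Then the sequence of state spaces $\{(\mathcal{S}(C(S^1)^{(n)}),d_n)\}_n$ converges to $(\mathcal{S}(C(S^1)),d)$ in Gromov--Hausdorff distance as $n\to\infty$.
   Context: An operator system is a $*$-closed linear subspace $E\subseteq\mathcal{B}(\mathcal{H})$ containing the identity; its state space $\mathcal{S}(E)$ is the set of positive linear functionals on $E$ of norm $1$. Given a dense subspace $\mathcal{E}\subseteq E$ and a self-adjoint operator $D$ in $\mathcal{H}$ with compact resolvent such that $[D,T]$ is bounded for all $T\in\mathcal{E}$, the triple $(\mathcal{E},\mathcal{H},D)$ (an operator system spectral triple) defines the distance $d(\phi,\psi)=\sup\{|\phi(x)-\psi(x)|: x\in\mathcal{E},\ \|[D,x]\|\le 1\}$ on $\mathcal{S}(E)$. On the circle $S^1=\mathbb{R}/2\pi\mathbb{Z}$, $C(S^1)$ acts on $L^2(S^1)$ by pointwise multiplication, $D=-i\frac{d}{dx}$, and $e_k(x)=e^{ikx}$ ($k\in\mathbb{Z}$) is the orthonormal eigenbasis of $D$ (normalized measure $dx/2\pi$). $P_n$ is the orthogonal projection onto $\mathrm{span}_{\mathbb{C}}\{e_1,\ldots,e_n\}$.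 The Toeplitz operator system is $C(S^1)^{(n)}=P_nC(S^1)P_n\subseteq\mathcal{B}(P_nL^2(S^1))\cong M_n(\mathbb{C})$, i.e. the space of Toeplitz matrices $T=(a_{k-l})_{k,l=1}^n$. *)

theory Defs
  imports "HOL-Analysis.Analysis" "HOL-Library.Nonpos_Ints"
begin

section \<open>The Hilbert space of square-integrable functions on the circle\<close>

text \<open>
  The circle is \<open>\<real>/2\<pi>\<int>\<close> with normalized measure \<open>dx/2\<pi>\<close>, represented on the fundamental
  domain \<open>[0,2\<pi>)\<close>; values of representatives outside of it are irrelevant.
\<close>

definition circ :: "real measure" where
  "circ = uniform_measure lborel {0..<2 * pi}"

definition square_integrable :: "(real \<Rightarrow> complex) \<Rightarrow> bool" where
  "square_integrable f \<longleftrightarrow> f \<in> borel_measurable borel \<and> integrable circ (\<lambda>x. (cmod (f x))\<^sup>2)"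

definition l2_rel :: "(real \<Rightarrow> complex) \<Rightarrow> (real \<Rightarrow> complex) \<Rightarrow> bool" where
  "l2_rel f g \<longleftrightarrow> square_integrable f \<and> square_integrable g \<and> (AE x in circ. f x = g x)"

lemma sets_circ [simp, measurable_cong]: "sets circ = sets borel"
  by (simp add: circ_def)

lemma space_circ [simp]: "space circ = UNIV"
  by (simp add: circ_def)

lemma prob_space_circ: "emeasure circ UNIV = 1"
  unfolding circ_def by (subst emeasure_uniform_measure) (auto simp: ennreal_divide_self)

lemma finite_measure_circ: "finite_measure circ"
  by (rule finite_measureI) (simp add: prob_space_circ)

lemma AE_circ: "(AE x in circ. P x) \<longleftrightarrow> (AE x in lborel. x \<in> {0..<2 * pi} \<longrightarrow> P x)"
  unfolding circ_def uniform_measure_def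
  by (subst AE_density) (auto simp: zero_less_iff_neq_zero ennreal_divide_eq_0_iff indicator_def)

lemma borel_measurable_cnj [measurable (raw)]:
  "f \<in> borel_measurable M \<Longrightarrow> (\<lambda>x. cnj (f x)) \<in> borel_measurable M"
  by (rule borel_measurable_continuous_on[where f = cnj]) (auto intro: continuous_intros)

lemma square_integrable_cnj_mult:
  assumes "square_integrable f" "square_integrable g"
  shows "integrable circ (\<lambda>x. cnj (f x) * g x)"
proof (rule Bochner_Integration.integrable_bound)
  show "integrable circ (\<lambda>x. (cmod (f x))\<^sup>2 + (cmod (g x))\<^sup>2)"
    using assms by (auto simp: square_integrable_def)
  have [measurable]: "f \<in> borel_measurable borel" "g \<in> borel_measurable borel"
    using assms by (auto simp: square_integrable_def)
  show "(\<lambda>x. cnj (f x) * g x) \<in> borel_measurable circ"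
    by measurable
  have "cmod a * cmod b \<le> (cmod a)\<^sup>2 + (cmod b)\<^sup>2" for a b
    using sum_squares_bound[of "cmod a" "cmod b"] mult_nonneg_nonneg[of "cmod a" "cmod b"]
    by (simp del: mult_nonneg_nonneg)
  then show "AE x in circ. norm (cnj (f x) * g x) \<le> norm ((cmod (f x))\<^sup>2 + (cmod (g x))\<^sup>2)"
    by (auto simp: norm_mult)
qed

lemma square_integrable_bounded:
  assumes "f \<in> borel_measurable borel" "\<And>x. x \<in> {0..<2 * pi} \<Longrightarrow> cmod (f x) \<le> B"
  shows "square_integrable f"
proof -
  interpret finite_measure circ by (rule finite_measure_circ)
  have [measurable]: "f \<in> borel_measurable borel" by fact
  have "AE x in circ. norm ((cmod (f x))\<^sup>2) \<le> B\<^sup>2"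
    unfolding AE_circ using assms(2) by (auto intro!: AE_I2 power_mono)
  then show ?thesis
    unfolding square_integrable_def by (auto intro!: integrable_const_bound)
qed

lemma square_integrable_0: "square_integrable (\<lambda>x. 0)"
  by (simp add: square_integrable_def)

lemma square_integrable_mult_bounded:
  assumes f: "f \<in> borel_measurable borel" "\<And>x. x \<in> {0..<2 * pi} \<Longrightarrow> cmod (f x) \<le> B"
    and g: "square_integrable g"
  shows "square_integrable (\<lambda>x. f x * g x)"
proof -
  have [measurable]: "f \<in> borel_measurable borel" "g \<in> borel_measurable borel"
    using assms by (auto simp: square_integrable_def)
  have "integrable circ (\<lambda>x. (cmod (f x * g x))\<^sup>2)"
  proof (rule Bochner_Integration.integrable_bound)
    show "integrable circ (\<lambda>x. B\<^sup>2 * (cmod (g x))\<^sup>2)"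
      using g by (auto simp: square_integrable_def)
    show "AE x in circ. norm ((cmod (f x * g x))\<^sup>2) \<le> norm (B\<^sup>2 * (cmod (g x))\<^sup>2)"
      unfolding AE_circ using f(2)
      by (auto intro!: AE_I2 mult_right_mono power_mono simp: norm_mult power_mult_distrib)
  qed measurable
  then show ?thesis
    by (simp add: square_integrable_def)
qed

lemma square_integrable_add:
  assumes "square_integrable f" "square_integrable g"
  shows "square_integrable (\<lambda>x. f x + g x)"
proof -
  have [measurable]: "f \<in> borel_measurable borel" "g \<in> borel_measurable borel"
    using assms by (auto simp: square_integrable_def)
  have "integrable circ (\<lambda>x. (cmod (f x + g x))\<^sup>2)"
  proof (rule Bochner_Integration.integrable_bound)
    show "integrable circ (\<lambda>x. 2 * (cmod (f x))\<^sup>2 + 2 * (cmod (g x))\<^sup>2)"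
      using assms by (auto simp: square_integrable_def)
    have "(cmod (a + b))\<^sup>2 \<le> 2 * (cmod a)\<^sup>2 + 2 * (cmod b)\<^sup>2" for a b
    proof -
      have "(cmod (a + b))\<^sup>2 \<le> (cmod a + cmod b)\<^sup>2"
        by (intro power_mono norm_triangle_ineq) auto
      then show ?thesis
        using sum_squares_bound[of "cmod a" "cmod b"] by (simp add: power2_sum)
    qed
    then show "AE x in circ. norm ((cmod (f x + g x))\<^sup>2)
        \<le> norm (2 * (cmod (f x))\<^sup>2 + 2 * (cmod (g x))\<^sup>2)"
      by auto
  qed measurable
  then show ?thesis
    by (simp add: square_integrable_def)
qed

lemma square_integrable_cmult:
  "square_integrable f \<Longrightarrow> square_integrable (\<lambda>x. c * f x)"
  by (rule square_integrable_mult_bounded[where B = "cmod c"]) auto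

lemma square_integrable_scaleR:
  "square_integrable f \<Longrightarrow> square_integrable (\<lambda>x. r *\<^sub>R f x)"
  using square_integrable_cmult[of f "of_real r"] by (simp add: scaleR_conv_of_real)

lemma square_integrable_uminus:
  "square_integrable f \<Longrightarrow> square_integrable (\<lambda>x. - f x)"
  by (simp add: square_integrable_def)

lemma square_integrable_diff:
  "square_integrable f \<Longrightarrow> square_integrable g \<Longrightarrow> square_integrable (\<lambda>x. f x - g x)"
  using square_integrable_add[of f "\<lambda>x. - g x"] square_integrable_uminus[of g] by simp

quotient_type L2_circle = "real \<Rightarrow> complex" / partial: l2_rel
proof (rule part_equivpI)
  show "\<exists>f. l2_rel f f"
    using square_integrable_0 by (auto simp: l2_rel_def)
  show "symp l2_rel"
    by (auto simp: l2_rel_def symp_def)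
  show "transp l2_rel"
    by (auto simp: l2_rel_def transp_def)
qed

instantiation L2_circle :: real_inner
begin

lift_definition zero_L2_circle :: L2_circle is "\<lambda>x. 0"
  by (simp add: l2_rel_def square_integrable_0)

lift_definition plus_L2_circle :: "L2_circle \<Rightarrow> L2_circle \<Rightarrow> L2_circle" is "\<lambda>f g x. f x + g x"
  by (auto simp: l2_rel_def intro: square_integrable_add)

lift_definition uminus_L2_circle :: "L2_circle \<Rightarrow> L2_circle" is "\<lambda>f x. - f x"
  by (auto simp: l2_rel_def intro: square_integrable_uminus)

lift_definition minus_L2_circle :: "L2_circle \<Rightarrow> L2_circle \<Rightarrow> L2_circle" is "\<lambda>f g x. f x - g x"
  by (auto simp: l2_rel_def intro: square_integrable_diff)

lift_definition scaleR_L2_circle :: "real \<Rightarrow> L2_circle \<Rightarrow> L2_circle" is "\<lambda>r f x. r *\<^sub>R f x"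
  by (auto simp: l2_rel_def intro: square_integrable_scaleR)

lift_definition inner_L2_circle :: "L2_circle \<Rightarrow> L2_circle \<Rightarrow> real"
  is "\<lambda>f g. Re (\<integral>x. cnj (f x) * g x \<partial>circ)"
proof -
  fix f f' g g' :: "real \<Rightarrow> complex"
  assume *: "l2_rel f f'" "l2_rel g g'"
  then have [measurable]: "f \<in> borel_measurable borel" "g \<in> borel_measurable borel"
    "f' \<in> borel_measurable borel" "g' \<in> borel_measurable borel"
    by (auto simp: l2_rel_def square_integrable_def)
  have "(\<integral>x. cnj (f x) * g x \<partial>circ) = (\<integral>x. cnj (f' x) * g' x \<partial>circ)"
    proof (rule integral_cong_AE)
    show "AE x in circ. cnj (f x) * g x = cnj (f' x) * g' x"
      using * by (auto simp: l2_rel_def)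
  qed measurable
  then show "Re (\<integral>x. cnj (f x) * g x \<partial>circ) = Re (\<integral>x. cnj (f' x) * g' x \<partial>circ)"
    by simp
qed

definition norm_L2_circle :: "L2_circle \<Rightarrow> real" where
  "norm_L2_circle \<xi> = sqrt (inner \<xi> \<xi>)"

definition sgn_L2_circle :: "L2_circle \<Rightarrow> L2_circle" where
  "sgn_L2_circle \<xi> = inverse (norm \<xi>) *\<^sub>R \<xi>"

definition dist_L2_circle :: "L2_circle \<Rightarrow> L2_circle \<Rightarrow> real" where
  "dist_L2_circle \<xi> \<eta> = norm (\<xi> - \<eta>)"

definition uniformity_L2_circle :: "(L2_circle \<times> L2_circle) filter" where
  "uniformity_L2_circle = (INF e\<in>{0<..}. principal {(x, y). dist x y < e})"

definition open_L2_circle :: "L2_circle set \<Rightarrow> bool" where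
  "open_L2_circle U \<longleftrightarrow> (\<forall>x\<in>U. eventually (\<lambda>(x', y). x' = x \<longrightarrow> y \<in> U) uniformity)"

instance
proof
  fix a b c :: L2_circle and r s :: real
  show "a + b + c = a + (b + c)"
    by transfer (auto simp: l2_rel_def add.assoc intro!: square_integrable_add)
  show "a + b = b + a"
    by transfer (auto simp: l2_rel_def add.commute intro!: square_integrable_add)
  show "0 + a = a"
    by transfer (auto simp: l2_rel_def)
  show "- a + a = 0"
    by transfer (auto simp: l2_rel_def square_integrable_0)
  show "a - b = a + - b"
    by transfer (auto simp: l2_rel_def intro!: square_integrable_diff)
  show "r *\<^sub>R (a + b) = r *\<^sub>R a + r *\<^sub>R b"
    by transfer (auto simp: l2_rel_def scaleR_add_right
        intro!: square_integrable_add square_integrable_scaleR)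
  show "(r + s) *\<^sub>R a = r *\<^sub>R a + s *\<^sub>R a"
    by transfer (auto simp: l2_rel_def scaleR_add_left
        intro!: square_integrable_add square_integrable_scaleR)
  show "r *\<^sub>R s *\<^sub>R a = (r * s) *\<^sub>R a"
    by transfer (auto simp: l2_rel_def intro!: square_integrable_scaleR)
  show "1 *\<^sub>R a = a"
    by transfer (auto simp: l2_rel_def)
  show "sgn a = inverse (norm a) *\<^sub>R a"
    by (simp add: sgn_L2_circle_def)
  show "dist a b = norm (a - b)"
    by (simp add: dist_L2_circle_def)
  show "(uniformity :: (L2_circle \<times> L2_circle) filter) = (INF e\<in>{0<..}. principal {(x, y). dist x y < e})"
    by (rule uniformity_L2_circle_def)
  show "open U = (\<forall>x\<in>U. \<forall>\<^sub>F (x', y) in uniformity. x' = x \<longrightarrow> y \<in> U)" for U :: "L2_circle set"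
    by (rule open_L2_circle_def)
  show "norm a = sqrt (inner a a)"
    by (rule norm_L2_circle_def)
  have cnj_swap: "Re (\<integral>x. cnj (f x) * g x \<partial>circ) = Re (\<integral>x. cnj (g x) * f x \<partial>circ)"
    for f g :: "real \<Rightarrow> complex"
  proof -
    have "(\<integral>x. cnj (f x) * g x \<partial>circ) = (\<integral>x. cnj (cnj (g x) * f x) \<partial>circ)"
      by (simp add: mult.commute)
    also have "\<dots> = cnj (\<integral>x. cnj (g x) * f x \<partial>circ)"
      by (rule Bochner_Integration.integral_cnj)
    finally show ?thesis by simp
  qed
  show "inner a b = inner b a"
    by transfer (rule cnj_swap)
  show "inner (a + b) c = inner a c + inner b c"
    by transfer
      (auto simp: l2_rel_def distrib_right Bochner_Integration.integral_add square_integrable_cnj_mult)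
  show "inner (r *\<^sub>R a) b = r * inner a b"
    by transfer (simp add: l2_rel_def)
  have sq: "(\<integral>x. cnj (f x) * f x \<partial>circ) = of_real (\<integral>x. (cmod (f x))\<^sup>2 \<partial>circ)"
    for f :: "real \<Rightarrow> complex"
    unfolding integral_complex_of_real[symmetric]
    by (rule Bochner_Integration.integral_cong) (auto simp: complex_norm_square[symmetric] mult.commute)
  show "0 \<le> inner a a"
    by transfer (simp add: sq)
  show "(inner a a = 0) = (a = 0)"
  proof transfer
    fix f assume "l2_rel f f"
    then have f: "square_integrable f" by (simp add: l2_rel_def)
    then have "(\<integral>x. (cmod (f x))\<^sup>2 \<partial>circ) = 0 \<longleftrightarrow> (AE x in circ. (cmod (f x))\<^sup>2 = 0)"
      by (intro integral_nonneg_eq_0_iff_AE) (auto simp: square_integrable_def)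
    then show "(Re (\<integral>x. cnj (f x) * f x \<partial>circ) = 0) = l2_rel f (\<lambda>x. 0)"
      using f by (simp add: sq l2_rel_def square_integrable_0)
  qed
qed

end

text \<open>The real inner product above is the real part of the following complex one, which is
  conjugate linear in its first argument.\<close>

lift_definition cinner :: "L2_circle \<Rightarrow> L2_circle \<Rightarrow> complex"
  is "\<lambda>f g. \<integral>x. cnj (f x) * g x \<partial>circ"
proof -
  fix f f' g g' :: "real \<Rightarrow> complex"
  assume *: "l2_rel f f'" "l2_rel g g'"
  then have [measurable]: "f \<in> borel_measurable borel" "g \<in> borel_measurable borel"
    "f' \<in> borel_measurable borel" "g' \<in> borel_measurable borel"
    by (auto simp: l2_rel_def square_integrable_def)
  show "(\<integral>x. cnj (f x) * g x \<partial>circ) = (\<integral>x. cnj (f' x) * g' x \<partial>circ)"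
    proof (rule integral_cong_AE)
    show "AE x in circ. cnj (f x) * g x = cnj (f' x) * g' x"
      using * by (auto simp: l2_rel_def)
  qed measurable
qed

lift_definition cscale :: "complex \<Rightarrow> L2_circle \<Rightarrow> L2_circle" (infixr \<open>*\<^sub>c\<close> 75)
  is "\<lambda>c f x. c * f x"
  by (auto simp: l2_rel_def intro: square_integrable_cmult)


section \<open>States and spectral distances\<close>

text \<open>
  An operator on a (not necessarily closed) subspace \<open>V\<close> of the Hilbert space is given by a function
  on \<open>L2_circle\<close> that is only looked at on \<open>V\<close>. Its norm is taken in \<open>[0,\<infinity>]\<close>.
\<close>

definition op_norm :: "L2_circle set \<Rightarrow> (L2_circle \<Rightarrow> L2_circle) \<Rightarrow> ennreal" where
  "op_norm V T = (SUP \<xi>\<in>{\<xi>\<in>V. norm \<xi> \<le> 1}. ennreal (norm (T \<xi>)))"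

definition positive_op :: "L2_circle set \<Rightarrow> (L2_circle \<Rightarrow> L2_circle) \<Rightarrow> bool" where
  "positive_op V T \<longleftrightarrow> (\<forall>\<xi>\<in>V. cinner \<xi> (T \<xi>) \<in> \<real>\<^sub>\<ge>\<^sub>0)"

text \<open>
  States of an operator system \<open>E\<close> of bounded operators on the Hilbert space \<open>V\<close>. Functionals on
  \<open>E\<close> are represented by functions that are \<open>undefined\<close> off \<open>E\<close>.
\<close>

definition state_space ::
  "L2_circle set \<Rightarrow> (L2_circle \<Rightarrow> L2_circle) set \<Rightarrow> ((L2_circle \<Rightarrow> L2_circle) \<Rightarrow> complex) set" where
  "state_space V E = {\<phi> \<in> extensional E.
      (\<forall>S\<in>E. \<forall>T\<in>E. \<phi> (\<lambda>\<xi>. S \<xi> + T \<xi>) = \<phi> S + \<phi> T) \<and>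
      (\<forall>c. \<forall>T\<in>E. \<phi> (\<lambda>\<xi>. c *\<^sub>c T \<xi>) = c * \<phi> T) \<and>
      (\<forall>T\<in>E. positive_op V T \<longrightarrow> \<phi> T \<in> \<real>\<^sub>\<ge>\<^sub>0) \<and>
      (SUP T\<in>{T\<in>E. op_norm V T \<le> 1}. ennreal (cmod (\<phi> T))) = 1}"

text \<open>
  The norm of the commutator of an operator \<open>D\<close> with domain \<open>W\<close> and a bounded operator \<open>T\<close>; the
  commutator is considered on its natural domain, which is \<open>W\<close> if \<open>T\<close> preserves \<open>W\<close>.
\<close>

definition commutator_norm ::
  "L2_circle set \<Rightarrow> (L2_circle \<Rightarrow> L2_circle) \<Rightarrow> (L2_circle \<Rightarrow> L2_circle) \<Rightarrow> ennreal" where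
  "commutator_norm W D T = op_norm {\<xi>\<in>W. T \<xi> \<in> W} (\<lambda>\<xi>. D (T \<xi>) - T (D \<xi>))"

definition spectral_dist ::
  "(L2_circle \<Rightarrow> L2_circle) set \<Rightarrow> L2_circle set \<Rightarrow> (L2_circle \<Rightarrow> L2_circle) \<Rightarrow>
    ((L2_circle \<Rightarrow> L2_circle) \<Rightarrow> complex) \<Rightarrow> ((L2_circle \<Rightarrow> L2_circle) \<Rightarrow> complex) \<Rightarrow> ennreal" where
  "spectral_dist E W D \<phi> \<psi> =
    (SUP T\<in>{T\<in>E. commutator_norm W D T \<le> 1}. ennreal (cmod (\<phi> T - \<psi> T)))"


section \<open>The spectral triple of the circle\<close>

definition cont_circle :: "(real \<Rightarrow> complex) set" where
  "cont_circle = {f. continuous_on UNIV f \<and> (\<forall>x. f (x + 2 * pi) = f x)}"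

definition smooth_circle :: "(real \<Rightarrow> complex) set" where
  "smooth_circle = {f. (\<forall>x. f (x + 2 * pi) = f x) \<and>
      (\<exists>F. F 0 = f \<and> (\<forall>k x. (F k has_vector_derivative F (Suc k) x) (at x)))}"

lemma cont_circle_mult:
  assumes "f \<in> cont_circle" "square_integrable g"
  shows "square_integrable (\<lambda>x. f x * g x)"
proof -
  have f: "continuous_on UNIV f" using assms by (simp add: cont_circle_def)
  then have "compact (f ` {0..2 * pi})"
    by (intro compact_continuous_image) (auto intro: continuous_on_subset)
  then obtain B where "\<forall>y\<in>f ` {0..2 * pi}. cmod y \<le> B"
    using compact_imp_bounded bounded_iff by blast
  then show ?thesis
    using f assms(2)
    by (intro square_integrable_mult_bounded[where B = B]) (auto intro: borel_measurable_continuous_onI)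
qed

text \<open>Multiplication by a continuous function on the circle (by convention \<open>0\<close> for other functions).\<close>

lift_definition mult_op :: "(real \<Rightarrow> complex) \<Rightarrow> L2_circle \<Rightarrow> L2_circle"
  is "\<lambda>f g x. if f \<in> cont_circle then f x * g x else 0"
  subgoal for f by (cases "f \<in> cont_circle") (auto simp: l2_rel_def square_integrable_0 cont_circle_mult)
  done

text \<open>
  \<open>has_L2_deriv \<xi> \<eta>\<close>: the class \<open>\<xi>\<close> contains an absolutely continuous \<open>2\<pi>\<close>-periodic function
  with almost everywhere derivative \<open>\<eta>\<close>, written as an indefinite integral of \<open>\<eta>\<close>;
  periodicity is the vanishing of the integral of \<open>\<eta>\<close> over a period. The \<open>\<xi>\<close> for which
  such an \<open>\<eta>\<close> exists form the domain on which \<open>-i d/dx\<close> is self-adjoint; \<open>\<eta>\<close> is then unique.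
\<close>

lift_definition has_L2_deriv :: "L2_circle \<Rightarrow> L2_circle \<Rightarrow> bool"
  is "\<lambda>f g. (LINT t:{0..<2 * pi}|lborel. g t) = 0 \<and>
        (\<exists>c. AE x in circ. f x = c + (LINT t:{0..x}|lborel. g t))"
proof -
  fix f f' g g' :: "real \<Rightarrow> complex"
  assume *: "l2_rel f f'" "l2_rel g g'"
  then have [measurable]: "g \<in> borel_measurable borel" "g' \<in> borel_measurable borel"
    by (auto simp: l2_rel_def square_integrable_def)
  have g: "AE t in lborel. t \<in> {0..<2 * pi} \<longrightarrow> g t = g' t"
    using * by (simp add: l2_rel_def AE_circ)
  have total: "(LINT t:{0..<2 * pi}|lborel. g t) = (LINT t:{0..<2 * pi}|lborel. g' t)"
    unfolding set_lebesgue_integral_def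
    by (rule integral_cong_AE) (use g in \<open>auto elim!: eventually_mono simp: indicator_def\<close>)
  have part: "(LINT t:{0..x}|lborel. g t) = (LINT t:{0..x}|lborel. g' t)" if "x \<in> {0..<2 * pi}" for x
    unfolding set_lebesgue_integral_def
    by (rule integral_cong_AE) (use g that in \<open>auto elim!: eventually_mono simp: indicator_def\<close>)
  have f: "AE x in lborel. x \<in> {0..<2 * pi} \<longrightarrow> f x = f' x"
    using * by (simp add: l2_rel_def AE_circ)
  have "(AE x in circ. f x = c + (LINT t:{0..x}|lborel. g t)) \<longleftrightarrow>
      (AE x in circ. f' x = c + (LINT t:{0..x}|lborel. g' t))" for c
    unfolding AE_circ
    by (rule eventually_cong, rule eventually_mono[OF f]) (auto simp: part)
  with total show "((LINT t:{0..<2 * pi}|lborel. g t) = 0 \<and>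
        (\<exists>c. AE x in circ. f x = c + (LINT t:{0..x}|lborel. g t))) =
      ((LINT t:{0..<2 * pi}|lborel. g' t) = 0 \<and>
        (\<exists>c. AE x in circ. f' x = c + (LINT t:{0..x}|lborel. g' t)))"
    by simp
qed

definition D_dom :: "L2_circle set" where
  "D_dom = {\<xi>. \<exists>\<eta>. has_L2_deriv \<xi> \<eta>}"

definition D_op :: "L2_circle \<Rightarrow> L2_circle" where
  "D_op \<xi> = (- \<i>) *\<^sub>c (THE \<eta>. has_L2_deriv \<xi> \<eta>)"

definition circle_states :: "((L2_circle \<Rightarrow> L2_circle) \<Rightarrow> complex) set" where
  "circle_states = state_space UNIV (mult_op ` cont_circle)"

definition circle_dist ::
  "((L2_circle \<Rightarrow> L2_circle) \<Rightarrow> complex) \<Rightarrow> ((L2_circle \<Rightarrow> L2_circle) \<Rightarrow> complex) \<Rightarrow> ennreal" where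
  "circle_dist = spectral_dist (mult_op ` smooth_circle) D_dom D_op"


section \<open>The spectral triple of the Toeplitz operator system\<close>

lift_definition basis_vec :: "int \<Rightarrow> L2_circle"
  is "\<lambda>k x. exp (\<i> * of_int k * of_real x)"
proof -
  fix k :: int
  have "(\<lambda>x. exp (\<i> * of_int k * of_real x)) \<in> borel_measurable borel"
    by (intro borel_measurable_continuous_onI continuous_intros)
  then have "square_integrable (\<lambda>x. exp (\<i> * of_int k * of_real x))"
    by (rule square_integrable_bounded[where B = 1]) (auto simp: norm_exp_eq_Re)
  then show "l2_rel (\<lambda>x. exp (\<i> * of_int k * of_real x)) (\<lambda>x. exp (\<i> * of_int k * of_real x))"
    by (simp add: l2_rel_def)
qed

definition proj :: "nat \<Rightarrow> L2_circle \<Rightarrow> L2_circle" where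
  "proj n \<xi> = (\<Sum>k = 1..n. cinner (basis_vec (int k)) \<xi> *\<^sub>c basis_vec (int k))"

text \<open>
  The compression \<open>P\<^sub>n T P\<^sub>n\<close> is an operator on \<open>range (proj n)\<close>; as a function on \<open>L2_circle\<close> it
  is determined by its restriction to this subspace. For \<open>T\<close> multiplication by \<open>f\<close>, its matrix in
  the basis \<open>e\<^sub>1, \<dots>, e\<^sub>n\<close> is the Toeplitz matrix of the Fourier coefficients of \<open>f\<close>.
\<close>

definition compress :: "nat \<Rightarrow> (L2_circle \<Rightarrow> L2_circle) \<Rightarrow> L2_circle \<Rightarrow> L2_circle" where
  "compress n T = proj n \<circ> T \<circ> proj n"

definition toeplitz_system :: "nat \<Rightarrow> (L2_circle \<Rightarrow> L2_circle) set" where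
  "toeplitz_system n = (\<lambda>f. compress n (mult_op f)) ` cont_circle"

definition toeplitz_states :: "nat \<Rightarrow> ((L2_circle \<Rightarrow> L2_circle) \<Rightarrow> complex) set" where
  "toeplitz_states n = state_space (range (proj n)) (toeplitz_system n)"

definition toeplitz_dist ::
  "nat \<Rightarrow> ((L2_circle \<Rightarrow> L2_circle) \<Rightarrow> complex) \<Rightarrow> ((L2_circle \<Rightarrow> L2_circle) \<Rightarrow> complex) \<Rightarrow> ennreal" where
  "toeplitz_dist n = spectral_dist (toeplitz_system n) (range (proj n)) (compress n D_op)"


section \<open>Gromov--Hausdorff distance\<close>

definition hausdorff_dist :: "('z \<Rightarrow> 'z \<Rightarrow> real) \<Rightarrow> 'z set \<Rightarrow> 'z set \<Rightarrow> ennreal" where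
  "hausdorff_dist d A B =
    max (SUP a\<in>A. INF b\<in>B. ennreal (d a b)) (SUP b\<in>B. INF a\<in>A. ennreal (d a b))"

definition isometric_embedding ::
  "'a set \<Rightarrow> ('a \<Rightarrow> 'a \<Rightarrow> ennreal) \<Rightarrow> 'z set \<Rightarrow> ('z \<Rightarrow> 'z \<Rightarrow> real) \<Rightarrow> ('a \<Rightarrow> 'z) \<Rightarrow> bool" where
  "isometric_embedding X dX Z dZ f \<longleftrightarrow>
    f \<in> X \<rightarrow> Z \<and> (\<forall>x\<in>X. \<forall>y\<in>X. ennreal (dZ (f x) (f y)) = dX x y)"

text \<open>
  The infimum of Hausdorff distances over all isometric embeddings into a common metric space \<open>Z\<close>.
  It is enough to consider \<open>Z\<close> with points in the type \<open>'a + 'b\<close>, since \<open>Z\<close> may be replaced by the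
  union of the two images, which injects into this type. The spaces come with distance functions in
  \<open>[0,\<infinity>]\<close>; if one of them takes the value \<open>\<infinity>\<close> there is no embedding and the infimum is \<open>\<infinity>\<close>.
\<close>

definition gromov_hausdorff_dist ::
  "'a set \<Rightarrow> ('a \<Rightarrow> 'a \<Rightarrow> ennreal) \<Rightarrow> 'b set \<Rightarrow> ('b \<Rightarrow> 'b \<Rightarrow> ennreal) \<Rightarrow> ennreal" where
  "gromov_hausdorff_dist X dX Y dY =
    Inf {hausdorff_dist dZ (f ` X) (g ` Y) | (Z :: ('a + 'b) set) dZ f g.
      Metric_space Z dZ \<and> isometric_embedding X dX Z dZ f \<and> isometric_embedding Y dY Z dZ g}"

end

theory Submission
  imports Defs "HOL-Real_Asymp.Real_Asymp"
begin

text \<open>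
  The truncation \<open>f \<mapsto> P\<^sub>n f P\<^sub>n\<close> has a partner in the opposite direction. Let \<open>v\<close> be the unit
  vector \<open>n\<^sup>-\<^sup>1\<^sup>/\<^sup>2 \<Sum>\<^sub>k e\<^sup>-\<^sup>i\<^sup>k\<^sup>x e\<^sub>k\<close> (\<open>fejer_vec n x\<close>) and send an operator \<open>T\<close> to the function
  \<open>x \<mapsto> \<langle>v, T v\<rangle>\<close> (\<open>symbol n T\<close>). Both maps are linear, unital and positive, so they pull states back
  to states. Both also shrink commutators with \<open>D\<close>: truncation because \<open>P\<^sub>n\<close> commutes with \<open>D\<close>
  (\<open>commutator_norm_compress_le\<close>), the symbol because its derivative is \<open>\<i>\<close> times the symbol of
  \<open>[P\<^sub>n D P\<^sub>n, T]\<close> (\<open>symbol_has_vector_derivative\<close>) and because multiplication by a smooth \<open>f\<close> has commutator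
  \<open>- \<i> f'\<close> (\<open>commutator_D_mult_op\<close>). It remains to see that the two composites are close to the
  identity, uniformly on elements whose commutator has norm at most 1.

  On the circle the composite sends \<open>f\<close> to its Fejer mean. Here \<open>f\<close> is 1-Lipschitz, and
  \<open>|f x - f t|\<close> is at most a multiple of \<open>|e\<^sup>i\<^sup>(\<^sup>t\<^sup>-\<^sup>x\<^sup>) - 1|\<close>. So the error is controlled by the norm of
  \<open>(e\<^sup>-\<^sup>i\<^sup>x e\<^sub>1 - 1) v\<close>, where the sum telescopes to two terms of size \<open>n\<^sup>-\<^sup>1\<^sup>/\<^sup>2\<close> (\<open>lipschitz_fejer\<close>).

  On Toeplitz matrices \<open>T = (a\<^sub>k\<^sub>-\<^sub>l)\<close> the composite multiplies the entries by \<open>1 - |k - l| / n\<close>. So the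
  entries of the difference are, up to signs, those of \<open>[P\<^sub>n D P\<^sub>n, T]\<close> divided by \<open>n\<close>. Signs do not
  affect the Hilbert--Schmidt norm, which exceeds the operator norm by a factor of at most
  \<open>\<surd>n\<close>; the difference has norm at most \<open>1/\<surd>n\<close> (\<open>toeplitz_remainder_norm\<close>).

  Consequently the pullback \<open>R\<close> of Toeplitz states to states of \<open>C(S\<^sup>1)\<close> changes distances by at most
  \<open>2/\<surd>n\<close> and has \<open>\<pi>/\<surd>n\<close>-dense image, and such a map bounds the Gromov--Hausdorff distance
  (\<open>gromov_hausdorff_dist_le\<close>). That the spectral distance on the states of \<open>C(S\<^sup>1)\<close> is a finite metric comes from
  the same estimates: Lipschitz functions are close to constants, and Fejer means are smooth and uniformly dense.
\<close>

section \<open>The complex Hilbert space structure\<close>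

lemma l2_rel_refl_iff: "l2_rel f f \<longleftrightarrow> square_integrable f"
  by (auto simp: l2_rel_def)

lemma cscale_add_right: "c *\<^sub>c (\<xi> + \<eta>) = c *\<^sub>c \<xi> + c *\<^sub>c \<eta>"
  by transfer (auto simp: l2_rel_def distrib_left intro!: square_integrable_add square_integrable_cmult)

lemma cscale_add_left: "(c + d) *\<^sub>c \<xi> = c *\<^sub>c \<xi> + d *\<^sub>c \<xi>"
  by transfer (auto simp: l2_rel_def distrib_right intro!: square_integrable_add square_integrable_cmult)

lemma cscale_cscale [simp]: "c *\<^sub>c (d *\<^sub>c \<xi>) = (c * d) *\<^sub>c \<xi>"
  by transfer (auto simp: l2_rel_def mult.assoc intro!: square_integrable_cmult)

lemma cscale_one [simp]: "1 *\<^sub>c \<xi> = \<xi>"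
  by transfer (auto simp: l2_rel_def)

lemma scaleR_cscale: "r *\<^sub>R \<xi> = of_real r *\<^sub>c \<xi>"
  by transfer (auto simp: l2_rel_def scaleR_conv_of_real intro!: square_integrable_cmult)

lemma cscale_zero_left [simp]: "0 *\<^sub>c \<xi> = 0"
  using scaleR_cscale[of 0 \<xi>] by simp

lemma cscale_zero_right [simp]: "c *\<^sub>c 0 = 0"
  using cscale_add_right[of c 0 0] by simp

lemma cscale_minus_one: "(-1) *\<^sub>c \<xi> = - \<xi>"
  using scaleR_cscale[of "-1" \<xi>] by simp

lemma cscale_minus_right: "c *\<^sub>c (- \<xi>) = - (c *\<^sub>c \<xi>)"
  using cscale_add_right[of c \<xi> "- \<xi>"] by (simp add: eq_neg_iff_add_eq_0 add.commute)

lemma cscale_diff_right: "c *\<^sub>c (\<xi> - \<eta>) = c *\<^sub>c \<xi> - c *\<^sub>c \<eta>"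
  using cscale_add_right[of c \<xi> "- \<eta>"] by (simp add: cscale_minus_right)

lemma cscale_sum_right: "c *\<^sub>c (\<Sum>i\<in>I. f i) = (\<Sum>i\<in>I. c *\<^sub>c f i)"
  by (induction I rule: infinite_finite_induct) (auto simp: cscale_add_right)

lemma cinner_add_right: "cinner \<xi> (\<eta> + \<zeta>) = cinner \<xi> \<eta> + cinner \<xi> \<zeta>"
  by transfer (auto simp: l2_rel_def distrib_left Bochner_Integration.integral_add square_integrable_cnj_mult)

lemma cinner_cscale_right [simp]: "cinner \<xi> (c *\<^sub>c \<eta>) = c * cinner \<xi> \<eta>"
proof transfer
  fix f g and c :: complex
  have "(\<integral>x. cnj (f x) * (c * g x) \<partial>circ) = (\<integral>x. c * (cnj (f x) * g x) \<partial>circ)"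
    by (rule Bochner_Integration.integral_cong) (auto simp: mult_ac)
  then show "(\<integral>x. cnj (f x) * (c * g x) \<partial>circ) = c * (\<integral>x. cnj (f x) * g x \<partial>circ)"
    by simp
qed

lemma cinner_commute: "cinner \<xi> \<eta> = cnj (cinner \<eta> \<xi>)"
proof transfer
  fix f g
  have "(\<integral>x. cnj (f x) * g x \<partial>circ) = (\<integral>x. cnj (cnj (g x) * f x) \<partial>circ)"
    by (simp add: mult.commute)
  also have "\<dots> = cnj (\<integral>x. cnj (g x) * f x \<partial>circ)"
    by (rule Bochner_Integration.integral_cnj)
  finally show "(\<integral>x. cnj (f x) * g x \<partial>circ) = cnj (\<integral>x. cnj (g x) * f x \<partial>circ)" .
qed

lemma cinner_add_left: "cinner (\<eta> + \<zeta>) \<xi> = cinner \<eta> \<xi> + cinner \<zeta> \<xi>"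
  using arg_cong[OF cinner_add_right, of cnj] by (simp flip: cinner_commute)

lemma cinner_cscale_left [simp]: "cinner (c *\<^sub>c \<eta>) \<xi> = cnj c * cinner \<eta> \<xi>"
  by (subst (1 2) cinner_commute) simp

lemma cinner_zero [simp]: "cinner 0 \<xi> = 0" "cinner \<xi> 0 = 0"
  using cinner_cscale_left[of 0 0 \<xi>] cinner_cscale_right[of \<xi> 0 0] by simp_all

lemma cinner_minus_right: "cinner \<xi> (- \<eta>) = - cinner \<xi> \<eta>"
  using cinner_cscale_right[of \<xi> "-1" \<eta>] by (simp add: cscale_minus_one)

lemma cinner_minus_left: "cinner (- \<eta>) \<xi> = - cinner \<eta> \<xi>"
  using cinner_cscale_left[of "-1" \<eta> \<xi>] by (simp add: cscale_minus_one)

lemma cinner_diff_right: "cinner \<xi> (\<eta> - \<zeta>) = cinner \<xi> \<eta> - cinner \<xi> \<zeta>"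
  using cinner_add_right[of \<xi> \<eta> "- \<zeta>"] by (simp add: cinner_minus_right)

lemma cinner_diff_left: "cinner (\<eta> - \<zeta>) \<xi> = cinner \<eta> \<xi> - cinner \<zeta> \<xi>"
  using cinner_add_left[of \<eta> "- \<zeta>" \<xi>] by (simp add: cinner_minus_left)

lemma cinner_sum_right: "cinner \<xi> (\<Sum>i\<in>I. f i) = (\<Sum>i\<in>I. cinner \<xi> (f i))"
  by (induction I rule: infinite_finite_induct) (auto simp: cinner_add_right)

lemma cinner_sum_left: "cinner (\<Sum>i\<in>I. f i) \<xi> = (\<Sum>i\<in>I. cinner (f i) \<xi>)"
  by (induction I rule: infinite_finite_induct) (auto simp: cinner_add_left)

lemma inner_eq_Re_cinner: "inner \<xi> \<eta> = Re (cinner \<xi> \<eta>)"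
  by transfer simp

lemma cinner_self: "cinner \<xi> \<xi> = of_real ((norm \<xi>)\<^sup>2)"
proof -
  have "Im (cinner \<xi> \<xi>) = 0"
    using arg_cong[OF cinner_commute[of \<xi> \<xi>], of Im] by simp
  then show ?thesis
    by (simp add: complex_eq_iff power2_norm_eq_inner inner_eq_Re_cinner)
qed

lemma norm_cscale [simp]: "norm (c *\<^sub>c \<xi>) = cmod c * norm \<xi>"
proof -
  have "complex_of_real ((norm (c *\<^sub>c \<xi>))\<^sup>2) = (c * cnj c) * cinner \<xi> \<xi>"
    unfolding cinner_self[symmetric] by simp
  also have "\<dots> = of_real ((cmod c * norm \<xi>)\<^sup>2)"
    by (simp only: cinner_self complex_norm_square[symmetric] power_mult_distrib of_real_mult)
  finally show ?thesis
    by (metis of_real_eq_iff power2_eq_iff_nonneg norm_ge_zero mult_nonneg_nonneg)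
qed

lemma ex_unit_rotation: "\<exists>u. cmod u = 1 \<and> u * z = of_real (cmod z)"
proof (cases "z = 0")
  case True
  then show ?thesis by (intro exI[of _ 1]) auto
next
  case False
  then have "cnj z / of_real (cmod z) * z = of_real (cmod z)"
    using complex_norm_square[of z] by (simp add: power2_eq_square mult.commute divide_eq_eq)
  with False show ?thesis
    by (intro exI[of _ "cnj z / of_real (cmod z)"]) (simp add: norm_divide)
qed

lemma cmod_cinner_le: "cmod (cinner \<xi> \<eta>) \<le> norm \<xi> * norm \<eta>"
proof -
  obtain u where u: "cmod u = 1" "u * cinner \<xi> \<eta> = of_real (cmod (cinner \<xi> \<eta>))"
    using ex_unit_rotation by blast
  have "cmod (cinner \<xi> \<eta>) = inner \<xi> (u *\<^sub>c \<eta>)"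
    unfolding inner_eq_Re_cinner using u by simp
  also have "\<dots> \<le> norm \<xi> * norm (u *\<^sub>c \<eta>)"
    by (rule norm_cauchy_schwarz)
  finally show ?thesis using u by simp
qed

section \<open>Indefinite integrals and weak derivatives on the circle\<close>

lemma circ_eq_density: "circ = density lborel (\<lambda>x. ennreal (indicat_real {0..<2 * pi} x / (2 * pi)))"
  unfolding circ_def uniform_measure_def
  by (rule density_cong) (auto simp: indicator_def divide_ennreal simp flip: ennreal_1)

lemma set_integrable_square_integrable:
  assumes "square_integrable g"
  shows "set_integrable lborel {0..<2 * pi} g"
proof -
  have [measurable]: "g \<in> borel_measurable borel"
    using assms by (simp add: square_integrable_def)
  have "integrable circ g"
    using square_integrable_cnj_mult[OF _ assms, of "\<lambda>_. 1"] square_integrable_bounded[of "\<lambda>_. 1" 1]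
    by simp
  then have "integrable (density lborel (\<lambda>x. ennreal (indicat_real {0..<2 * pi} x / (2 * pi)))) g"
    by (simp only: circ_eq_density)
  then have "integrable lborel (\<lambda>x. (indicat_real {0..<2 * pi} x / (2 * pi)) *\<^sub>R g x)"
    by (subst (asm) integrable_density) auto
  then have "integrable lborel (\<lambda>x. (2 * pi) *\<^sub>R (indicat_real {0..<2 * pi} x / (2 * pi)) *\<^sub>R g x)"
    by (rule integrable_scaleR_right)
  then show ?thesis
    by (simp add: set_integrable_def)
qed

lemma set_lebesgue_integral_restrict:
  fixes f :: "real \<Rightarrow> complex"
  assumes "A \<subseteq> B"
  shows "(LINT t:A|lborel. f t) = (LINT t:A|lborel. indicat_real B t *\<^sub>R f t)"
  unfolding set_lebesgue_integral_def using assms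
  by (intro Bochner_Integration.integral_cong) (auto simp: indicator_def)

text \<open>The exceptional set is open, and a nonempty open set is not null.\<close>

lemma continuous_AE_const:
  fixes \<phi> :: "real \<Rightarrow> complex"
  assumes cont: "continuous_on {a..b} \<phi>" and ab: "a < b"
    and AE: "AE x in lborel. x \<in> {a..<b} \<longrightarrow> \<phi> x = c" and x: "x \<in> {a..b}"
  shows "\<phi> x = c"
proof -
  define U where "U = {y \<in> {a<..<b}. \<phi> y \<in> - {c}}"
  have "open U"
    unfolding U_def
    by (rule continuous_open_preimage[folded vimage_def, simplified Int_def vimage_def mem_Collect_eq, of "{a<..<b}" \<phi> "- {c}"])
       (auto intro: continuous_on_subset[OF cont])
  have "U \<in> null_sets lborel"
  proof -
    from AE have "AE x in lborel. x \<notin> U"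
      by eventually_elim (auto simp: U_def)
    then show ?thesis
      using \<open>open U\<close> by (subst (asm) AE_iff_null_sets[symmetric]) auto
  qed
  then have "negligible U"
    by (simp add: negligible_iff_null_sets null_sets_completionI)
  then have "U = {}"
    using open_not_negligible[OF \<open>open U\<close>] by blast
  then have "\<phi> y = c" if "y \<in> {a<..<b}" for y
    using that by (auto simp: U_def)
  moreover have "closure {a<..<b} = {a..b}"
    using ab by simp
  ultimately show ?thesis
    using continuous_constant_on_closure[of "{a<..<b}" \<phi> c x] cont x by auto
qed

text \<open>Initial segments are closed under intersection and generate the Borel sets, so the vanishing of
  the integral spreads from them to all Borel sets.\<close>

lemma AE_zero_of_initial_segments:
  fixes H :: "real \<Rightarrow> complex"
  assumes H: "integrable lborel H" and total: "integral\<^sup>L lborel H = 0"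
    and seg: "\<And>a. (LINT t:{..a}|lborel. H t) = 0"
  shows "AE t in lborel. H t = 0"
proof (rule sigma_finite_measure.density_zero[OF sigma_finite_lborel H])
  have [measurable]: "H \<in> borel_measurable borel" using H by auto
  fix A :: "real set" assume "A \<in> sets lborel"
  then have A: "A \<in> sigma_sets UNIV (range (\<lambda>a. {..a}))"
    by (subst sets_measure_of[symmetric]) (auto simp: borel_eq_atMost)
  have "Int_stable (range (\<lambda>a::real. {..a}))"
    by (auto simp: Int_stable_def)
  moreover have "range (\<lambda>a::real. {..a}) \<subseteq> Pow UNIV"
    by simp
  moreover note A
  ultimately show "(LINT t:A|lborel. H t) = 0"
  proof (induction rule: sigma_sets_induct_disjoint)
    case (basic A)
    then show ?case using seg by auto
  next
    case empty
    then show ?case by (simp add: set_lebesgue_integral_def)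
  next
    case (compl A)
    then have [measurable]: "A \<in> sets borel"
      by (simp add: borel_eq_atMost)
    have "set_integrable lborel B H" if "B \<in> sets borel" for B
      unfolding set_integrable_def by (rule integrable_mult_indicator) (use H that in auto)
    then have "(LINT t:A \<union> (UNIV - A)|lborel. H t) = (LINT t:A|lborel. H t) + (LINT t:UNIV - A|lborel. H t)"
      by (intro set_integral_Un) auto
    also have "(LINT t:A \<union> (UNIV - A)|lborel. H t) = integral\<^sup>L lborel H"
      by (simp add: set_lebesgue_integral_def)
    finally have "integral\<^sup>L lborel H = (LINT t:A|lborel. H t) + (LINT t:UNIV - A|lborel. H t)" .
    then show ?case using compl total by simp
  next
    case (union A)
    then have [measurable]: "\<And>i. A i \<in> sets borel"
      by (auto simp: borel_eq_atMost)
    have "(LINT t:(\<Union>i. A i)|lborel. H t) = (\<Sum>i. (LINT t:A i|lborel. H t))"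
    proof (rule lebesgue_integral_countable_add)
      show "set_integrable lborel (\<Union>i. A i) H"
        unfolding set_integrable_def by (rule integrable_mult_indicator) (use H in auto)
    qed (use union in \<open>auto simp: disjoint_family_on_def\<close>)
    then show ?case using union by simp
  qed
qed

lemma continuous_on_indefinite_LINT:
  fixes h :: "real \<Rightarrow> complex"
  assumes h: "set_integrable lborel {0..<b} h" and [measurable]: "h \<in> borel_measurable borel"
  shows "continuous_on {0..b} (\<lambda>x. LINT t:{0..x}|lborel. h t)"
proof -
  let ?H = "\<lambda>t. indicat_real {0..<b} t *\<^sub>R h t"
  have H: "integrable lborel ?H"
    using h by (simp add: set_integrable_def)
  have H': "set_integrable lborel {0..x} ?H" for x
    unfolding set_integrable_def by (rule integrable_mult_indicator) (use H in auto)
  have eq: "(LINT t:{0..x}|lborel. h t) = integral {0..x} ?H" if "x \<in> {0..b}" for x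
  proof -
    have "(LINT t:{0..x}|lborel. h t) = (LINT t:{0..x}|lborel. ?H t)"
      unfolding set_lebesgue_integral_def
    proof (rule integral_cong_AE)
      have "AE t in lborel. t \<noteq> b" by (rule AE_lborel_singleton)
      then show "AE t in lborel. indicat_real {0..x} t *\<^sub>R h t = indicat_real {0..x} t *\<^sub>R ?H t"
        by eventually_elim (use that in \<open>auto simp: indicator_def\<close>)
    qed measurable
    then show ?thesis
      using set_borel_integral_eq_integral(2)[OF H'] by simp
  qed
  have "continuous_on {0..b} (\<lambda>x. integral {0..x} ?H)"
    by (rule indefinite_integral_continuous_1) (use set_borel_integral_eq_integral(1)[OF H'] in auto)
  then show ?thesis
    by (rule continuous_on_eq) (use eq in auto)
qed

text \<open>This is what makes the weak derivative unique. The constant \<open>c\<close> is zero, because the indefinite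
  integral is continuous and vanishes at \<open>0\<close>.\<close>

lemma indefinite_LINT_inject:
  fixes h :: "real \<Rightarrow> complex"
  assumes h: "set_integrable lborel {0..<b} h" "h \<in> borel_measurable borel" and b: "0 < b"
    and total: "(LINT t:{0..<b}|lborel. h t) = 0"
    and AE: "AE x in lborel. x \<in> {0..<b} \<longrightarrow> (LINT t:{0..x}|lborel. h t) = c"
  shows "AE t in lborel. t \<in> {0..<b} \<longrightarrow> h t = 0"
proof -
  let ?H = "\<lambda>t. indicat_real {0..<b} t *\<^sub>R h t"
  have H: "integrable lborel ?H"
    using h(1) by (simp add: set_integrable_def)
  have const: "(LINT t:{0..x}|lborel. h t) = c" if "x \<in> {0..b}" for x
    by (rule continuous_AE_const[OF continuous_on_indefinite_LINT[OF h] b AE that])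
  have "(LINT t:{0..0}|lborel. h t) = 0"
    unfolding set_lebesgue_integral_def
    by (rule integral_eq_zero_AE, rule AE_mp[OF AE_lborel_singleton[of 0]]) (auto simp: indicator_def)
  then have zero: "(LINT t:{0..x}|lborel. h t) = 0" if "x \<in> {0..b}" for x
    using const[of 0] const[OF that] b by auto
  have "AE t in lborel. ?H t = 0"
  proof (rule AE_zero_of_initial_segments[OF H])
    show tot: "integral\<^sup>L lborel ?H = 0"
      using total by (simp add: set_lebesgue_integral_def)
    fix a
    consider "a < 0" | "0 \<le> a" "a < b" | "b \<le> a" by linarith
    then show "(LINT t:{..a}|lborel. ?H t) = 0"
    proof cases
      case 1
      then have "(LINT t:{..a}|lborel. ?H t) = (LINT t::real|lborel. 0)"
        unfolding set_lebesgue_integral_def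
        by (intro Bochner_Integration.integral_cong) (auto simp: indicator_def)
      then show ?thesis by simp
    next
      case 2
      then have "(LINT t:{..a}|lborel. ?H t) = (LINT t:{0..a}|lborel. h t)"
        unfolding set_lebesgue_integral_def
        by (intro Bochner_Integration.integral_cong) (auto simp: indicator_def)
      then show ?thesis using zero 2 by simp
    next
      case 3
      then have "(LINT t:{..a}|lborel. ?H t) = integral\<^sup>L lborel ?H"
        unfolding set_lebesgue_integral_def
        by (intro Bochner_Integration.integral_cong) (auto simp: indicator_def)
      then show ?thesis using tot by simp
    qed
  qed
  then show ?thesis
    by eventually_elim (auto simp: indicator_def split: if_splits)
qed

text \<open>Integration by parts for an indefinite integral that need not be differentiable everywhere:
  both sides are the integral of \<open>f' t * G s\<close> over the triangle \<open>0 \<le> s \<le> t \<le> x\<close>.\<close>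

lemma LINT_by_parts:
  fixes f f' G :: "real \<Rightarrow> complex"
  assumes G: "integrable lborel G"
    and f: "\<And>t. (f has_vector_derivative f' t) (at t)" and f': "continuous_on UNIV f'"
    and x: "0 \<le> x"
  shows "(LINT t:{0..x}|lborel. f' t * (LINT s:{0..t}|lborel. G s)) =
    (LINT s:{0..x}|lborel. (f x - f s) * G s)"
proof -
  have [measurable]: "G \<in> borel_measurable borel" "f' \<in> borel_measurable borel"
    using G f' by (auto intro: borel_measurable_continuous_onI)
  have f'_int: "set_integrable lborel {a..b} f'" for a b
    by (rule borel_integrable_atLeastAtMost'[OF continuous_on_subset[OF f']]) auto
  let ?F = "\<lambda>t. indicat_real {0..x} t *\<^sub>R f' t"
  let ?T = "{p::real \<times> real. 0 \<le> snd p \<and> snd p \<le> fst p}"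
  have "closed ?T"
    by (intro closed_Collect_conj closed_Collect_le continuous_intros)
  then have T[measurable]: "?T \<in> sets (lborel \<Otimes>\<^sub>M lborel)"
    unfolding lborel_prod by auto
  have "integrable (lborel \<Otimes>\<^sub>M lborel) (\<lambda>p. ?F (fst p) * G (snd p))"
  proof (rule lborel_pair.Fubini_integrable)
    show "integrable lborel (\<lambda>t. LINT s|lborel. norm (?F (fst (t, s)) * G (snd (t, s))))"
      unfolding fst_conv snd_conv norm_mult Bochner_Integration.integral_mult_right_zero
      using integrable_norm[OF f'_int[of 0 x, unfolded set_integrable_def]]
      by (rule Bochner_Integration.integrable_mult_left)
    show "AE t in lborel. integrable lborel (\<lambda>s. ?F (fst (t, s)) * G (snd (t, s)))"
      using G by simp
  qed measurable
  then have "integrable (lborel \<Otimes>\<^sub>M lborel) (\<lambda>p. indicat_real ?T p *\<^sub>R (?F (fst p) * G (snd p)))"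
    by (rule integrable_mult_indicator[OF T])
  then have "integrable (lborel \<Otimes>\<^sub>M lborel) (\<lambda>(t, s). indicat_real ?T (t, s) *\<^sub>R (?F t * G s))"
    by (simp only: case_prod_beta' prod.collapse)
  from lborel_pair.Fubini_integral[OF this]
  have *: "(LINT s|lborel. LINT t|lborel. indicat_real ?T (t, s) *\<^sub>R (?F t * G s)) =
      (LINT t|lborel. LINT s|lborel. indicat_real ?T (t, s) *\<^sub>R (?F t * G s))" .
  have 1: "(LINT s|lborel. indicat_real ?T (t, s) *\<^sub>R (?F t * G s)) =
      indicat_real {0..x} t *\<^sub>R (f' t * (LINT s:{0..t}|lborel. G s))" for t
  proof -
    have "(LINT s|lborel. indicat_real ?T (t, s) *\<^sub>R (?F t * G s)) =
      (LINT s|lborel. ?F t * (indicat_real {0..t} s *\<^sub>R G s))"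
      by (rule Bochner_Integration.integral_cong) (auto simp: indicator_def)
    then show ?thesis
      unfolding Bochner_Integration.integral_mult_right_zero by (simp add: set_lebesgue_integral_def)
  qed
  have 2: "(LINT t|lborel. indicat_real ?T (t, s) *\<^sub>R (?F t * G s)) =
      indicat_real {0..x} s *\<^sub>R ((f x - f s) * G s)" for s
  proof (cases "s \<in> {0..x}")
    case True
    have "(LINT t|lborel. indicat_real ?T (t, s) *\<^sub>R (?F t * G s)) =
      (LINT t|lborel. (indicat_real {s..x} t *\<^sub>R f' t) * G s)"
      using True by (intro Bochner_Integration.integral_cong) (auto simp: indicator_def)
    also have "\<dots> = (LINT t|lborel. indicat_real {s..x} t *\<^sub>R f' t) * G s"
      by (rule Bochner_Integration.integral_mult_left_zero)
    also have "(LINT t|lborel. indicat_real {s..x} t *\<^sub>R f' t) = f x - f s"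
      by (rule integral_FTC_atLeastAtMost)
         (use True f f' in \<open>auto intro: has_vector_derivative_at_within continuous_on_subset\<close>)
    finally show ?thesis using True by simp
  next
    case False
    then have "(LINT t|lborel. indicat_real ?T (t, s) *\<^sub>R (?F t * G s)) = (LINT t::real|lborel. 0)"
      by (intro Bochner_Integration.integral_cong) (auto simp: indicator_def)
    then show ?thesis using False by simp
  qed
  show ?thesis
    using * unfolding 1 2 by (simp add: set_lebesgue_integral_def)
qed


lemma has_L2_deriv_unique:
  assumes "has_L2_deriv \<xi> \<eta>" "has_L2_deriv \<xi> \<zeta>"
  shows "\<eta> = \<zeta>"
  using assms
proof transfer
  fix f g h
  assume rel: "l2_rel f f" "l2_rel g g" "l2_rel h h"
  assume "(LINT t:{0..<2 * pi}|lborel. g t) = 0 \<and> (\<exists>c. AE x in circ. f x = c + (LINT t:{0..x}|lborel. g t))"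
    and "(LINT t:{0..<2 * pi}|lborel. h t) = 0 \<and> (\<exists>c. AE x in circ. f x = c + (LINT t:{0..x}|lborel. h t))"
  then obtain c d where g: "(LINT t:{0..<2 * pi}|lborel. g t) = 0" "AE x in circ. f x = c + (LINT t:{0..x}|lborel. g t)"
    and h: "(LINT t:{0..<2 * pi}|lborel. h t) = 0" "AE x in circ. f x = d + (LINT t:{0..x}|lborel. h t)"
    by blast
  have sq: "square_integrable g" "square_integrable h"
    using rel by (auto simp: l2_rel_def)
  have [measurable]: "g \<in> borel_measurable borel" "h \<in> borel_measurable borel"
    using sq by (auto simp: square_integrable_def)
  have int: "set_integrable lborel {0..<2 * pi} g" "set_integrable lborel {0..<2 * pi} h"
    using sq by (auto intro: set_integrable_square_integrable)
  have int': "set_integrable lborel {0..x} g" "set_integrable lborel {0..x} h" if "x < 2 * pi" for x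
    using that by (auto intro: set_integrable_subset[OF int(1)] set_integrable_subset[OF int(2)])
  have "AE t in lborel. t \<in> {0..<2 * pi} \<longrightarrow> g t - h t = 0"
  proof (rule indefinite_LINT_inject)
    show "set_integrable lborel {0..<2 * pi} (\<lambda>t. g t - h t)"
      by (rule set_integral_diff(1)[OF int])
    show "(LINT t:{0..<2 * pi}|lborel. g t - h t) = 0"
      using g h by (simp add: set_integral_diff(2)[OF int])
    show "AE x in lborel. x \<in> {0..<2 * pi} \<longrightarrow> (LINT t:{0..x}|lborel. g t - h t) = d - c"
      using g(2) h(2) unfolding AE_circ
    proof eventually_elim
      case (elim x)
      show ?case
        using elim by (auto simp: set_integral_diff(2)[OF int'] algebra_simps)
    qed
  qed auto
  then show "l2_rel g h"
    using sq by (auto simp: l2_rel_def AE_circ)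
qed

lemma D_op_eqI: "has_L2_deriv \<xi> \<eta> \<Longrightarrow> D_op \<xi> = (- \<i>) *\<^sub>c \<eta>"
  unfolding D_op_def using has_L2_deriv_unique by (metis the_equality)

lemma cont_circle_square_integrable:
  assumes "f \<in> cont_circle"
  shows "square_integrable f"
  using cont_circle_mult[OF assms square_integrable_bounded[of "\<lambda>_. 1" 1]] by simp

text \<open>The Leibniz rule. On representatives, with \<open>u = c + \<integral> g\<close> almost everywhere, it reads
  \<open>f u = f 0 * c + \<integral> (f' u + f g)\<close> and follows by integrating \<open>f' * \<integral> g\<close> by parts. The integral over a whole
  period vanishes because both \<open>f\<close> and \<open>u\<close> are periodic.\<close>

lemma has_L2_deriv_mult_op:
  assumes f: "f \<in> cont_circle" and f': "f' \<in> cont_circle"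
    and deriv: "\<And>t. (f has_vector_derivative f' t) (at t)"
  assumes "has_L2_deriv \<xi> \<eta>"
  shows "has_L2_deriv (mult_op f \<xi>) (mult_op f' \<xi> + mult_op f \<eta>)"
  using assms
proof (transfer fixing: f f')
  fix u g
  assume rel: "l2_rel u u" "l2_rel g g"
  assume "(LINT t:{0..<2 * pi}|lborel. g t) = 0 \<and> (\<exists>c. AE x in circ. u x = c + (LINT t:{0..x}|lborel. g t))"
  then obtain c where g: "(LINT t:{0..<2 * pi}|lborel. g t) = 0"
    and u: "AE x in circ. u x = c + (LINT t:{0..x}|lborel. g t)"
    by blast
  have sq: "square_integrable g" "square_integrable u"
    using rel by (auto simp: l2_rel_def)
  have [measurable]: "g \<in> borel_measurable borel" "u \<in> borel_measurable borel"
    using sq by (auto simp: square_integrable_def)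
  \<comment> \<open>Extension by zero makes the integrand globally integrable; over \<open>[0, x]\<close> with \<open>x < 2\<pi>\<close> nothing changes.\<close>
  define G where "G = (\<lambda>t. indicat_real {0..<2 * pi} t *\<^sub>R g t)"
  have G: "integrable lborel G"
    using set_integrable_square_integrable[OF sq(1)] by (simp add: set_integrable_def G_def)
  then have [measurable]: "G \<in> borel_measurable borel" by auto
  have G_int: "set_integrable lborel {0..x} G" for x
    unfolding set_integrable_def by (rule integrable_mult_indicator) (use G in auto)
  define k where "k = (\<lambda>t. f' t * u t + f t * g t)"
  have sqk: "square_integrable (\<lambda>t. f' t * u t)" "square_integrable (\<lambda>t. f t * g t)"
    using sq f f' by (auto intro: cont_circle_mult)
  have k: "set_integrable lborel {0..<2 * pi} k"
    unfolding k_def by (intro set_integrable_square_integrable square_integrable_add sqk)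
  have cont: "continuous_on S f" "continuous_on S f'" for S
    using f f' by (auto simp: cont_circle_def intro: continuous_on_subset)
  have [measurable]: "f \<in> borel_measurable borel" "f' \<in> borel_measurable borel"
    using cont by (auto intro: borel_measurable_continuous_onI)
  have FTC: "(LINT t:{0..x}|lborel. f' t) = f x - f 0" if "0 \<le> x" for x
    unfolding set_lebesgue_integral_def
    by (rule integral_FTC_atLeastAtMost) (use that deriv cont in \<open>auto intro: has_vector_derivative_at_within\<close>)
  have f'_int: "set_integrable lborel {0..x} f'" for x
    by (rule borel_integrable_atLeastAtMost'[OF cont(2)])
  have fG: "integrable lborel (\<lambda>s. f s * G s)"
    using set_integrable_square_integrable[OF sqk(2)] by (simp add: set_integrable_def G_def mult_ac)
  then have fG_int: "set_integrable lborel {0..x} (\<lambda>s. f s * G s)" for x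
    unfolding set_integrable_def by (rule integrable_mult_indicator[rotated]) auto
  have fbG: "set_integrable lborel {0..x} (\<lambda>t. f' t * (LINT s:{0..t}|lborel. G s))" for x
  proof -
    have "continuous_on {0..x} (\<lambda>t. LINT s:{0..t}|lborel. G s)"
      by (rule continuous_on_indefinite_LINT[OF set_integrable_subset[OF G_int[of x]]]) auto
    then show ?thesis
      by (intro borel_integrable_atLeastAtMost' continuous_intros cont)
  qed
  have int_k: "(LINT t:{0..x}|lborel. k t) = f x * (c + (LINT s:{0..x}|lborel. G s)) - f 0 * c"
    if x: "x \<in> {0..2 * pi}" for x
  proof -
    have sum_int: "set_integrable lborel {0..x} (\<lambda>t. c * f' t + f' t * (LINT s:{0..t}|lborel. G s) + f t * G t)"
      by (intro set_integral_add(1) set_integrable_mult_right fG_int fbG f'_int)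
    have "(LINT t:{0..x}|lborel. k t) =
        (LINT t:{0..x}|lborel. c * f' t + f' t * (LINT s:{0..t}|lborel. G s) + f t * G t)"
      unfolding set_lebesgue_integral_def
    proof (rule integral_cong_AE)
      have "AE t in lborel. t \<noteq> 2 * pi" by (rule AE_lborel_singleton)
      with u show "AE t in lborel. indicat_real {0..x} t *\<^sub>R k t =
        indicat_real {0..x} t *\<^sub>R (c * f' t + f' t * (LINT s|lborel. indicat_real {0..t} s *\<^sub>R G s) + f t * G t)"
        unfolding AE_circ
      proof eventually_elim
        case (elim t)
        show ?case
        proof (cases "t \<in> {0..x}")
          case True
          then have t: "t \<in> {0..<2 * pi}" using elim x by auto
          have "(LINT s:{0..t}|lborel. g s) = (LINT s:{0..t}|lborel. G s)"
            unfolding G_def by (rule set_lebesgue_integral_restrict) (use t in auto)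
          then show ?thesis
            using elim t by (simp add: k_def set_lebesgue_integral_def algebra_simps) (simp add: G_def)
        qed auto
      qed
    qed (use sum_int in \<open>auto simp: k_def set_integrable_def set_lebesgue_integral_def\<close>)
    also have "\<dots> = c * (f x - f 0) + (LINT s:{0..x}|lborel. (f x - f s) * G s) + (LINT s:{0..x}|lborel. f s * G s)"
      using x by (simp add: set_integral_add fG_int fbG f'_int FTC LINT_by_parts[OF G deriv cont(2)])
    also have "(LINT s:{0..x}|lborel. (f x - f s) * G s) = f x * (LINT s:{0..x}|lborel. G s) - (LINT s:{0..x}|lborel. f s * G s)"
      by (simp add: left_diff_distrib set_integral_diff G_int fG_int)
    finally show ?thesis
      by (simp add: algebra_simps)
  qed
  have "(LINT t:{0..<2 * pi}|lborel. k t) = 0 \<and>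
      (\<exists>c. AE x in circ. f x * u x = c + (LINT t:{0..x}|lborel. k t))"
  proof
    have ae: "AE t in lborel. indicat_real {0..<2 * pi} t *\<^sub>R (w t :: complex) = indicat_real {0..2 * pi} t *\<^sub>R w t" for w
      by (rule AE_mp[OF AE_lborel_singleton[of "2 * pi"]]) (auto simp: indicator_def)
    have "(LINT t:{0..<2 * pi}|lborel. k t) = (LINT t:{0..2 * pi}|lborel. k t)"
      unfolding set_lebesgue_integral_def by (rule integral_cong_AE[OF _ _ ae]) (auto simp: k_def)
    also have "\<dots> = f (2 * pi) * (c + (LINT s:{0..2 * pi}|lborel. G s)) - f 0 * c"
      by (rule int_k) auto
    also have "(LINT s:{0..2 * pi}|lborel. G s) = (LINT s:{0..<2 * pi}|lborel. g s)"
      unfolding set_lebesgue_integral_def G_def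
      by (rule Bochner_Integration.integral_cong) (auto simp: indicator_def)
    also have "f (2 * pi) = f 0"
      using f by (auto simp: cont_circle_def dest: spec[of _ 0])
    finally show "(LINT t:{0..<2 * pi}|lborel. k t) = 0"
      using g by simp
    show "\<exists>c. AE x in circ. f x * u x = c + (LINT t:{0..x}|lborel. k t)"
    proof
      show "AE x in circ. f x * u x = f 0 * c + (LINT t:{0..x}|lborel. k t)"
        using u unfolding AE_circ
      proof eventually_elim
        case (elim x)
        have "(LINT s:{0..x}|lborel. g s) = (LINT s:{0..x}|lborel. G s)" if "x \<in> {0..<2 * pi}"
          unfolding G_def by (rule set_lebesgue_integral_restrict) (use that in auto)
        with elim show ?case by (auto simp: int_k)
      qed
    qed
  qed
  then show "(LINT t:{0..<2 * pi}|lborel. (if f' \<in> cont_circle then f' t * u t else 0) +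
        (if f \<in> cont_circle then f t * g t else 0)) = 0 \<and>
      (\<exists>c. AE x in circ. (if f \<in> cont_circle then f x * u x else 0) =
         c + (LINT t:{0..x}|lborel. (if f' \<in> cont_circle then f' t * u t else 0) +
           (if f \<in> cont_circle then f t * g t else 0)))"
    using f f' by (simp add: k_def)
qed

lemma integral_circ:
  assumes "square_integrable g"
  shows "integral\<^sup>L circ g = (LINT t:{0..<2 * pi}|lborel. g t) / (2 * pi)"
proof -
  have [measurable]: "g \<in> borel_measurable borel"
    using assms by (simp add: square_integrable_def)
  have "integral\<^sup>L circ g = integral\<^sup>L (density lborel (\<lambda>x. ennreal (indicat_real {0..<2 * pi} x / (2 * pi)))) g"
    by (simp only: circ_eq_density)
  also have "\<dots> = (LINT x|lborel. (indicat_real {0..<2 * pi} x / (2 * pi)) *\<^sub>R g x)"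
    by (rule integral_density) auto
  also have "\<dots> = (LINT x|lborel. (1 / (2 * pi)) *\<^sub>R (indicat_real {0..<2 * pi} x *\<^sub>R g x))"
    by (rule Bochner_Integration.integral_cong) auto
  also have "\<dots> = (1 / (2 * pi)) *\<^sub>R (LINT x|lborel. indicat_real {0..<2 * pi} x *\<^sub>R g x)"
    by (rule integral_scaleR_right)
  finally show ?thesis
    by (simp add: set_lebesgue_integral_def scaleR_conv_of_real)
qed

lemma has_L2_deriv_add:
  assumes "has_L2_deriv \<xi> \<eta>" "has_L2_deriv \<xi>' \<eta>'"
  shows "has_L2_deriv (\<xi> + \<xi>') (\<eta> + \<eta>')"
  using assms
proof transfer
  fix f g f' g'
  assume rel: "l2_rel f f" "l2_rel g g" "l2_rel f' f'" "l2_rel g' g'"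
  assume "(LINT t:{0..<2 * pi}|lborel. g t) = 0 \<and> (\<exists>c. AE x in circ. f x = c + (LINT t:{0..x}|lborel. g t))"
    and "(LINT t:{0..<2 * pi}|lborel. g' t) = 0 \<and> (\<exists>c. AE x in circ. f' x = c + (LINT t:{0..x}|lborel. g' t))"
  then obtain c d where g: "(LINT t:{0..<2 * pi}|lborel. g t) = 0" "AE x in circ. f x = c + (LINT t:{0..x}|lborel. g t)"
    and h: "(LINT t:{0..<2 * pi}|lborel. g' t) = 0" "AE x in circ. f' x = d + (LINT t:{0..x}|lborel. g' t)"
    by blast
  have int: "set_integrable lborel {0..<2 * pi} g" "set_integrable lborel {0..<2 * pi} g'"
    using rel by (auto intro: set_integrable_square_integrable simp: l2_rel_def)
  have int': "set_integrable lborel {0..x} g" "set_integrable lborel {0..x} g'" if "x < 2 * pi" for x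
    using that by (auto intro: set_integrable_subset[OF int(1)] set_integrable_subset[OF int(2)])
  have "(LINT t:{0..<2 * pi}|lborel. g t + g' t) = 0"
    using g h by (simp add: set_integral_add(2)[OF int])
  moreover have "AE x in circ. f x + f' x = c + d + (LINT t:{0..x}|lborel. g t + g' t)"
    using g(2) h(2) unfolding AE_circ
  proof eventually_elim
    case (elim x)
    show ?case
      using elim by (auto simp: set_integral_add(2)[OF int'])
  qed
  ultimately show "(LINT t:{0..<2 * pi}|lborel. g t + g' t) = 0 \<and>
      (\<exists>c. AE x in circ. f x + f' x = c + (LINT t:{0..x}|lborel. g t + g' t))"
    by blast
qed

lemma has_L2_deriv_cscale:
  assumes "has_L2_deriv \<xi> \<eta>"
  shows "has_L2_deriv (a *\<^sub>c \<xi>) (a *\<^sub>c \<eta>)"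
  using assms
proof (transfer fixing: a)
  fix f g :: "real \<Rightarrow> complex"
  assume "(LINT t:{0..<2 * pi}|lborel. g t) = 0 \<and> (\<exists>c. AE x in circ. f x = c + (LINT t:{0..x}|lborel. g t))"
  then obtain c where g: "(LINT t:{0..<2 * pi}|lborel. g t) = 0" "AE x in circ. f x = c + (LINT t:{0..x}|lborel. g t)"
    by blast
  have "AE x in circ. a * f x = a * c + (LINT t:{0..x}|lborel. a * g t)"
    using g(2) by eventually_elim (simp add: algebra_simps)
  with g(1) show "(LINT t:{0..<2 * pi}|lborel. a * g t) = 0 \<and>
      (\<exists>c. AE x in circ. a * f x = c + (LINT t:{0..x}|lborel. a * g t))"
    by auto
qed

lemma has_L2_deriv_zero: "has_L2_deriv 0 0"
  by (transfer) (auto intro!: exI[of _ 0] simp: set_lebesgue_integral_def)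

lemma has_L2_deriv_sum:
  "(\<And>i. i \<in> I \<Longrightarrow> has_L2_deriv (f i) (g i)) \<Longrightarrow> has_L2_deriv (\<Sum>i\<in>I. f i) (\<Sum>i\<in>I. g i)"
  by (induction I rule: infinite_finite_induct) (auto intro: has_L2_deriv_add has_L2_deriv_zero)

section \<open>Multiplication operators\<close>

lemma cont_circle_const: "(\<lambda>x. c) \<in> cont_circle"
  by (simp add: cont_circle_def)

lemma cont_circle_add: "f \<in> cont_circle \<Longrightarrow> g \<in> cont_circle \<Longrightarrow> (\<lambda>x. f x + g x) \<in> cont_circle"
  by (auto simp: cont_circle_def intro!: continuous_intros)

lemma cont_circle_cmult: "f \<in> cont_circle \<Longrightarrow> (\<lambda>x. c * f x) \<in> cont_circle"
  by (auto simp: cont_circle_def intro!: continuous_intros)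

lemma cont_circle_diff: "f \<in> cont_circle \<Longrightarrow> g \<in> cont_circle \<Longrightarrow> (\<lambda>x. f x - g x) \<in> cont_circle"
  by (auto simp: cont_circle_def intro!: continuous_intros)

lemma cont_circle_cnj: "f \<in> cont_circle \<Longrightarrow> (\<lambda>x. cnj (f x)) \<in> cont_circle"
  by (auto simp: cont_circle_def intro!: continuous_intros)

lemma cont_circle_sum: "(\<And>i. i \<in> I \<Longrightarrow> f i \<in> cont_circle) \<Longrightarrow> (\<lambda>x. \<Sum>i\<in>I. f i x) \<in> cont_circle"
  by (induction I rule: infinite_finite_induct) (auto intro: cont_circle_add cont_circle_const)

lemma mult_op_add_fun:
  "f \<in> cont_circle \<Longrightarrow> g \<in> cont_circle \<Longrightarrow> mult_op (\<lambda>x. f x + g x) \<xi> = mult_op f \<xi> + mult_op g \<xi>"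
  by (transfer) (auto simp: l2_rel_def cont_circle_add algebra_simps intro!: square_integrable_add cont_circle_mult)

lemma mult_op_diff_fun:
  "f \<in> cont_circle \<Longrightarrow> g \<in> cont_circle \<Longrightarrow> mult_op (\<lambda>x. f x - g x) \<xi> = mult_op f \<xi> - mult_op g \<xi>"
  by (transfer) (auto simp: l2_rel_def cont_circle_diff algebra_simps intro!: square_integrable_diff cont_circle_mult)

lemma mult_op_cmult_fun:
  "f \<in> cont_circle \<Longrightarrow> mult_op (\<lambda>x. c * f x) \<xi> = c *\<^sub>c mult_op f \<xi>"
  by (transfer) (auto simp: l2_rel_def cont_circle_cmult mult.assoc intro!: square_integrable_cmult cont_circle_mult)

lemma mult_op_const: "mult_op (\<lambda>x. c) \<xi> = c *\<^sub>c \<xi>"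
  by (transfer) (auto simp: l2_rel_def cont_circle_const intro!: square_integrable_cmult)

lemma mult_op_sum_fun:
  "(\<And>i. i \<in> I \<Longrightarrow> f i \<in> cont_circle) \<Longrightarrow> mult_op (\<lambda>x. \<Sum>i\<in>I. f i x) \<xi> = (\<Sum>i\<in>I. mult_op (f i) \<xi>)"
  by (induction I rule: infinite_finite_induct)
     (auto simp: mult_op_const mult_op_add_fun cont_circle_sum)

lemma mult_op_add: "mult_op f (\<xi> + \<eta>) = mult_op f \<xi> + mult_op f \<eta>"
proof (transfer fixing: f)
  fix g h assume "l2_rel g g" "l2_rel h h"
  then have gh: "square_integrable g" "square_integrable h" by (simp_all add: l2_rel_def)
  have "(\<lambda>x. if f \<in> cont_circle then f x * (g x + h x) else 0) =
      (\<lambda>x. (if f \<in> cont_circle then f x * g x else 0) + (if f \<in> cont_circle then f x * h x else 0))"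
    by (auto simp: distrib_left)
  moreover have "square_integrable (\<lambda>x. if f \<in> cont_circle then f x * w x else 0)"
    if "square_integrable w" for w
    by (cases "f \<in> cont_circle") (auto simp: cont_circle_mult[OF _ that] square_integrable_0)
  ultimately show "l2_rel (\<lambda>x. if f \<in> cont_circle then f x * (g x + h x) else 0)
      (\<lambda>x. (if f \<in> cont_circle then f x * g x else 0) + (if f \<in> cont_circle then f x * h x else 0))"
    using gh by (simp only: l2_rel_refl_iff square_integrable_add)
qed

lemma mult_op_cscale: "mult_op f (c *\<^sub>c \<xi>) = c *\<^sub>c mult_op f \<xi>"
proof (transfer fixing: f c)
  fix g assume "l2_rel g g"
  then have g: "square_integrable g" by (simp add: l2_rel_def)
  have "(\<lambda>x. if f \<in> cont_circle then f x * (c * g x) else 0) =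
      (\<lambda>x. c * (if f \<in> cont_circle then f x * g x else 0))"
    by auto
  moreover have "square_integrable (\<lambda>x. if f \<in> cont_circle then f x * g x else 0)"
    by (cases "f \<in> cont_circle") (auto simp: cont_circle_mult[OF _ g] square_integrable_0)
  ultimately show "l2_rel (\<lambda>x. if f \<in> cont_circle then f x * (c * g x) else 0)
      (\<lambda>x. c * (if f \<in> cont_circle then f x * g x else 0))"
    by (simp only: l2_rel_refl_iff square_integrable_cmult)
qed

lemma cinner_mult_op_left:
  assumes "f \<in> cont_circle"
  shows "cinner (mult_op f \<xi>) \<eta> = cinner \<xi> (mult_op (\<lambda>x. cnj (f x)) \<eta>)"
  using assms cont_circle_cnj[OF assms] by (transfer fixing: f) (simp add: mult_ac)

lemma norm_square_L2: "(norm \<xi>)\<^sup>2 = Re (cinner \<xi> \<xi>)"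
  by (simp add: cinner_self)

text \<open>The link from pointwise to Hilbert space estimates. The squares and the constant \<open>A\<close> serve
  Fejer's theorem for functions that are merely continuous, where \<open>|f x - f t|\<close> is small only up to an error.\<close>

lemma norm_mult_op_le:
  assumes f: "f \<in> cont_circle" and g: "g \<in> cont_circle"
    and le: "\<And>t. (cmod (f t))\<^sup>2 \<le> A + B * (cmod (g t))\<^sup>2"
  shows "(norm (mult_op f \<xi>))\<^sup>2 \<le> A * (norm \<xi>)\<^sup>2 + B * (norm (mult_op g \<xi>))\<^sup>2"
  unfolding norm_square_L2
proof (use assms in \<open>transfer fixing: f g A B\<close>)
  fix u assume "l2_rel u u"
  then have u: "square_integrable u" by (simp add: l2_rel_def)
  have sq: "cnj z * z = of_real ((cmod z)\<^sup>2)" for z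
    by (simp add: complex_norm_square mult.commute flip: of_real_power)
  have int: "integrable circ (\<lambda>x. (cmod (u x))\<^sup>2)" "integrable circ (\<lambda>x. (cmod (f x * u x))\<^sup>2)"
    "integrable circ (\<lambda>x. (cmod (g x * u x))\<^sup>2)"
    using u cont_circle_mult[OF f u] cont_circle_mult[OF g u] by (auto simp: square_integrable_def)
  have "(\<integral>x. (cmod (f x * u x))\<^sup>2 \<partial>circ) \<le> (\<integral>x. A * (cmod (u x))\<^sup>2 + B * (cmod (g x * u x))\<^sup>2 \<partial>circ)"
  proof (rule integral_mono[OF int(2)])
    show "(cmod (f x * u x))\<^sup>2 \<le> A * (cmod (u x))\<^sup>2 + B * (cmod (g x * u x))\<^sup>2" for x
      using mult_right_mono[OF le[of x], of "(cmod (u x))\<^sup>2"]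
      by (simp add: norm_mult power_mult_distrib algebra_simps)
  qed (intro Bochner_Integration.integrable_add integrable_mult_right int)
  also have "\<dots> = A * (\<integral>x. (cmod (u x))\<^sup>2 \<partial>circ) + B * (\<integral>x. (cmod (g x * u x))\<^sup>2 \<partial>circ)"
    using int by simp
  finally show "Re (\<integral>x. cnj (if f \<in> cont_circle then f x * u x else 0) * (if f \<in> cont_circle then f x * u x else 0) \<partial>circ)
    \<le> A * Re (\<integral>x. cnj (u x) * u x \<partial>circ) +
      B * Re (\<integral>x. cnj (if g \<in> cont_circle then g x * u x else 0) * (if g \<in> cont_circle then g x * u x else 0) \<partial>circ)"
    using f g by (simp only: if_True sq integral_complex_of_real Re_complex_of_real)
qed

lemma norm_mult_op_bound:
  assumes f: "f \<in> cont_circle" and le: "\<And>t. cmod (f t) \<le> C"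
  shows "norm (mult_op f \<xi>) \<le> C * norm \<xi>"
proof -
  have C: "0 \<le> C" using le[of 0] norm_ge_zero order_trans by blast
  have "(norm (mult_op f \<xi>))\<^sup>2 \<le> C\<^sup>2 * (norm \<xi>)\<^sup>2 + 0 * (norm (mult_op f \<xi>))\<^sup>2"
    by (rule norm_mult_op_le[OF f f]) (use le in \<open>auto intro: power_mono\<close>)
  then show ?thesis
    using C by (auto intro: power2_le_imp_le[of _ "C * norm \<xi>"] simp: power_mult_distrib)
qed

lemma cinner_mult_op_nonneg:
  assumes f: "f \<in> cont_circle" and nn: "\<And>t. f t \<in> \<real>\<^sub>\<ge>\<^sub>0"
  shows "cinner \<xi> (mult_op f \<xi>) \<in> \<real>\<^sub>\<ge>\<^sub>0"
proof (use f in \<open>transfer fixing: f\<close>)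
  fix u :: "real \<Rightarrow> complex"
  have f_eq: "f x = of_real (cmod (f x))" for x
    using nn[of x] by (auto elim!: nonneg_Reals_cases)
  have "cnj (u x) * (f x * u x) = of_real (cmod (f x) * (cmod (u x))\<^sup>2)" for x
    using complex_norm_square[of "u x"] by (subst f_eq) (simp add: mult_ac)
  then have "(\<integral>x. cnj (u x) * (f x * u x) \<partial>circ) = of_real (\<integral>x. cmod (f x) * (cmod (u x))\<^sup>2 \<partial>circ)"
    by (simp only: integral_complex_of_real)
  moreover have "0 \<le> (\<integral>x. cmod (f x) * (cmod (u x))\<^sup>2 \<partial>circ)"
    by simp
  ultimately show "(\<integral>x. cnj (u x) * (if f \<in> cont_circle then f x * u x else 0) \<partial>circ) \<in> \<real>\<^sub>\<ge>\<^sub>0"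
    using f by simp
qed

section \<open>The Fourier basis\<close>

definition fourier :: "int \<Rightarrow> real \<Rightarrow> complex" where
  "fourier k x = exp (\<i> * of_int k * of_real x)"

lemma fourier_add: "fourier (k + l) x = fourier k x * fourier l x"
  by (simp add: fourier_def exp_add[symmetric] algebra_simps)

lemma fourier_add_arg: "fourier k (x + y) = fourier k x * fourier k y"
  by (simp add: fourier_def exp_add[symmetric] algebra_simps)

lemma fourier_0 [simp]: "fourier 0 x = 1" "fourier k 0 = 1"
  by (simp_all add: fourier_def)

lemma cnj_fourier: "cnj (fourier k x) = fourier (- k) x"
  by (simp add: fourier_def exp_cnj)

lemma cmod_fourier [simp]: "cmod (fourier k x) = 1"
  by (simp add: fourier_def norm_exp_eq_Re)

lemma fourier_2pi: "fourier k (x + 2 * pi) = fourier k x"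
proof -
  have "fourier k (2 * pi) = 1"
    unfolding fourier_def exp_eq_1 by auto
  then show ?thesis by (simp add: fourier_add_arg)
qed

lemma fourier_has_vector_derivative:
  "(fourier k has_vector_derivative \<i> * of_int k * fourier k x) (at x)"
  unfolding fourier_def
  by (auto intro!: derivative_eq_intros has_vector_derivative_real_field)

lemma fourier_cont_circle [simp]: "fourier k \<in> cont_circle"
  unfolding cont_circle_def
  using fourier_2pi by (auto simp: fourier_def intro!: continuous_intros)

lemma mult_op_fourier_basis_vec: "mult_op (fourier k) (basis_vec l) = basis_vec (k + l)"
proof (transfer fixing: k l)
  show "l2_rel (\<lambda>x. if fourier k \<in> cont_circle then fourier k x * exp (\<i> * of_int l * of_real x) else 0)
     (\<lambda>x. exp (\<i> * of_int (k + l) * of_real x))"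
    unfolding fourier_def[symmetric]
    using cont_circle_square_integrable[OF fourier_cont_circle, of "k + l"]
    by (simp add: l2_rel_refl_iff fourier_add[abs_def])
qed

lemma has_L2_deriv_basis_vec: "has_L2_deriv (basis_vec k) ((\<i> * of_int k) *\<^sub>c basis_vec k)"
proof -
  have 0: "has_L2_deriv (basis_vec 0) 0"
    by transfer (auto intro!: exI[of _ 1] simp: set_lebesgue_integral_def)
  have "has_L2_deriv (mult_op (fourier k) (basis_vec 0))
      (mult_op (\<lambda>x. \<i> * of_int k * fourier k x) (basis_vec 0) + mult_op (fourier k) 0)"
    by (rule has_L2_deriv_mult_op[OF _ _ fourier_has_vector_derivative 0]) (auto intro: cont_circle_cmult)
  moreover have "mult_op (fourier k) 0 = 0"
    using mult_op_cscale[of "fourier k" 0 0] by simp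
  ultimately show ?thesis
    by (simp add: mult_op_fourier_basis_vec mult_op_cmult_fun)
qed

lemma cinner_basis_vec_shift:
  "cinner (basis_vec k) \<xi> = cinner (basis_vec 0) (mult_op (fourier (- k)) \<xi>)"
proof -
  have "cinner (mult_op (fourier k) (basis_vec 0)) \<xi> = cinner (basis_vec 0) (mult_op (fourier (- k)) \<xi>)"
    by (simp add: cinner_mult_op_left cnj_fourier[abs_def])
  then show ?thesis by (simp add: mult_op_fourier_basis_vec)
qed

lemma cinner_basis_vec_0_deriv:
  assumes "has_L2_deriv \<xi> \<eta>"
  shows "cinner (basis_vec 0) \<eta> = 0"
  using assms by transfer (simp add: integral_circ l2_rel_def)

text \<open>Integrating the derivative of \<open>e\<^sub>-\<^sub>k \<xi>\<close> over the circle gives zero.\<close>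

lemma cinner_basis_vec_deriv:
  assumes "has_L2_deriv \<xi> \<eta>"
  shows "cinner (basis_vec k) \<eta> = \<i> * of_int k * cinner (basis_vec k) \<xi>"
proof -
  have "has_L2_deriv (mult_op (fourier (- k)) \<xi>)
      (mult_op (\<lambda>x. \<i> * of_int (- k) * fourier (- k) x) \<xi> + mult_op (fourier (- k)) \<eta>)"
    by (intro has_L2_deriv_mult_op[OF _ _ fourier_has_vector_derivative assms] cont_circle_cmult fourier_cont_circle)
  from cinner_basis_vec_0_deriv[OF this] show ?thesis
    using cinner_basis_vec_shift[of k \<xi>] cinner_basis_vec_shift[of k \<eta>] mult_op_cmult_fun[of "fourier (-k)" "\<i> * of_int (- k)" \<xi>]
    by (simp add: cinner_add_right)
qed

text \<open>Eigenvectors of the symmetric operator \<open>-\<i> d/dx\<close> with different eigenvalues are orthogonal.\<close>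

lemma cinner_basis_vec: "cinner (basis_vec k) (basis_vec l) = (if k = l then 1 else 0)"
proof (cases "k = l")
  case True
  interpret finite_measure circ by (rule finite_measure_circ)
  have "cinner (basis_vec k) (basis_vec k) = 1"
  proof (transfer fixing: k)
    have "(\<lambda>x. cnj (exp (\<i> * of_int k * of_real x)) * exp (\<i> * of_int k * of_real x)) = (\<lambda>x::real. 1)"
      using fourier_add[of "-k" k] by (simp add: fun_eq_iff fourier_def exp_cnj exp_add[symmetric])
    then show "(\<integral>x. cnj (exp (\<i> * of_int k * of_real x)) * exp (\<i> * of_int k * of_real x) \<partial>circ) = 1"
      using prob_space_circ by (simp add: measure_def)
  qed
  with True show ?thesis by simp
next
  case False
  have "\<i> * of_int l * cinner (basis_vec k) (basis_vec l) = \<i> * of_int k * cinner (basis_vec k) (basis_vec l)"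
    using cinner_basis_vec_deriv[OF has_L2_deriv_basis_vec, of k l] by simp
  with False show ?thesis by simp
qed

lemma norm_basis_vec [simp]: "norm (basis_vec k) = 1"
proof -
  have "(norm (basis_vec k))\<^sup>2 = 1"
    by (simp add: norm_square_L2 cinner_basis_vec)
  then show ?thesis
    using norm_ge_zero[of "basis_vec k"] by (auto simp: power2_eq_1_iff simp del: norm_ge_zero)
qed

section \<open>Truncation and the operator D\<close>

lemma proj_add: "proj n (\<xi> + \<eta>) = proj n \<xi> + proj n \<eta>"
  by (simp add: proj_def cinner_add_right cscale_add_left sum.distrib)

lemma proj_cscale: "proj n (c *\<^sub>c \<xi>) = c *\<^sub>c proj n \<xi>"
  by (simp add: proj_def cscale_sum_right)

lemma proj_diff: "proj n (\<xi> - \<eta>) = proj n \<xi> - proj n \<eta>"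
  using proj_add[of n \<xi> "(-1) *\<^sub>c \<eta>"] unfolding proj_cscale by (simp add: cscale_minus_one)

lemma cinner_basis_vec_sum:
  assumes "k \<in> {1..n}"
  shows "cinner (basis_vec (int k)) (\<Sum>l = 1..n. c l *\<^sub>c basis_vec (int l)) = c k"
  using assms by (simp add: cinner_sum_right cinner_basis_vec if_distrib[of "\<lambda>z. _ * z"] sum.delta' cong: if_cong)

lemma proj_basis_vec_sum:
  "proj n (\<Sum>l = 1..n. c l *\<^sub>c basis_vec (int l)) = (\<Sum>l = 1..n. c l *\<^sub>c basis_vec (int l))"
  unfolding proj_def by (intro sum.cong refl) (simp only: cinner_basis_vec_sum)

lemma proj_proj [simp]: "proj n (proj n \<xi>) = proj n \<xi>"
  using proj_basis_vec_sum[of n "\<lambda>l. cinner (basis_vec (int l)) \<xi>"] by (simp add: proj_def)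

lemma in_range_proj_iff: "\<xi> \<in> range (proj n) \<longleftrightarrow> proj n \<xi> = \<xi>"
  by (metis proj_proj rangeE rangeI)

lemma proj_basis_vec [simp]: "k \<in> {1..n} \<Longrightarrow> proj n (basis_vec (int k)) = basis_vec (int k)"
  by (simp add: proj_def cinner_basis_vec if_distrib[of "\<lambda>z. z *\<^sub>c _"] sum.delta' cong: if_cong)

lemma cinner_proj: "cinner \<xi> (proj n \<eta>) = cinner (proj n \<xi>) \<eta>"
  by (simp add: proj_def cinner_sum_right cinner_sum_left cinner_commute[of \<xi>] mult.commute)

lemma cinner_basis_vec_proj:
  "k \<in> {1..n} \<Longrightarrow> cinner (basis_vec (int k)) (proj n \<xi>) = cinner (basis_vec (int k)) \<xi>"
  by (simp add: cinner_proj)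

lemma norm_proj_square: "(norm (proj n \<xi>))\<^sup>2 = (\<Sum>k = 1..n. (cmod (cinner (basis_vec (int k)) \<xi>))\<^sup>2)"
proof -
  have "complex_of_real ((norm (proj n \<xi>))\<^sup>2) = cinner \<xi> (proj n \<xi>)"
    using cinner_proj[of \<xi> n "proj n \<xi>"] cinner_self[of "proj n \<xi>"] by simp
  also have "\<dots> = (\<Sum>k = 1..n. cinner (basis_vec (int k)) \<xi> * cnj (cinner (basis_vec (int k)) \<xi>))"
    by (simp add: proj_def cinner_sum_right cinner_commute[of \<xi>])
  also have "\<dots> = complex_of_real (\<Sum>k = 1..n. (cmod (cinner (basis_vec (int k)) \<xi>))\<^sup>2)"
    by (simp add: complex_norm_square[symmetric])
  finally show ?thesis by (simp only: of_real_eq_iff)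
qed

lemma norm_proj_le: "norm (proj n \<xi>) \<le> norm \<xi>"
proof (cases "norm (proj n \<xi>) = 0")
  case False
  have "(norm (proj n \<xi>))\<^sup>2 = Re (cinner (proj n \<xi>) \<xi>)"
    using cinner_proj[of "proj n \<xi>" n \<xi>] by (simp add: norm_square_L2)
  also have "\<dots> \<le> norm (proj n \<xi>) * norm \<xi>"
    using complex_Re_le_cmod cmod_cinner_le by (rule order_trans)
  finally show ?thesis using False by (simp add: power2_eq_square)
qed auto

lemma D_dom_basis_vec_sum: "(\<Sum>k = 1..n. c k *\<^sub>c basis_vec (int k)) \<in> D_dom"
  and D_op_basis_vec_sum:
    "D_op (\<Sum>k = 1..n. c k *\<^sub>c basis_vec (int k)) = (\<Sum>k = 1..n. (of_nat k * c k) *\<^sub>c basis_vec (int k))"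
proof -
  have *: "has_L2_deriv (\<Sum>k = 1..n. c k *\<^sub>c basis_vec (int k))
      (\<Sum>k = 1..n. c k *\<^sub>c (\<i> * of_int (int k)) *\<^sub>c basis_vec (int k))"
    by (intro has_L2_deriv_sum has_L2_deriv_cscale has_L2_deriv_basis_vec)
  then show "(\<Sum>k = 1..n. c k *\<^sub>c basis_vec (int k)) \<in> D_dom"
    by (auto simp: D_dom_def)
  show "D_op (\<Sum>k = 1..n. c k *\<^sub>c basis_vec (int k)) = (\<Sum>k = 1..n. (of_nat k * c k) *\<^sub>c basis_vec (int k))"
    using D_op_eqI[OF *] by (simp add: cscale_sum_right mult_ac)
qed

lemma range_proj_D_dom: "proj n \<xi> \<in> D_dom"
  unfolding proj_def by (rule D_dom_basis_vec_sum)

lemma D_op_proj: "D_op (proj n \<xi>) = (\<Sum>k = 1..n. (of_nat k * cinner (basis_vec (int k)) \<xi>) *\<^sub>c basis_vec (int k))"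
  unfolding proj_def by (rule D_op_basis_vec_sum)

lemma proj_D_op_proj: "proj n (D_op (proj n \<xi>)) = D_op (proj n \<xi>)"
  unfolding D_op_proj by (rule proj_basis_vec_sum)

lemma compress_D_op: "compress n D_op \<xi> = D_op (proj n \<xi>)"
  by (simp add: compress_def proj_D_op_proj)

lemma cinner_basis_vec_D_op:
  assumes "\<xi> \<in> D_dom"
  shows "cinner (basis_vec k) (D_op \<xi>) = of_int k * cinner (basis_vec k) \<xi>"
proof -
  from assms obtain \<eta> where "has_L2_deriv \<xi> \<eta>" by (auto simp: D_dom_def)
  then show ?thesis by (simp add: D_op_eqI cinner_basis_vec_deriv flip: mult.assoc)
qed

lemma D_op_proj_commute: "\<xi> \<in> D_dom \<Longrightarrow> D_op (proj n \<xi>) = proj n (D_op \<xi>)"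
  unfolding D_op_proj by (simp add: proj_def cinner_basis_vec_D_op)

lemma smooth_circle_deriv:
  assumes "f \<in> smooth_circle"
  obtains f' where "f \<in> cont_circle" "f' \<in> cont_circle"
    "\<And>t. (f has_vector_derivative f' t) (at t)"
proof -
  from assms obtain F where per: "\<And>x. f (x + 2 * pi) = f x" and F0: "F 0 = f"
    and F: "\<And>k x. (F k has_vector_derivative F (Suc k) x) (at x)"
    by (auto simp: smooth_circle_def)
  have cont: "continuous_on UNIV (F k)" for k
    by (rule continuous_at_imp_continuous_on) (use F has_vector_derivative_continuous in blast)
  have F': "(f has_vector_derivative F (Suc 0) x) (at x)" for x
    using F[of 0 x] F0 by simp
  have "F (Suc 0) (x + 2 * pi) = F (Suc 0) x" for x
  proof (rule vector_derivative_unique_at)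
    have "((f \<circ> (\<lambda>y. y + 2 * pi)) has_vector_derivative (1 *\<^sub>R F (Suc 0) (x + 2 * pi))) (at x)"
      by (rule vector_diff_chain_at) (auto intro!: derivative_eq_intros F' simp: has_real_derivative_iff_has_vector_derivative[symmetric])
    then show "(f has_vector_derivative F (Suc 0) (x + 2 * pi)) (at x)"
      by (simp add: o_def per)
  qed (rule F')
  then show ?thesis
    using that[of "F (Suc 0)"] cont[of 0] cont[of "Suc 0"] F' F0 per by (auto simp: cont_circle_def)
qed

lemma smooth_imp_cont_circle: "f \<in> smooth_circle \<Longrightarrow> f \<in> cont_circle"
  using smooth_circle_deriv by blast

lemma commutator_D_mult_op:
  assumes f: "f \<in> cont_circle" and f': "f' \<in> cont_circle"
    and deriv: "\<And>t. (f has_vector_derivative f' t) (at t)" and \<xi>: "\<xi> \<in> D_dom"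
  shows "mult_op f \<xi> \<in> D_dom"
    and "D_op (mult_op f \<xi>) - mult_op f (D_op \<xi>) = (- \<i>) *\<^sub>c mult_op f' \<xi>"
proof -
  from \<xi> obtain \<eta> where \<eta>: "has_L2_deriv \<xi> \<eta>" by (auto simp: D_dom_def)
  note * = has_L2_deriv_mult_op[OF f f' deriv \<eta>]
  then show "mult_op f \<xi> \<in> D_dom" by (auto simp: D_dom_def)
  show "D_op (mult_op f \<xi>) - mult_op f (D_op \<xi>) = (- \<i>) *\<^sub>c mult_op f' \<xi>"
    by (simp add: D_op_eqI[OF *] D_op_eqI[OF \<eta>] mult_op_cscale cscale_add_right)
qed

lemma op_norm_le_iff:
  assumes "0 \<le> c"
  shows "op_norm V T \<le> ennreal c \<longleftrightarrow> (\<forall>\<xi>\<in>V. norm \<xi> \<le> 1 \<longrightarrow> norm (T \<xi>) \<le> c)"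
  using assms by (auto simp: op_norm_def SUP_le_iff)

lemma op_norm_le_1_iff:
  "op_norm V T \<le> 1 \<longleftrightarrow> (\<forall>\<xi>\<in>V. norm \<xi> \<le> 1 \<longrightarrow> norm (T \<xi>) \<le> 1)"
  using op_norm_le_iff[of 1 V T] by simp

lemma commutator_norm_circle_le:
  assumes f: "f \<in> cont_circle" and f': "f' \<in> cont_circle"
    and deriv: "\<And>t. (f has_vector_derivative f' t) (at t)" and le: "\<And>t. cmod (f' t) \<le> c"
  shows "commutator_norm D_dom D_op (mult_op f) \<le> ennreal c"
proof -
  have c: "0 \<le> c" using le[of 0] norm_ge_zero order_trans by blast
  show ?thesis
    unfolding commutator_norm_def op_norm_le_iff[OF c]
  proof (intro ballI impI)
    fix \<xi> assume \<xi>: "\<xi> \<in> {\<xi> \<in> D_dom. mult_op f \<xi> \<in> D_dom}" "norm \<xi> \<le> 1"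
    have "norm (mult_op f' \<xi>) \<le> c * norm \<xi>"
      by (rule norm_mult_op_bound[OF f' le])
    also have "\<dots> \<le> c * 1" by (rule mult_left_mono[OF \<xi>(2) c])
    finally show "norm (D_op (mult_op f \<xi>) - mult_op f (D_op \<xi>)) \<le> c"
      using \<xi>(1) by (simp add: commutator_D_mult_op(2)[OF f f' deriv])
  qed
qed

lemma compress_commutator:
  assumes f: "f \<in> smooth_circle" and \<xi>: "\<xi> \<in> range (proj n)"
  shows "compress n D_op (compress n (mult_op f) \<xi>) - compress n (mult_op f) (compress n D_op \<xi>) =
    proj n (D_op (mult_op f \<xi>) - mult_op f (D_op \<xi>))"
proof -
  obtain f' where f': "f \<in> cont_circle" "f' \<in> cont_circle" "\<And>t. (f has_vector_derivative f' t) (at t)"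
    using smooth_circle_deriv[OF f] by blast
  have [simp]: "proj n \<xi> = \<xi>" using \<xi> by (simp add: in_range_proj_iff)
  have "mult_op f \<xi> \<in> D_dom"
    using commutator_D_mult_op(1)[OF f'] range_proj_D_dom[of n \<xi>] by simp
  moreover have "proj n (D_op \<xi>) = D_op \<xi>"
    using proj_D_op_proj[of n \<xi>] by simp
  ultimately show ?thesis
    unfolding compress_D_op by (simp add: compress_def D_op_proj_commute proj_diff)
qed

text \<open>The commutator of the truncated triple is the compression of the commutator on the circle, since
  \<open>P\<^sub>n\<close> commutes with \<open>D\<close>.\<close>

lemma commutator_norm_compress_le:
  assumes f: "f \<in> smooth_circle"
  shows "commutator_norm (range (proj n)) (compress n D_op) (compress n (mult_op f)) \<le>
    commutator_norm D_dom D_op (mult_op f)"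
  unfolding commutator_norm_def op_norm_def
proof (rule SUP_mono, clarify)
  fix \<xi> assume \<xi>: "norm (proj n \<xi>) \<le> 1"
  obtain f' where f': "f \<in> cont_circle" "f' \<in> cont_circle" "\<And>t. (f has_vector_derivative f' t) (at t)"
    using smooth_circle_deriv[OF f] by blast
  have "mult_op f (proj n \<xi>) \<in> D_dom"
    using commutator_D_mult_op(1)[OF f'] range_proj_D_dom by simp
  then show "\<exists>\<eta>\<in>{\<eta> \<in> {\<eta> \<in> D_dom. mult_op f \<eta> \<in> D_dom}. norm \<eta> \<le> 1}.
    ennreal (norm (compress n D_op (compress n (mult_op f) (proj n \<xi>)) -
      compress n (mult_op f) (compress n D_op (proj n \<xi>))))
    \<le> ennreal (norm (D_op (mult_op f \<eta>) - mult_op f (D_op \<eta>)))"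
    using \<xi> range_proj_D_dom
    by (intro bexI[of _ "proj n \<xi>"]) (auto simp: compress_commutator[OF f] norm_proj_le intro!: ennreal_leI)
qed

section \<open>Fejer means\<close>

text \<open>The squared modulus of this function of \<open>t\<close> is the Fejer kernel at \<open>t - x\<close>.\<close>

definition fejer_vec :: "nat \<Rightarrow> real \<Rightarrow> L2_circle" where
  "fejer_vec n x = of_real (1 / sqrt n) *\<^sub>c (\<Sum>k = 1..n. fourier (- int k) x *\<^sub>c basis_vec (int k))"

text \<open>For multiplication by \<open>f\<close> this is the Fejer mean of \<open>f\<close> at \<open>x\<close>. Only the compression of \<open>T\<close> to the
  range of \<open>P\<^sub>n\<close> matters, so the same formula maps Toeplitz matrices to functions.\<close>

definition symbol :: "nat \<Rightarrow> (L2_circle \<Rightarrow> L2_circle) \<Rightarrow> real \<Rightarrow> complex" where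
  "symbol n T x = cinner (fejer_vec n x) (T (fejer_vec n x))"

lemma proj_fejer_vec [simp]: "proj n (fejer_vec n x) = fejer_vec n x"
  unfolding fejer_vec_def proj_cscale by (simp only: proj_basis_vec_sum)

lemma fejer_vec_in_range: "fejer_vec n x \<in> range (proj n)"
  by (simp add: in_range_proj_iff)

lemma norm_fejer_vec:
  assumes "n \<ge> 1"
  shows "norm (fejer_vec n x) = 1"
proof -
  have "(norm (fejer_vec n x))\<^sup>2 = (norm (proj n (fejer_vec n x)))\<^sup>2" by simp
  also have "\<dots> = (\<Sum>k = 1..n. (1 / sqrt n)\<^sup>2)"
    unfolding norm_proj_square
    by (intro sum.cong refl)
       (simp only: fejer_vec_def cinner_cscale_right cinner_basis_vec_sum norm_mult cmod_fourier norm_of_real, simp)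
  also have "\<dots> = 1"
    using assms by (simp add: power_divide)
  finally show ?thesis
    using norm_ge_zero[of "fejer_vec n x"] by (auto simp: power2_eq_1_iff simp del: norm_ge_zero)
qed

lemma symbol_compress: "symbol n (compress n T) x = symbol n T x"
  by (simp add: symbol_def compress_def cinner_proj)

lemma cmod_symbol_le:
  assumes "n \<ge> 1" "op_norm (range (proj n)) T \<le> ennreal c" "0 \<le> c"
  shows "cmod (symbol n T x) \<le> c"
proof -
  have "norm (T (fejer_vec n x)) \<le> c"
    using assms norm_fejer_vec[OF assms(1), of x] fejer_vec_in_range[of n x] by (auto simp: op_norm_le_iff)
  then show ?thesis
    using cmod_cinner_le[of "fejer_vec n x" "T (fejer_vec n x)"] norm_fejer_vec[OF assms(1), of x]
    by (simp add: symbol_def)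
qed

text \<open>Multiplication by \<open>e\<^sup>-\<^sup>i\<^sup>x e\<^sub>1\<close> shifts the sum defining the Fejer vector by one index, so the
  difference telescopes.\<close>

lemma mult_op_rotation_fejer_vec:
  "mult_op (\<lambda>t. fourier (- 1) x * fourier 1 t - 1) (fejer_vec n x) =
    of_real (1 / sqrt n) *\<^sub>c (fourier (- int (Suc n)) x *\<^sub>c basis_vec (int (Suc n)) - fourier (- 1) x *\<^sub>c basis_vec 1)"
proof -
  let ?M = "mult_op (\<lambda>t. fourier (- 1) x * fourier 1 t - 1)"
  have M: "?M \<xi> = fourier (- 1) x *\<^sub>c mult_op (fourier 1) \<xi> - \<xi>" for \<xi>
    by (subst mult_op_diff_fun)
       (auto simp: mult_op_cmult_fun mult_op_const intro: cont_circle_cmult cont_circle_const)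
  let ?S = "\<lambda>n. (\<Sum>k = 1..n. fourier (- int k) x *\<^sub>c basis_vec (int k))"
  have "?M (?S n) = fourier (- int (Suc n)) x *\<^sub>c basis_vec (int (Suc n)) - fourier (- 1) x *\<^sub>c basis_vec 1"
  proof (induction n)
    case 0
    then show ?case using mult_op_cscale[of _ 0 0] by simp
  next
    case (Suc n)
    have "?M (?S (Suc n)) = ?M (?S n) + ?M (fourier (- int (Suc n)) x *\<^sub>c basis_vec (int (Suc n)))"
      by (simp add: mult_op_add)
    also have "?M (fourier (- int (Suc n)) x *\<^sub>c basis_vec (int (Suc n))) =
        fourier (- int (Suc (Suc n))) x *\<^sub>c basis_vec (int (Suc (Suc n))) -
        fourier (- int (Suc n)) x *\<^sub>c basis_vec (int (Suc n))"
      unfolding M using fourier_add[of "-1" "- int (Suc n)" x]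
      by (simp add: mult_op_cscale mult_op_fourier_basis_vec)
    finally show ?case using Suc.IH by simp
  qed
  then show ?thesis
    by (simp only: fejer_vec_def mult_op_cscale)
qed

lemma norm_mult_op_rotation_fejer_vec:
  assumes "n \<ge> 1"
  shows "(norm (mult_op (\<lambda>t. fourier (- 1) x * fourier 1 t - 1) (fejer_vec n x)))\<^sup>2 = 2 / n"
proof -
  let ?d = "fourier (- int (Suc n)) x *\<^sub>c basis_vec (int (Suc n)) - fourier (- 1) x *\<^sub>c basis_vec 1"
  have "cinner ?d ?d = 2"
    using assms
    by (simp add: cinner_diff_left cinner_diff_right cinner_basis_vec cnj_fourier fourier_add[symmetric])
  then have "(norm ?d)\<^sup>2 = 2"
    by (simp add: norm_square_L2)
  then show ?thesis
    using assms by (simp only: mult_op_rotation_fejer_vec norm_cscale power_mult_distrib) (simp add: norm_divide power_divide)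
qed

text \<open>The Fejer kernel concentrates at \<open>x\<close> because the rotated Fejer vector is close to the Fejer vector.
  This makes any bound of the oscillation of \<open>f\<close> in terms of \<open>|e\<^sup>i\<^sup>(\<^sup>t\<^sup>-\<^sup>x\<^sup>) - 1|\<close> a bound of
  \<open>\<langle>v, (f x - f) v\<rangle>\<close>.\<close>

lemma fejer_estimate:
  assumes f: "f \<in> cont_circle" and n: "n \<ge> 1"
    and le: "\<And>t. (cmod (f x - f t))\<^sup>2 \<le> A + B * (cmod (fourier 1 (t - x) - 1))\<^sup>2"
  shows "(cmod (f x - symbol n (mult_op f) x))\<^sup>2 \<le> A + 2 * B / n"
proof -
  let ?v = "fejer_vec n x"
  let ?g = "\<lambda>t. fourier (- 1) x * fourier 1 t - 1"
  have g: "?g \<in> cont_circle"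
    by (intro cont_circle_diff cont_circle_cmult cont_circle_const fourier_cont_circle)
  have h: "(\<lambda>t. f x - f t) \<in> cont_circle"
    by (intro cont_circle_diff cont_circle_const f)
  have "?g t = fourier 1 (t - x) - 1" for t
    using fourier_add_arg[of 1 t "- x"] by (simp add: fourier_def mult_ac)
  with le have le': "(cmod (f x - f t))\<^sup>2 \<le> A + B * (cmod (?g t))\<^sup>2" for t
    by simp
  have "f x - symbol n (mult_op f) x = cinner ?v (mult_op (\<lambda>t. f x - f t) ?v)"
    using norm_fejer_vec[OF n, of x]
    by (simp add: symbol_def mult_op_diff_fun[OF cont_circle_const f] mult_op_const cinner_diff_right cinner_self)
  then have "cmod (f x - symbol n (mult_op f) x) \<le> norm (mult_op (\<lambda>t. f x - f t) ?v)"
    using cmod_cinner_le[of ?v "mult_op (\<lambda>t. f x - f t) ?v"] norm_fejer_vec[OF n, of x] by simp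
  then have "(cmod (f x - symbol n (mult_op f) x))\<^sup>2 \<le> (norm (mult_op (\<lambda>t. f x - f t) ?v))\<^sup>2"
    by (intro power_mono) auto
  also have "\<dots> \<le> A * (norm ?v)\<^sup>2 + B * (norm (mult_op ?g ?v))\<^sup>2"
    by (rule norm_mult_op_le[OF h g le'])
  finally show ?thesis
    using norm_fejer_vec[OF n, of x] by (simp only: norm_mult_op_rotation_fejer_vec[OF n]) (simp add: mult.commute)
qed


text \<open>An arc is at most \<open>\<pi>/2\<close> times its chord, by concavity of the sine on \<open>[0, \<pi>/2]\<close>.\<close>

lemma chord_lower_bound:
  assumes "\<bar>s\<bar> \<le> pi"
  shows "\<bar>s\<bar> \<le> pi / 2 * cmod (fourier 1 s - 1)"
proof -
  have "concave_on {0..pi / 2} sin"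
  proof (rule f''_le0_imp_concave)
    show "(sin has_real_derivative cos x) (at x)" "(cos has_real_derivative - sin x) (at x)" for x :: real
      by (auto intro!: derivative_eq_intros)
    show "- sin x \<le> 0" if "x \<in> {0..pi / 2}" for x
      using that sin_ge_zero[of x] by auto
  qed auto
  define t where "t = \<bar>s\<bar> / pi"
  have t: "0 \<le> t" "t \<le> 1" using assms by (auto simp: t_def)
  have "(1 - t) * sin 0 + t * sin (pi / 2) \<le> sin ((1 - t) *\<^sub>R 0 + t *\<^sub>R (pi / 2))"
    by (rule concave_onD[OF \<open>concave_on {0..pi / 2} sin\<close> t]) auto
  then have "t \<le> sin (\<bar>s\<bar> / 2)" by (simp add: t_def)
  also have "\<dots> \<le> \<bar>sin (s / 2)\<bar>"
    by (cases "0 \<le> s") auto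
  also have "\<dots> = cmod (fourier 1 s - 1) / 2"
    by (simp add: fourier_def dist_exp_i_1)
  finally show ?thesis by (simp add: t_def field_simps)
qed

lemma cont_circle_shift:
  assumes "f \<in> cont_circle"
  shows "f (x + 2 * pi * of_int k) = f x"
proof -
  have per: "f (x + 2 * pi) = f x" for x using assms by (auto simp: cont_circle_def)
  have nat: "f (x + 2 * pi * of_nat m) = f x" for x m
  proof (induction m)
    case (Suc m)
    then show ?case using per[of "x + 2 * pi * of_nat m"] by (simp add: algebra_simps)
  qed simp
  show ?thesis
  proof (cases "k \<ge> 0")
    case True
    then show ?thesis using nat[of x "nat k"] by simp
  next
    case False
    then show ?thesis using nat[of "x + 2 * pi * of_int k" "nat (- k)"] by simp
  qed
qed

lemma ex_shift_principal: "\<exists>k::int. \<bar>s + 2 * pi * of_int k\<bar> \<le> pi"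
proof -
  have "\<bar>of_int (round (s / (2 * pi))) - s / (2 * pi)\<bar> \<le> 1 / 2"
    by (rule of_int_round_abs_le)
  then have "2 * pi * \<bar>of_int (round (s / (2 * pi))) - s / (2 * pi)\<bar> \<le> pi"
    by (simp add: field_simps)
  also have "2 * pi * \<bar>of_int (round (s / (2 * pi))) - s / (2 * pi)\<bar> =
      \<bar>2 * pi * (of_int (round (s / (2 * pi))) - s / (2 * pi))\<bar>"
    by (simp add: abs_mult)
  also have "2 * pi * (of_int (round (s / (2 * pi))) - s / (2 * pi)) =
      - (s + 2 * pi * of_int (- round (s / (2 * pi))))"
    by (simp add: field_simps)
  finally show ?thesis by (intro exI[of _ "- round (s / (2 * pi))"]) (simp only: abs_minus_cancel)
qed

text \<open>Periodicity reduces oscillation estimates to differences of arguments in \<open>[-\<pi>, \<pi>]\<close>, where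
  chord and arc are comparable.\<close>

lemma circle_modulus:
  assumes f: "f \<in> cont_circle"
    and le: "\<And>s x. \<bar>s\<bar> \<le> pi \<Longrightarrow> cmod (f x - f (x + s)) \<le> \<omega> (cmod (fourier 1 s - 1))"
  shows "cmod (f x - f t) \<le> \<omega> (cmod (fourier 1 (t - x) - 1))"
proof -
  obtain k :: int where k: "\<bar>(t - x) + 2 * pi * of_int k\<bar> \<le> pi"
    using ex_shift_principal by blast
  have "f (x + ((t - x) + 2 * pi * of_int k)) = f t"
    using cont_circle_shift[OF f, of t k] by (simp add: algebra_simps)
  moreover have "fourier 1 ((t - x) + 2 * pi * of_int k) = fourier 1 (t - x)"
    by (rule cont_circle_shift) simp
  ultimately show ?thesis using le[OF k, of x] by simp
qed

lemma circle_lipschitz: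
  assumes f: "f \<in> cont_circle" and deriv: "\<And>t. (f has_vector_derivative f' t) (at t)"
    and le: "\<And>t. cmod (f' t) \<le> 1"
  shows "cmod (f x - f t) \<le> pi / 2 * cmod (fourier 1 (t - x) - 1)"
proof -
  have lip: "cmod (f x - f t) \<le> \<bar>t - x\<bar>" for x t
  proof -
    have "norm (f x - f t) \<le> 1 * norm (x - t)"
      by (rule differentiable_bound[where S = UNIV and f' = "\<lambda>t h. h *\<^sub>R f' t"])
         (use deriv le in \<open>auto simp: has_vector_derivative_def intro!: onorm_le mult_left_le\<close>)
    then show ?thesis by (simp add: abs_minus_commute)
  qed
  show ?thesis
  proof (rule circle_modulus[OF f])
    fix s x :: real assume "\<bar>s\<bar> \<le> pi"
    then show "cmod (f x - f (x + s)) \<le> pi / 2 * cmod (fourier 1 s - 1)"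
      using lip[of x "x + s"] chord_lower_bound[of s] by simp
  qed
qed

lemma lipschitz_fejer:
  assumes f: "f \<in> cont_circle" and deriv: "\<And>t. (f has_vector_derivative f' t) (at t)"
    and le: "\<And>t. cmod (f' t) \<le> 1" and n: "n \<ge> 1"
  shows "cmod (f x - symbol n (mult_op f) x) \<le> pi / sqrt n"
proof -
  have "cmod (f x - f t) \<le> pi / 2 * cmod (fourier 1 (t - x) - 1)" for t
    by (rule circle_lipschitz[OF f deriv le])
  then have "(cmod (f x - f t))\<^sup>2 \<le> 0 + (pi / 2)\<^sup>2 * (cmod (fourier 1 (t - x) - 1))\<^sup>2" for t
    by (auto simp flip: power_mult_distrib intro!: power_mono)
  from fejer_estimate[OF f n this]
  have "(cmod (f x - symbol n (mult_op f) x))\<^sup>2 \<le> (pi / 2)\<^sup>2 * 2 / n"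
    by (simp add: mult.commute)
  also have "\<dots> \<le> (pi / sqrt n)\<^sup>2"
    using n by (simp add: power_divide field_simps)
  finally show ?thesis
    by (rule power2_le_imp_le) simp
qed

text \<open>Uniform continuity handles short arcs; on long ones the chord is bounded below and \<open>f\<close> is bounded.\<close>

lemma cont_circle_modulus:
  assumes f: "f \<in> cont_circle" and e: "\<epsilon> > 0"
  shows "\<exists>B. \<forall>x t. cmod (f x - f t) \<le> \<epsilon> + B * cmod (fourier 1 (t - x) - 1)"
proof -
  have cont: "continuous_on S f" for S
    using f by (auto simp: cont_circle_def intro: continuous_on_subset)
  let ?K = "{- pi..3 * pi}"
  have "uniformly_continuous_on ?K f"
    by (rule compact_uniformly_continuous[OF cont]) simp
  then obtain d where d: "d > 0" "\<And>x y. x \<in> ?K \<Longrightarrow> y \<in> ?K \<Longrightarrow> dist y x < d \<Longrightarrow> dist (f y) (f x) < \<epsilon>"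
    using e unfolding uniformly_continuous_on_def by blast
  have "bounded (f ` ?K)"
    by (intro compact_imp_bounded compact_continuous_image cont) simp
  then obtain M where "M > 0" "\<forall>z\<in>f ` ?K. cmod z \<le> M"
    unfolding bounded_pos by blast
  then have M: "\<And>x. x \<in> ?K \<Longrightarrow> cmod (f x) \<le> M" "M > 0"
    by blast+
  define B where "B = pi * M / d"
  have B: "B \<ge> 0" using M(2) d(1) by (simp add: B_def)
  have "cmod (f x - f (x + s)) \<le> \<epsilon> + B * cmod (fourier 1 s - 1)" if s: "\<bar>s\<bar> \<le> pi" for s x
  proof -
    obtain k :: int where k: "\<bar>(x - pi) + 2 * pi * of_int k\<bar> \<le> pi"
      using ex_shift_principal by blast
    define y where "y = x + 2 * pi * of_int k"
    have y: "y \<in> ?K" "y + s \<in> ?K" using k s by (auto simp: y_def)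
    have "f x = f y" "f (x + s) = f (y + s)"
      using cont_circle_shift[OF f, of x k] cont_circle_shift[OF f, of "x + s" k] by (simp_all add: y_def add_ac)
    moreover have "cmod (f y - f (y + s)) \<le> \<epsilon> + B * cmod (fourier 1 s - 1)"
    proof (cases "\<bar>s\<bar> < d")
      case True
      then have "cmod (f y - f (y + s)) < \<epsilon>"
        using d(2)[OF y(2) y(1)] by (simp add: dist_norm)
      moreover have "0 \<le> B * cmod (fourier 1 s - 1)" using B by simp
      ultimately show ?thesis by linarith
    next
      case False
      have "cmod (f y - f (y + s)) \<le> 2 * M"
        using norm_triangle_ineq4[of "f y" "f (y + s)"] M(1)[OF y(1)] M(1)[OF y(2)] by linarith
      also have "\<dots> = B * (2 / pi * d)"
        using d(1) by (simp add: B_def)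
      also have "\<dots> \<le> B * (2 / pi * \<bar>s\<bar>)"
        using False B by (intro mult_left_mono) auto
      also have "\<dots> \<le> B * cmod (fourier 1 s - 1)"
        using chord_lower_bound[OF s] B by (intro mult_left_mono) (auto simp: field_simps)
      finally show ?thesis using e by linarith
    qed
    ultimately show ?thesis by simp
  qed
  then show ?thesis
    using circle_modulus[OF f, where \<omega> = "\<lambda>z. \<epsilon> + B * z"] by blast
qed

lemma fejer_uniform_convergence:
  assumes f: "f \<in> cont_circle" and e: "\<epsilon> > 0"
  shows "\<exists>n\<ge>1. \<forall>x. cmod (f x - symbol n (mult_op f) x) \<le> \<epsilon>"
proof -
  obtain B where B: "\<And>x t. cmod (f x - f t) \<le> \<epsilon> / 2 + B * cmod (fourier 1 (t - x) - 1)"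
    using cont_circle_modulus[OF f, of "\<epsilon> / 2"] e by auto
  \<comment> \<open>Squaring the modulus of continuity with \<open>(a + b)\<^sup>2 \<le> 2 a\<^sup>2 + 2 b\<^sup>2\<close> turns \<open>\<epsilon> / 2\<close> and \<open>B\<close> into
    the constants \<open>\<epsilon>\<^sup>2 / 2\<close> and \<open>2 B\<^sup>2\<close> of the Fejer estimate.\<close>
  obtain n :: nat where n: "n \<ge> 1" "2 * (2 * B\<^sup>2) / n \<le> \<epsilon>\<^sup>2 / 2"
  proof -
    obtain m :: nat where m: "8 * B\<^sup>2 / \<epsilon>\<^sup>2 \<le> m" using real_arch_simple by blast
    then have "8 * B\<^sup>2 \<le> real (Suc m) * \<epsilon>\<^sup>2"
      using e by (simp add: field_simps) (smt (verit) zero_le_power2)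
    then show ?thesis using that[of "Suc m"] by (simp add: field_simps)
  qed
  have "cmod (f x - symbol n (mult_op f) x) \<le> \<epsilon>" for x
  proof -
    have "(cmod (f x - f t))\<^sup>2 \<le> \<epsilon>\<^sup>2 / 2 + (2 * B\<^sup>2) * (cmod (fourier 1 (t - x) - 1))\<^sup>2" for t
    proof -
      have "(cmod (f x - f t))\<^sup>2 \<le> (\<epsilon> / 2 + B * cmod (fourier 1 (t - x) - 1))\<^sup>2"
        by (intro power_mono B) auto
      also have "\<dots> \<le> 2 * (\<epsilon> / 2)\<^sup>2 + 2 * (B * cmod (fourier 1 (t - x) - 1))\<^sup>2"
        using sum_squares_bound[of "\<epsilon> / 2" "B * cmod (fourier 1 (t - x) - 1)"] by (simp add: power2_sum)
      finally show ?thesis by (simp add: power_mult_distrib power_divide mult.assoc)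
    qed
    from fejer_estimate[OF f n(1) this]
    have "(cmod (f x - symbol n (mult_op f) x))\<^sup>2 \<le> \<epsilon>\<^sup>2"
      using n(2) by linarith
    then show ?thesis by (rule power2_le_imp_le) (use e in simp)
  qed
  with n(1) show ?thesis by blast
qed

text \<open>The commutator acts as multiplication by \<open>- \<i> f'\<close>, and its quadratic form at Fejer vectors converges
  to the values of \<open>f'\<close>.\<close>

lemma commutator_norm_circle_ge:
  assumes f: "f \<in> cont_circle" and f': "f' \<in> cont_circle"
    and deriv: "\<And>t. (f has_vector_derivative f' t) (at t)"
    and le: "commutator_norm D_dom D_op (mult_op f) \<le> ennreal c" and c: "0 \<le> c"
  shows "cmod (f' x) \<le> c"
proof (rule field_le_epsilon)
  fix e :: real assume "e > 0"
  then obtain n where n: "n \<ge> 1" "cmod (f' x - symbol n (mult_op f') x) \<le> e"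
    using fejer_uniform_convergence[OF f'] by blast
  have dom: "proj n \<xi> \<in> D_dom" "mult_op f (proj n \<xi>) \<in> D_dom" for \<xi>
    using commutator_D_mult_op(1)[OF f f' deriv] range_proj_D_dom by auto
  have "op_norm (range (proj n)) (mult_op f') \<le> ennreal c"
    unfolding op_norm_le_iff[OF c]
  proof (intro ballI impI, clarify)
    fix \<xi> assume "norm (proj n \<xi>) \<le> 1"
    then have "norm (D_op (mult_op f (proj n \<xi>)) - mult_op f (D_op (proj n \<xi>))) \<le> c"
      using le dom by (auto simp: commutator_norm_def op_norm_le_iff[OF c])
    then show "norm (mult_op f' (proj n \<xi>)) \<le> c"
      by (simp add: commutator_D_mult_op(2)[OF f f' deriv dom(1)])
  qed
  then have "cmod (symbol n (mult_op f') x) \<le> c"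
    by (rule cmod_symbol_le[OF n(1) _ c])
  then show "cmod (f' x) \<le> c + e"
    using n(2) norm_triangle_sub[of "f' x" "symbol n (mult_op f') x"] by linarith
qed

section \<open>Symbols of truncated operators\<close>

definition clinear :: "(L2_circle \<Rightarrow> L2_circle) \<Rightarrow> bool" where
  "clinear T \<longleftrightarrow> (\<forall>\<xi> \<eta>. T (\<xi> + \<eta>) = T \<xi> + T \<eta>) \<and> (\<forall>c \<xi>. T (c *\<^sub>c \<xi>) = c *\<^sub>c T \<xi>)"

lemma clinear_add: "clinear T \<Longrightarrow> T (\<xi> + \<eta>) = T \<xi> + T \<eta>"
  and clinear_cscale: "clinear T \<Longrightarrow> T (c *\<^sub>c \<xi>) = c *\<^sub>c T \<xi>"
  by (auto simp: clinear_def)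

lemma clinear_zero: "clinear T \<Longrightarrow> T 0 = 0"
  using clinear_cscale[of T 0 0] by simp

lemma clinear_sum: "clinear T \<Longrightarrow> T (\<Sum>i\<in>I. f i) = (\<Sum>i\<in>I. T (f i))"
  by (induction I rule: infinite_finite_induct) (auto simp: clinear_zero clinear_add)

lemma clinear_mult_op: "clinear (mult_op f)"
  by (simp add: clinear_def mult_op_add mult_op_cscale)

lemma clinear_compress: "clinear T \<Longrightarrow> clinear (compress n T)"
  by (simp add: clinear_def compress_def proj_add proj_cscale)

lemma clinear_compress_D: "clinear (compress n D_op)"
  unfolding clinear_def compress_D_op D_op_proj
  by (simp add: cinner_add_right distrib_left cscale_add_left sum.distrib cscale_sum_right mult_ac)

text \<open>The derivation of the truncated triple, as an operation on operators that can be iterated.\<close>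

definition ad :: "nat \<Rightarrow> (L2_circle \<Rightarrow> L2_circle) \<Rightarrow> L2_circle \<Rightarrow> L2_circle" where
  "ad n T \<xi> = compress n D_op (T \<xi>) - T (compress n D_op \<xi>)"

lemma clinear_ad:
  assumes "clinear T"
  shows "clinear (ad n T)"
  using assms clinear_compress_D[of n] by (auto simp: clinear_def ad_def cscale_diff_right)

lemma compress_D_basis_vec:
  "k \<in> {1..n} \<Longrightarrow> compress n D_op (basis_vec (int k)) = of_nat k *\<^sub>c basis_vec (int k)"
  using D_op_eqI[OF has_L2_deriv_basis_vec[of "int k"]] by (simp add: compress_D_op mult.assoc[symmetric])

lemma cinner_basis_vec_compress_D:
  assumes "k \<in> {1..n}"
  shows "cinner (basis_vec (int k)) (compress n D_op \<xi>) = of_nat k * cinner (basis_vec (int k)) \<xi>"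
  using cinner_basis_vec_D_op[OF range_proj_D_dom[of n \<xi>], of "int k"] assms
  by (simp add: compress_D_op cinner_basis_vec_proj)

lemma ad_matrix:
  assumes "clinear T" "k \<in> {1..n}" "l \<in> {1..n}"
  shows "cinner (basis_vec (int k)) (ad n T (basis_vec (int l))) =
    (of_nat k - of_nat l) * cinner (basis_vec (int k)) (T (basis_vec (int l)))"
  using assms
  by (simp add: ad_def cinner_diff_right cinner_basis_vec_compress_D compress_D_basis_vec clinear_cscale left_diff_distrib)

lemma symbol_expand:
  assumes T: "clinear T"
  shows "symbol n T x =
    (\<Sum>k = 1..n. \<Sum>l = 1..n. cinner (basis_vec (int k)) (T (basis_vec (int l))) / n * fourier (int k - int l) x)"
proof -
  let ?S = "\<Sum>k = 1..n. fourier (- int k) x *\<^sub>c basis_vec (int k)"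
  let ?t = "\<lambda>k l. cinner (basis_vec (int k)) (T (basis_vec (int l)))"
  have T_S: "T ?S = (\<Sum>l = 1..n. fourier (- int l) x *\<^sub>c T (basis_vec (int l)))"
    by (simp add: clinear_sum[OF T] clinear_cscale[OF T])
  have "cinner ?S (T ?S) = (\<Sum>k = 1..n. fourier (int k) x * cinner (basis_vec (int k)) (T ?S))"
    by (subst cinner_sum_left) (simp add: cnj_fourier)
  also have "\<dots> = (\<Sum>k = 1..n. \<Sum>l = 1..n. ?t k l * (fourier (int k) x * fourier (- int l) x))"
    unfolding T_S cinner_sum_right cinner_cscale_right sum_distrib_left
    by (intro sum.cong refl) (simp only: mult_ac)
  also have "\<dots> = (\<Sum>k = 1..n. \<Sum>l = 1..n. ?t k l * fourier (int k - int l) x)"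
    by (simp only: fourier_add[symmetric] diff_conv_add_uminus)
  finally have S: "cinner ?S (T ?S) = (\<Sum>k = 1..n. \<Sum>l = 1..n. ?t k l * fourier (int k - int l) x)" .
  have "complex_of_real (1 / sqrt n) * complex_of_real (1 / sqrt n) = of_real (1 / n)"
    by (simp only: of_real_mult[symmetric]) simp
  then have "symbol n T x = of_real (1 / n) * cinner ?S (T ?S)"
    unfolding symbol_def fejer_vec_def clinear_cscale[OF T] cinner_cscale_left cinner_cscale_right
    by (simp only: mult.assoc[symmetric] complex_cnj_complex_of_real)
  then show ?thesis
    unfolding S by (simp add: sum_distrib_left sum_divide_distrib)
qed

lemma symbol_cont_circle:
  assumes T: "clinear T"
  shows "symbol n T \<in> cont_circle"
  unfolding symbol_expand[OF T, abs_def]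
  by (intro cont_circle_sum cont_circle_cmult fourier_cont_circle)

text \<open>Differentiating the symbol amounts to commuting with \<open>P\<^sub>n D P\<^sub>n\<close>, because \<open>x\<close> moves the
  vectors by the unitary group generated by \<open>D\<close>.\<close>

lemma symbol_has_vector_derivative:
  assumes T: "clinear T"
  shows "(symbol n T has_vector_derivative \<i> * symbol n (ad n T) x) (at x)"
proof -
  have "((\<lambda>x. \<Sum>k = 1..n. \<Sum>l = 1..n. cinner (basis_vec (int k)) (T (basis_vec (int l))) / n * fourier (int k - int l) x)
    has_vector_derivative
    (\<Sum>k = 1..n. \<Sum>l = 1..n. cinner (basis_vec (int k)) (T (basis_vec (int l))) / n *
      (\<i> * of_int (int k - int l) * fourier (int k - int l) x))) (at x)"
    by (intro has_vector_derivative_sum has_vector_derivative_mult_right fourier_has_vector_derivative)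
  moreover have "(\<Sum>k = 1..n. \<Sum>l = 1..n. cinner (basis_vec (int k)) (T (basis_vec (int l))) / n *
      (\<i> * of_int (int k - int l) * fourier (int k - int l) x)) = \<i> * symbol n (ad n T) x"
    unfolding symbol_expand[OF clinear_ad[OF T]] sum_distrib_left
    by (intro sum.cong refl) (simp add: ad_matrix[OF T])
  ultimately show ?thesis
    by (simp add: symbol_expand[OF T, abs_def])
qed

text \<open>The higher derivatives are the symbols of iterated commutators, up to powers of \<open>\<i>\<close>.\<close>

lemma symbol_smooth_circle:
  assumes T: "clinear T"
  shows "symbol n T \<in> smooth_circle"
proof -
  have lin: "clinear ((ad n ^^ j) T)" for j
    by (induction j) (auto intro: clinear_ad T)
  have "((\<lambda>x. \<i> ^ j * symbol n ((ad n ^^ j) T) x) has_vector_derivative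
      \<i> ^ Suc j * symbol n ((ad n ^^ Suc j) T) x) (at x)" for j x
    using has_vector_derivative_mult_right[OF symbol_has_vector_derivative[OF lin[of j]], of "\<i> ^ j" n x]
    by (simp add: mult_ac)
  then show ?thesis
    unfolding smooth_circle_def using symbol_cont_circle[OF T, of n]
    by (intro CollectI conjI exI[of _ "\<lambda>j x. \<i> ^ j * symbol n ((ad n ^^ j) T) x"]) (auto simp: cont_circle_def)
qed

lemma commutator_norm_toeplitz:
  assumes "\<And>\<xi>. T \<xi> \<in> range (proj n)"
  shows "commutator_norm (range (proj n)) (compress n D_op) T = op_norm (range (proj n)) (ad n T)"
proof -
  have "{\<xi> \<in> range (proj n). T \<xi> \<in> range (proj n)} = range (proj n)"
    using assms by blast
  then show ?thesis
    by (simp only: commutator_norm_def ad_def[abs_def])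
qed

lemma commutator_norm_symbol_le:
  assumes T: "clinear T" and n: "n \<ge> 1" and c: "0 \<le> c"
    and le: "op_norm (range (proj n)) (ad n T) \<le> ennreal c"
  shows "commutator_norm D_dom D_op (mult_op (symbol n T)) \<le> ennreal c"
proof (rule commutator_norm_circle_le)
  show "symbol n T \<in> cont_circle"
    by (rule symbol_cont_circle[OF T])
  show "(\<lambda>x. \<i> * symbol n (ad n T) x) \<in> cont_circle"
    by (intro cont_circle_cmult symbol_cont_circle clinear_ad T)
  show "(symbol n T has_vector_derivative \<i> * symbol n (ad n T) x) (at x)" for x
    by (rule symbol_has_vector_derivative[OF T])
  show "cmod (\<i> * symbol n (ad n T) x) \<le> c" for x
    using cmod_symbol_le[OF n le c] by (simp add: norm_mult)
qed

section \<open>Toeplitz matrices\<close>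

lemma mult_op_toeplitz:
  assumes f: "f \<in> cont_circle"
  shows "cinner (basis_vec k) (mult_op f (basis_vec l)) = cinner (basis_vec (k - l)) (mult_op f (basis_vec 0))"
proof (transfer fixing: f k l)
  have "cnj (fourier k x) * (f x * fourier l x) = cnj (fourier (k - l) x) * (f x * fourier 0 x)" for x
    using fourier_add[of "- k" l x] by (simp add: cnj_fourier)
  then show "(\<integral>x. cnj (exp (\<i> * of_int k * of_real x)) *
       (if f \<in> cont_circle then f x * exp (\<i> * of_int l * of_real x) else 0) \<partial>circ) =
     (\<integral>x. cnj (exp (\<i> * of_int (k - l) * of_real x)) *
       (if f \<in> cont_circle then f x * exp (\<i> * of_int 0 * of_real x) else 0) \<partial>circ)"
    using f unfolding fourier_def[symmetric] by (simp only: if_True)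
qed

text \<open>The diagonal through the entry \<open>(k, l)\<close> of an \<open>n \<times> n\<close> matrix has \<open>n - |k - l|\<close> entries. Averaging over
  diagonals is how the symbol of a Toeplitz matrix arises; these bounds suffice to compare the average with the entry.\<close>

lemma card_diagonal:
  assumes "k \<in> {1..n}" "l \<in> {1..n}"
  shows "real n - \<bar>real k - real l\<bar> \<le> card {p \<in> {1..n} \<times> {1..n}. int (fst p) - int (snd p) = int k - int l}"
    and "card {p \<in> {1..n} \<times> {1..n}. int (fst p) - int (snd p) = int k - int l} \<le> n"
proof -
  let ?S = "{p \<in> {1..n} \<times> {1..n}. int (fst p) - int (snd p) = int k - int l}"
  have fin: "finite ?S" by (rule finite_subset[of _ "{1..n} \<times> {1..n}"]) auto
  have "inj_on snd ?S" by (auto simp: inj_on_def)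
  moreover have "snd ` ?S \<subseteq> {1..n}" by auto
  ultimately have "card ?S \<le> card {1..n}"
    by (intro card_inj_on_le) auto
  then show "card ?S \<le> n" by simp
  show "real n - \<bar>real k - real l\<bar> \<le> card ?S"
  proof (cases "l \<le> k")
    case True
    have "(\<lambda>j. (j + (k - l), j)) ` {1..n - (k - l)} \<subseteq> ?S"
      using assms True by auto
    from card_mono[OF fin this] have "card ((\<lambda>j. (j + (k - l), j)) ` {1..n - (k - l)}) \<le> card ?S" .
    moreover have "card ((\<lambda>j. (j + (k - l), j)) ` {1..n - (k - l)}) = n - (k - l)"
      by (subst card_image) (auto simp: inj_on_def)
    ultimately have "n - (k - l) \<le> card ?S" by (simp only:)
    then show ?thesis using True assms by (simp add: of_nat_diff)
  next
    case False
    have "(\<lambda>j. (j, j + (l - k))) ` {1..n - (l - k)} \<subseteq> ?S"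
      using assms False by auto
    from card_mono[OF fin this] have "card ((\<lambda>j. (j, j + (l - k))) ` {1..n - (l - k)}) \<le> card ?S" .
    moreover have "card ((\<lambda>j. (j, j + (l - k))) ` {1..n - (l - k)}) = n - (l - k)"
      by (subst card_image) (auto simp: inj_on_def)
    ultimately have "n - (l - k) \<le> card ?S" by (simp only:)
    then show ?thesis using False assms by (simp add: of_nat_diff)
  qed
qed

lemma cinner_mult_op_symbol:
  assumes T: "clinear T"
  shows "cinner (basis_vec i) (mult_op (symbol n T) (basis_vec j)) =
    (\<Sum>k = 1..n. \<Sum>l = 1..n. if int k - int l = i - j then cinner (basis_vec (int k)) (T (basis_vec (int l))) / n else 0)"
proof -
  have "mult_op (symbol n T) (basis_vec j) = (\<Sum>k = 1..n. \<Sum>l = 1..n.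
     (cinner (basis_vec (int k)) (T (basis_vec (int l))) / n) *\<^sub>c basis_vec (int k - int l + j))"
    unfolding symbol_expand[OF T, abs_def]
    by (simp only: mult_op_sum_fun cont_circle_sum cont_circle_cmult fourier_cont_circle
        mult_op_cmult_fun mult_op_fourier_basis_vec)
  then show ?thesis
    by (simp only: cinner_sum_right cinner_cscale_right cinner_basis_vec)
       (intro sum.cong refl, auto)
qed

text \<open>Compressing the symbol again multiplies the entry with indices \<open>i\<close>, \<open>j\<close> by the length of its
  diagonal over \<open>n\<close>, so the remainder carries a factor of at most \<open>|i - j| / n\<close>; the commutator
  carries the factor \<open>i - j\<close>.\<close>

lemma toeplitz_remainder_entry:
  fixes f n
  defines "T \<equiv> compress n (mult_op f)"
  defines "R \<equiv> compress n (mult_op (\<lambda>x. f x - symbol n T x))"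
  assumes f: "f \<in> cont_circle" and i: "i \<in> {1..n}" and j: "j \<in> {1..n}"
  shows "cmod (cinner (basis_vec (int i)) (R (basis_vec (int j)))) \<le>
    cmod (cinner (basis_vec (int i)) (ad n T (basis_vec (int j)))) / n"
proof -
  have n: "n \<ge> 1" using i by auto
  have T: "clinear T"
    unfolding T_def by (intro clinear_compress clinear_mult_op)
  define a where "a m = cinner (basis_vec m) (mult_op f (basis_vec 0))" for m
  have T_entry: "cinner (basis_vec (int k)) (T (basis_vec (int l))) = a (int k - int l)"
    if "k \<in> {1..n}" "l \<in> {1..n}" for k l
    using that by (simp add: T_def compress_def cinner_basis_vec_proj a_def mult_op_toeplitz[OF f, of "int k" "int l"])
  define S where "S = {p \<in> {1..n} \<times> {1..n}. int (fst p) - int (snd p) = int i - int j}"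
  have "cinner (basis_vec (int i)) (mult_op (symbol n T) (basis_vec (int j))) =
      (\<Sum>k = 1..n. \<Sum>l = 1..n. if int k - int l = int i - int j then a (int i - int j) / n else 0)"
    unfolding cinner_mult_op_symbol[OF T] by (intro sum.cong refl) (auto simp: T_entry)
  also have "\<dots> = (\<Sum>p\<in>{1..n} \<times> {1..n}. if int (fst p) - int (snd p) = int i - int j then a (int i - int j) / n else 0)"
    by (simp add: sum.cartesian_product case_prod_beta)
  also have "\<dots> = (\<Sum>p\<in>S. a (int i - int j) / n)"
    unfolding S_def by (rule sum.inter_filter[symmetric]) auto
  also have "\<dots> = of_real (card S / n) * a (int i - int j)"
    by simp
  finally have "cinner (basis_vec (int i)) (R (basis_vec (int j))) = of_real (1 - card S / n) * a (int i - int j)"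
    using i j symbol_cont_circle[OF T, of n] T_entry[OF i j]
    by (simp add: R_def compress_def cinner_basis_vec_proj mult_op_diff_fun f cinner_diff_right algebra_simps)
       (simp add: T_def compress_def cinner_basis_vec_proj)
  then have "cmod (cinner (basis_vec (int i)) (R (basis_vec (int j)))) = \<bar>1 - card S / n\<bar> * cmod (a (int i - int j))"
    by (simp only: norm_mult norm_of_real)
  also have "\<dots> \<le> \<bar>real i - real j\<bar> / n * cmod (a (int i - int j))"
  proof (rule mult_right_mono)
    show "\<bar>1 - real (card S) / n\<bar> \<le> \<bar>real i - real j\<bar> / n"
    proof -
      have "1 - real (card S) / n = (real n - card S) / n"
        using n by (simp add: field_simps)
      then show ?thesis
        using card_diagonal[OF i j, folded S_def] by (auto intro!: divide_right_mono)
    qed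
  qed simp
  also have "\<dots> = cmod (cinner (basis_vec (int i)) (ad n T (basis_vec (int j)))) / n"
  proof -
    have "cmod (of_nat i - of_nat j) = \<bar>real i - real j\<bar>"
      using norm_of_real[of "real i - real j", where 'a = complex] by simp
    then show ?thesis
      unfolding ad_matrix[OF T i j] T_entry[OF i j] norm_mult by simp
  qed
  finally show ?thesis .
qed

text \<open>The signs of the entries are lost, so the comparison is made columnwise in the Euclidean norm; summing
  over \<open>n\<close> columns costs a factor \<open>\<surd>n\<close>, which the factor \<open>1/n\<close> absorbs.\<close>

lemma toeplitz_remainder_norm:
  fixes f n
  defines "T \<equiv> compress n (mult_op f)"
  defines "R \<equiv> compress n (mult_op (\<lambda>x. f x - symbol n T x))"
  assumes f: "f \<in> cont_circle" and n: "n \<ge> 1" and le: "op_norm (range (proj n)) (ad n T) \<le> 1"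
  shows "op_norm (range (proj n)) R \<le> ennreal (1 / sqrt n)"
proof -
  have R: "clinear R"
    unfolding R_def by (intro clinear_compress clinear_mult_op)
  have R_range: "proj n (R \<xi>) = R \<xi>" for \<xi>
    by (simp add: R_def compress_def)
  have col: "norm (R (basis_vec (int j))) \<le> 1 / n" if j: "j \<in> {1..n}" for j
  proof -
    have "(norm (R (basis_vec (int j))))\<^sup>2 = (\<Sum>i = 1..n. (cmod (cinner (basis_vec (int i)) (R (basis_vec (int j)))))\<^sup>2)"
      using norm_proj_square[of n "R (basis_vec (int j))"] by (simp add: R_range)
    also have "\<dots> \<le> (\<Sum>i = 1..n. (cmod (cinner (basis_vec (int i)) (ad n T (basis_vec (int j)))) / n)\<^sup>2)"
      by (intro sum_mono power_mono) (use toeplitz_remainder_entry[OF f _ j] in \<open>auto simp: R_def T_def\<close>)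
    also have "\<dots> = (norm (proj n (ad n T (basis_vec (int j)))) / n)\<^sup>2"
      by (simp add: norm_proj_square power_divide sum_divide_distrib)
    also have "\<dots> \<le> (1 / n)\<^sup>2"
    proof (intro power_mono divide_right_mono)
      have "basis_vec (int j) \<in> range (proj n)" using j by (simp add: in_range_proj_iff)
      then have "norm (ad n T (basis_vec (int j))) \<le> 1"
        using le unfolding op_norm_le_1_iff by (metis norm_basis_vec order_refl)
      then show "norm (proj n (ad n T (basis_vec (int j)))) \<le> 1"
        using norm_proj_le order_trans by blast
    qed auto
    finally show ?thesis by (rule power2_le_imp_le) simp
  qed
  have "norm (R \<xi>) \<le> 1 / sqrt n" if \<xi>: "proj n \<xi> = \<xi>" "norm \<xi> \<le> 1" for \<xi>
  proof -
    let ?c = "\<lambda>j. cinner (basis_vec (int j)) \<xi>"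
    have "R \<xi> = (\<Sum>j = 1..n. ?c j *\<^sub>c R (basis_vec (int j)))"
      by (subst \<xi>(1)[symmetric]) (simp add: proj_def clinear_sum[OF R] clinear_cscale[OF R])
    then have "norm (R \<xi>) \<le> (\<Sum>j = 1..n. norm (?c j *\<^sub>c R (basis_vec (int j))))"
      by (simp only: norm_sum)
    also have "\<dots> \<le> (\<Sum>j = 1..n. cmod (?c j) * (1 / n))"
      unfolding norm_cscale by (intro sum_mono mult_left_mono col) auto
    finally have "norm (R \<xi>) \<le> (\<Sum>j = 1..n. cmod (?c j) * (1 / n))" .
    then have "(norm (R \<xi>))\<^sup>2 \<le> (\<Sum>j = 1..n. cmod (?c j) * (1 / n))\<^sup>2"
      by (rule power_mono) simp
    also have "\<dots> \<le> (\<Sum>j = 1..n. (cmod (?c j))\<^sup>2) * (\<Sum>j = 1..n. (1 / n)\<^sup>2)"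
      by (rule Cauchy_Schwarz_ineq_sum)
    also have "(\<Sum>j = 1..n. (cmod (?c j))\<^sup>2) = (norm \<xi>)\<^sup>2"
      using norm_proj_square[of n \<xi>] \<xi>(1) by simp
    also have "(norm \<xi>)\<^sup>2 * (\<Sum>j = 1..n. (1 / real n)\<^sup>2) \<le> 1 * (\<Sum>j = 1..n. (1 / real n)\<^sup>2)"
      using \<xi>(2) by (intro mult_right_mono) (auto simp: power_le_one sum_nonneg)
    also have "\<dots> = (1 / sqrt n)\<^sup>2"
      using n by (simp add: power_divide power2_eq_square)
    finally show ?thesis by (rule power2_le_imp_le) simp
  qed
  then show ?thesis
    by (auto simp: op_norm_le_iff in_range_proj_iff)
qed

section \<open>States of operator systems\<close>

text \<open>Positivity sees an operator through its quadratic form, so closure under adjoints is expressed on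
  that level.\<close>

locale operator_system =
  fixes V :: "L2_circle set" and E :: "(L2_circle \<Rightarrow> L2_circle) set" and I :: "L2_circle \<Rightarrow> L2_circle"
  assumes unit: "I \<in> E" and unit_apply: "\<And>\<xi>. \<xi> \<in> V \<Longrightarrow> I \<xi> = \<xi>"
    and add: "\<And>S T. S \<in> E \<Longrightarrow> T \<in> E \<Longrightarrow> (\<lambda>\<xi>. S \<xi> + T \<xi>) \<in> E"
    and scale: "\<And>c T. T \<in> E \<Longrightarrow> (\<lambda>\<xi>. c *\<^sub>c T \<xi>) \<in> E"
    and adjoint: "\<And>T. T \<in> E \<Longrightarrow> \<exists>T'\<in>E. \<forall>\<xi>\<in>V. cinner \<xi> (T' \<xi>) = cnj (cinner \<xi> (T \<xi>))"
    and linear: "\<And>T. T \<in> E \<Longrightarrow> clinear T"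
    and scale_closed: "\<And>c \<xi>. \<xi> \<in> V \<Longrightarrow> c *\<^sub>c \<xi> \<in> V"
begin

lemma norm_apply_le:
  assumes T: "T \<in> E" and le: "op_norm V T \<le> ennreal c" and c: "0 \<le> c" and \<xi>: "\<xi> \<in> V"
  shows "norm (T \<xi>) \<le> c * norm \<xi>"
proof (cases "\<xi> = 0")
  case True
  then show ?thesis by (simp add: clinear_zero[OF linear[OF T]])
next
  case False
  let ?r = "complex_of_real (1 / norm \<xi>)"
  have "norm (T (?r *\<^sub>c \<xi>)) \<le> c"
    using le False scale_closed[OF \<xi>, of ?r] by (auto simp: op_norm_le_iff[OF c] norm_divide)
  then show ?thesis
    using False by (simp add: clinear_cscale[OF linear[OF T]] norm_divide field_simps)
qed

text \<open>If \<open>T\<close> has norm at most \<open>c\<close> and \<open>|u| = 1\<close>, the operator \<open>2 c + u T + (u T)*\<close> is positive. Applied to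
  \<open>u = 1\<close> and \<open>u = \<i>\<close> this makes \<open>\<phi>\<close> hermitian; the \<open>u\<close> that turns \<open>\<phi> T\<close> into \<open>- |\<phi> T|\<close> then gives the bound.\<close>

lemma positive_functional_bound:
  assumes \<phi>_add: "\<And>S T. S \<in> E \<Longrightarrow> T \<in> E \<Longrightarrow> \<phi> (\<lambda>\<xi>. S \<xi> + T \<xi>) = \<phi> S + \<phi> T"
    and \<phi>_scale: "\<And>c T. T \<in> E \<Longrightarrow> \<phi> (\<lambda>\<xi>. c *\<^sub>c T \<xi>) = c * \<phi> T"
    and \<phi>_pos: "\<And>T. T \<in> E \<Longrightarrow> positive_op V T \<Longrightarrow> \<phi> T \<in> \<real>\<^sub>\<ge>\<^sub>0"
    and T: "T \<in> E" and le: "op_norm V T \<le> ennreal c" and c: "0 \<le> c"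
  shows "cmod (\<phi> T) \<le> c * Re (\<phi> I)"
proof -
  obtain T' where T': "T' \<in> E" and adj: "\<And>\<xi>. \<xi> \<in> V \<Longrightarrow> cinner \<xi> (T' \<xi>) = cnj (cinner \<xi> (T \<xi>))"
    using adjoint[OF T] by blast
  have pos: "of_real (2 * c) * \<phi> I + (u * \<phi> T + cnj u * \<phi> T') \<in> \<real>\<^sub>\<ge>\<^sub>0" if u: "cmod u = 1" for u
  proof -
    let ?A = "\<lambda>\<xi>. u *\<^sub>c T \<xi> + cnj u *\<^sub>c T' \<xi>"
    have A: "?A \<in> E" by (intro add scale T T')
    have cI: "(\<lambda>\<xi>. of_real (2 * c) *\<^sub>c I \<xi>) \<in> E" by (intro scale unit)
    have "positive_op V (\<lambda>\<xi>. of_real (2 * c) *\<^sub>c I \<xi> + ?A \<xi>)"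
      unfolding positive_op_def
    proof
      fix \<xi> assume \<xi>: "\<xi> \<in> V"
      let ?z = "u * cinner \<xi> (T \<xi>)"
      have "cmod ?z \<le> c * (norm \<xi>)\<^sup>2"
      proof -
        have "cmod (cinner \<xi> (T \<xi>)) \<le> norm \<xi> * norm (T \<xi>)" by (rule cmod_cinner_le)
        also have "\<dots> \<le> norm \<xi> * (c * norm \<xi>)"
          by (intro mult_left_mono norm_apply_le T le c \<xi>) auto
        finally show ?thesis using u by (simp add: norm_mult power2_eq_square mult_ac)
      qed
      then have nn: "0 \<le> 2 * (c * (norm \<xi>)\<^sup>2) + 2 * Re ?z"
        using abs_Re_le_cmod[of ?z] by linarith
      have "cinner \<xi> (of_real (2 * c) *\<^sub>c I \<xi> + ?A \<xi>) = of_real (2 * c * (norm \<xi>)\<^sup>2) + (?z + cnj ?z)"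
        using \<xi> by (simp add: cinner_add_right unit_apply adj cinner_self)
      also have "\<dots> = of_real (2 * (c * (norm \<xi>)\<^sup>2) + 2 * Re ?z)"
        by (simp only: complex_add_cnj) simp
      finally show "cinner \<xi> (of_real (2 * c) *\<^sub>c I \<xi> + ?A \<xi>) \<in> \<real>\<^sub>\<ge>\<^sub>0"
        using nn by (simp only: nonneg_Reals_of_real_iff)
    qed
    from \<phi>_pos[OF add[OF cI A] this] show ?thesis
      by (simp only: \<phi>_add[OF cI A] \<phi>_add[OF scale[OF T] scale[OF T']]
          \<phi>_scale[OF T] \<phi>_scale[OF T'] \<phi>_scale[OF unit])
  qed
  have I_pos: "\<phi> I \<in> \<real>\<^sub>\<ge>\<^sub>0"
    by (rule \<phi>_pos[OF unit]) (simp add: positive_op_def unit_apply cinner_self)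
  have "Im (\<phi> T) + Im (\<phi> T') = 0" "Re (\<phi> T) - Re (\<phi> T') = 0"
    using pos[of 1] pos[of \<i>] I_pos by (auto simp: complex_nonneg_Reals_iff)
  then have herm: "\<phi> T' = cnj (\<phi> T)" by (simp add: complex_eq_iff)
  obtain u where u: "cmod u = 1" "u * \<phi> T = of_real (cmod (\<phi> T))"
    using ex_unit_rotation by blast
  have "- u * \<phi> T + cnj (- u) * \<phi> T' = - (u * \<phi> T + cnj (u * \<phi> T))"
    by (simp add: herm)
  also have "\<dots> = of_real (- 2 * cmod (\<phi> T))"
    unfolding u(2) by simp
  finally have "of_real (2 * c) * \<phi> I + of_real (- 2 * cmod (\<phi> T)) \<in> \<real>\<^sub>\<ge>\<^sub>0"
    using pos[of "- u"] u(1) by (simp only: norm_minus_cancel)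
  then show ?thesis by (simp add: complex_nonneg_Reals_iff)
qed

text \<open>Unitality replaces the condition on the norm. It is evidently preserved by pullback along unital
  positive maps, whereas the norm of a pullback is not evident.\<close>

lemma state_space_iff:
  "\<phi> \<in> state_space V E \<longleftrightarrow> \<phi> \<in> extensional E \<and>
    (\<forall>S\<in>E. \<forall>T\<in>E. \<phi> (\<lambda>\<xi>. S \<xi> + T \<xi>) = \<phi> S + \<phi> T) \<and>
    (\<forall>c. \<forall>T\<in>E. \<phi> (\<lambda>\<xi>. c *\<^sub>c T \<xi>) = c * \<phi> T) \<and>
    (\<forall>T\<in>E. positive_op V T \<longrightarrow> \<phi> T \<in> \<real>\<^sub>\<ge>\<^sub>0) \<and> \<phi> I = 1"
proof -
  have "(SUP T\<in>{T\<in>E. op_norm V T \<le> 1}. ennreal (cmod (\<phi> T))) = 1 \<longleftrightarrow> \<phi> I = 1"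
    if \<phi>: "\<forall>S\<in>E. \<forall>T\<in>E. \<phi> (\<lambda>\<xi>. S \<xi> + T \<xi>) = \<phi> S + \<phi> T"
    "\<forall>c. \<forall>T\<in>E. \<phi> (\<lambda>\<xi>. c *\<^sub>c T \<xi>) = c * \<phi> T"
    "\<forall>T\<in>E. positive_op V T \<longrightarrow> \<phi> T \<in> \<real>\<^sub>\<ge>\<^sub>0"
  proof -
    have "positive_op V I" by (simp add: positive_op_def unit_apply cinner_self)
    then have "\<phi> I \<in> \<real>\<^sub>\<ge>\<^sub>0" using \<phi>(3) unit by blast
    then have I: "\<phi> I = of_real (Re (\<phi> I))" "0 \<le> Re (\<phi> I)" "cmod (\<phi> I) = Re (\<phi> I)"
      by (auto simp: complex_nonneg_Reals_iff complex_eq_iff cmod_def)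
    have I_contraction: "I \<in> {T\<in>E. op_norm V T \<le> 1}"
      using unit by (simp add: op_norm_le_1_iff unit_apply)
    have "(SUP T\<in>{T\<in>E. op_norm V T \<le> 1}. ennreal (cmod (\<phi> T))) = ennreal (Re (\<phi> I))"
    proof (rule antisym)
      show "(SUP T\<in>{T\<in>E. op_norm V T \<le> 1}. ennreal (cmod (\<phi> T))) \<le> ennreal (Re (\<phi> I))"
      proof (rule SUP_least)
        fix T assume "T \<in> {T\<in>E. op_norm V T \<le> 1}"
        then have "cmod (\<phi> T) \<le> 1 * Re (\<phi> I)"
          using \<phi> by (intro positive_functional_bound) auto
        then show "ennreal (cmod (\<phi> T)) \<le> ennreal (Re (\<phi> I))" by (simp add: ennreal_leI)
      qed
      show "ennreal (Re (\<phi> I)) \<le> (SUP T\<in>{T\<in>E. op_norm V T \<le> 1}. ennreal (cmod (\<phi> T)))"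
        using SUP_upper[OF I_contraction, of "\<lambda>T. ennreal (cmod (\<phi> T))"] I(3) by simp
    qed
    moreover have "\<phi> I = 1 \<longleftrightarrow> Re (\<phi> I) = 1"
      using I(1) by (metis of_real_1 one_complex.simps(1))
    ultimately show ?thesis using I(2) by simp
  qed
  then show ?thesis unfolding state_space_def by blast
qed

lemma
  assumes "\<phi> \<in> state_space V E"
  shows state_add: "S \<in> E \<Longrightarrow> T \<in> E \<Longrightarrow> \<phi> (\<lambda>\<xi>. S \<xi> + T \<xi>) = \<phi> S + \<phi> T"
    and state_scale: "T \<in> E \<Longrightarrow> \<phi> (\<lambda>\<xi>. c *\<^sub>c T \<xi>) = c * \<phi> T"
    and state_positive: "T \<in> E \<Longrightarrow> positive_op V T \<Longrightarrow> \<phi> T \<in> \<real>\<^sub>\<ge>\<^sub>0"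
    and state_unit: "\<phi> I = 1"
    and state_extensional: "\<phi> \<in> extensional E"
  using assms by (simp_all add: state_space_iff)

lemma state_bound:
  assumes \<phi>: "\<phi> \<in> state_space V E" and T: "T \<in> E" "op_norm V T \<le> ennreal c" "0 \<le> c"
  shows "cmod (\<phi> T) \<le> c"
proof -
  have "cmod (\<phi> T) \<le> c * Re (\<phi> I)"
    by (rule positive_functional_bound[where \<phi> = \<phi>, OF _ _ _ T])
       (rule state_add[OF \<phi>] state_scale[OF \<phi>] state_positive[OF \<phi>]; assumption)+
  then show ?thesis using state_unit[OF \<phi>] by simp
qed

lemma state_diff:
  assumes \<phi>: "\<phi> \<in> state_space V E" and ST: "S \<in> E" "T \<in> E"
  shows "\<phi> (\<lambda>\<xi>. S \<xi> - T \<xi>) = \<phi> S - \<phi> T"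
  using state_add[OF \<phi> ST(1) scale[OF ST(2), of "- 1"]] state_scale[OF \<phi> ST(2), of "- 1"]
  by (simp add: cscale_minus_one)

end

lemma state_pullback:
  assumes E: "operator_system V E I" and E': "operator_system V' E' I'"
    and \<phi>: "\<phi> \<in> state_space V' E'"
    and g: "\<And>T. T \<in> E \<Longrightarrow> g T \<in> E'"
    and g_add: "\<And>S T. S \<in> E \<Longrightarrow> T \<in> E \<Longrightarrow> g (\<lambda>\<xi>. S \<xi> + T \<xi>) = (\<lambda>\<xi>. g S \<xi> + g T \<xi>)"
    and g_scale: "\<And>c T. T \<in> E \<Longrightarrow> g (\<lambda>\<xi>. c *\<^sub>c T \<xi>) = (\<lambda>\<xi>. c *\<^sub>c g T \<xi>)"
    and g_pos: "\<And>T. T \<in> E \<Longrightarrow> positive_op V T \<Longrightarrow> positive_op V' (g T)"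
    and g_unit: "g I = I'"
  shows "restrict (\<lambda>T. \<phi> (g T)) E \<in> state_space V E"
proof -
  interpret E: operator_system V E I by fact
  interpret E': operator_system V' E' I' by fact
  show ?thesis
    using E'.state_add[OF \<phi>] E'.state_scale[OF \<phi>] E'.state_positive[OF \<phi>] E'.state_unit[OF \<phi>]
    by (simp add: E.state_space_iff E.unit E.add E.scale g g_add g_scale g_pos g_unit)
qed

lemma cnj_cinner_mult_op:
  "f \<in> cont_circle \<Longrightarrow> cinner \<xi> (mult_op (\<lambda>x. cnj (f x)) \<xi>) = cnj (cinner \<xi> (mult_op f \<xi>))"
  using cinner_mult_op_left[of f \<xi> \<xi>] cinner_commute[of "mult_op f \<xi>" \<xi>] by simp

lemma operator_system_circle: "operator_system UNIV (mult_op ` cont_circle) (mult_op (\<lambda>x. 1))"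
proof
  show "(\<lambda>\<xi>. S \<xi> + T \<xi>) \<in> mult_op ` cont_circle"
    if ST: "S \<in> mult_op ` cont_circle" "T \<in> mult_op ` cont_circle" for S T
  proof -
    from ST obtain f g where fg: "f \<in> cont_circle" "S = mult_op f" "g \<in> cont_circle" "T = mult_op g" by blast
    then show ?thesis
      by (intro image_eqI[of _ _ "\<lambda>x. f x + g x"]) (auto simp: mult_op_add_fun intro: cont_circle_add)
  qed
  show "(\<lambda>\<xi>. c *\<^sub>c T \<xi>) \<in> mult_op ` cont_circle" if T: "T \<in> mult_op ` cont_circle" for c T
  proof -
    from T obtain f where f: "f \<in> cont_circle" "T = mult_op f" by blast
    then show ?thesis
      by (intro image_eqI[of _ _ "\<lambda>x. c * f x"]) (auto simp: mult_op_cmult_fun intro: cont_circle_cmult)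
  qed
  show "\<exists>T'\<in>mult_op ` cont_circle. \<forall>\<xi>\<in>UNIV. cinner \<xi> (T' \<xi>) = cnj (cinner \<xi> (T \<xi>))"
    if T: "T \<in> mult_op ` cont_circle" for T
  proof -
    from T obtain f where f: "f \<in> cont_circle" "T = mult_op f" by blast
    then show ?thesis
      by (intro bexI[of _ "mult_op (\<lambda>x. cnj (f x))"] imageI cont_circle_cnj) (auto simp: cnj_cinner_mult_op)
  qed
qed (auto intro: cont_circle_const clinear_mult_op simp: mult_op_const)

lemma toeplitz_system_eq: "toeplitz_system n = compress n ` mult_op ` cont_circle"
  by (simp add: toeplitz_system_def image_image)

lemma operator_system_toeplitz:
  "operator_system (range (proj n)) (toeplitz_system n) (compress n (mult_op (\<lambda>x. 1)))"
proof
  interpret C: operator_system UNIV "mult_op ` cont_circle" "mult_op (\<lambda>x. 1)" by (rule operator_system_circle)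
  show "compress n (mult_op (\<lambda>x. 1)) \<in> toeplitz_system n"
    using C.unit by (auto simp: toeplitz_system_eq)
  show "compress n (mult_op (\<lambda>x. 1)) \<xi> = \<xi>" if "\<xi> \<in> range (proj n)" for \<xi>
    using that by (simp add: compress_def mult_op_const in_range_proj_iff)
  show "(\<lambda>\<xi>. S \<xi> + T \<xi>) \<in> toeplitz_system n" if ST: "S \<in> toeplitz_system n" "T \<in> toeplitz_system n" for S T
  proof -
    from ST obtain A B where AB: "A \<in> mult_op ` cont_circle" "B \<in> mult_op ` cont_circle"
      "S = compress n A" "T = compress n B" unfolding toeplitz_system_eq by blast
    then have "(\<lambda>\<xi>. S \<xi> + T \<xi>) = compress n (\<lambda>\<xi>. A \<xi> + B \<xi>)" by (simp add: compress_def fun_eq_iff proj_add)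
    with C.add[OF AB(1,2)] show ?thesis unfolding toeplitz_system_eq by blast
  qed
  show "(\<lambda>\<xi>. c *\<^sub>c T \<xi>) \<in> toeplitz_system n" if T: "T \<in> toeplitz_system n" for c T
  proof -
    from T obtain A where A: "A \<in> mult_op ` cont_circle" "T = compress n A" unfolding toeplitz_system_eq by blast
    then have "(\<lambda>\<xi>. c *\<^sub>c T \<xi>) = compress n (\<lambda>\<xi>. c *\<^sub>c A \<xi>)" by (simp add: compress_def fun_eq_iff proj_cscale)
    with C.scale[OF A(1)] show ?thesis unfolding toeplitz_system_eq by blast
  qed
  show "\<exists>T'\<in>toeplitz_system n. \<forall>\<xi>\<in>range (proj n). cinner \<xi> (T' \<xi>) = cnj (cinner \<xi> (T \<xi>))"
    if T: "T \<in> toeplitz_system n" for T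
  proof -
    from T obtain A where A: "A \<in> mult_op ` cont_circle" "T = compress n A" unfolding toeplitz_system_eq by blast
    obtain A' where A': "A' \<in> mult_op ` cont_circle" "\<And>\<xi>. cinner \<xi> (A' \<xi>) = cnj (cinner \<xi> (A \<xi>))"
      using C.adjoint[OF A(1)] by blast
    have "cinner \<xi> (compress n A' \<xi>) = cnj (cinner \<xi> (T \<xi>))" for \<xi>
      by (simp add: A(2) compress_def cinner_proj A'(2))
    then show ?thesis using A'(1) unfolding toeplitz_system_eq by blast
  qed
  show "clinear T" if "T \<in> toeplitz_system n" for T
    using that by (auto simp: toeplitz_system_def intro: clinear_compress clinear_mult_op)
  show "c *\<^sub>c \<xi> \<in> range (proj n)" if "\<xi> \<in> range (proj n)" for c \<xi>
    using that by (simp add: in_range_proj_iff proj_cscale)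
qed

interpretation circle: operator_system UNIV "mult_op ` cont_circle" "mult_op (\<lambda>x. 1)"
  by (rule operator_system_circle)

interpretation toeplitz: operator_system "range (proj n)" "toeplitz_system n" "compress n (mult_op (\<lambda>x. 1))" for n
  by (rule operator_system_toeplitz)

text \<open>The pullbacks of states along \<open>f \<mapsto> P\<^sub>n f P\<^sub>n\<close> and \<open>T \<mapsto> symbol n T\<close>; \<open>restrict\<close> makes them extensional,
  as \<open>state_space\<close> demands.\<close>

definition dilate_state ::
  "nat \<Rightarrow> ((L2_circle \<Rightarrow> L2_circle) \<Rightarrow> complex) \<Rightarrow> (L2_circle \<Rightarrow> L2_circle) \<Rightarrow> complex" where
  "dilate_state n \<phi> = restrict (\<lambda>A. \<phi> (compress n A)) (mult_op ` cont_circle)"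

definition truncate_state ::
  "nat \<Rightarrow> ((L2_circle \<Rightarrow> L2_circle) \<Rightarrow> complex) \<Rightarrow> (L2_circle \<Rightarrow> L2_circle) \<Rightarrow> complex" where
  "truncate_state n \<phi> = restrict (\<lambda>T. \<phi> (mult_op (symbol n T))) (toeplitz_system n)"

lemma dilate_state_in:
  assumes "\<phi> \<in> toeplitz_states n"
  shows "dilate_state n \<phi> \<in> circle_states"
  unfolding dilate_state_def circle_states_def
proof (rule state_pullback[OF operator_system_circle operator_system_toeplitz assms[unfolded toeplitz_states_def]])
  show "positive_op (range (proj n)) (compress n A)" if "positive_op UNIV A" for A
    using that by (auto simp: positive_op_def compress_def cinner_proj)
qed (auto simp: toeplitz_system_eq compress_def fun_eq_iff proj_add proj_cscale)

lemma truncate_state_in: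
  assumes n: "n \<ge> 1" and "\<phi> \<in> circle_states"
  shows "truncate_state n \<phi> \<in> toeplitz_states n"
  unfolding truncate_state_def toeplitz_states_def
proof (rule state_pullback[OF operator_system_toeplitz operator_system_circle assms(2)[unfolded circle_states_def]])
  note cont = symbol_cont_circle[OF toeplitz.linear]
  show "mult_op (symbol n T) \<in> mult_op ` cont_circle" if "T \<in> toeplitz_system n" for T
    using cont[OF that] by blast
  show "mult_op (symbol n (\<lambda>\<xi>. S \<xi> + T \<xi>)) = (\<lambda>\<xi>. mult_op (symbol n S) \<xi> + mult_op (symbol n T) \<xi>)"
    if "S \<in> toeplitz_system n" "T \<in> toeplitz_system n" for S T
    using mult_op_add_fun[OF cont[OF that(1)] cont[OF that(2)]]
    by (simp add: fun_eq_iff symbol_def[abs_def] cinner_add_right)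
  show "mult_op (symbol n (\<lambda>\<xi>. c *\<^sub>c T \<xi>)) = (\<lambda>\<xi>. c *\<^sub>c mult_op (symbol n T) \<xi>)"
    if "T \<in> toeplitz_system n" for c T
    using mult_op_cmult_fun[OF cont[OF that]] by (simp add: fun_eq_iff symbol_def[abs_def])
  show "positive_op UNIV (mult_op (symbol n T))"
    if "T \<in> toeplitz_system n" "positive_op (range (proj n)) T" for T
    unfolding positive_op_def
  proof
    show "cinner \<xi> (mult_op (symbol n T) \<xi>) \<in> \<real>\<^sub>\<ge>\<^sub>0" for \<xi>
    proof (rule cinner_mult_op_nonneg[OF cont[OF that(1)]])
      show "symbol n T t \<in> \<real>\<^sub>\<ge>\<^sub>0" for t
        using that(2) fejer_vec_in_range unfolding positive_op_def symbol_def by blast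
    qed
  qed
  have "symbol n (compress n (mult_op (\<lambda>x. 1))) = (\<lambda>x. 1)"
    using norm_fejer_vec[OF n] by (simp add: fun_eq_iff symbol_compress) (simp add: symbol_def mult_op_const cinner_self)
  then show "mult_op (symbol n (compress n (mult_op (\<lambda>x. 1)))) = mult_op (\<lambda>x. 1)" by simp
qed

section \<open>Spectral distances\<close>

lemma spectral_dist_le:
  assumes "\<And>T. T \<in> E \<Longrightarrow> commutator_norm W D T \<le> 1 \<Longrightarrow> ennreal (cmod (\<phi> T - \<psi> T)) \<le> c"
  shows "spectral_dist E W D \<phi> \<psi> \<le> c"
  unfolding spectral_dist_def using assms by (auto intro: SUP_least)

lemma spectral_dist_ge:
  assumes "T \<in> E" "commutator_norm W D T \<le> 1"
  shows "ennreal (cmod (\<phi> T - \<psi> T)) \<le> spectral_dist E W D \<phi> \<psi>"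
  unfolding spectral_dist_def using assms by (auto intro: SUP_upper)

lemma spectral_dist_commute: "spectral_dist E W D \<phi> \<psi> = spectral_dist E W D \<psi> \<phi>"
  by (simp add: spectral_dist_def norm_minus_commute)

lemma spectral_dist_refl: "spectral_dist E W D \<phi> \<phi> = 0"
  using spectral_dist_le[of E W D \<phi> \<phi> 0] by simp

lemma spectral_dist_triangle:
  "spectral_dist E W D \<phi> \<rho> \<le> spectral_dist E W D \<phi> \<psi> + spectral_dist E W D \<psi> \<rho>"
proof (rule spectral_dist_le)
  fix T assume T: "T \<in> E" "commutator_norm W D T \<le> 1"
  have "ennreal (cmod (\<phi> T - \<rho> T)) \<le> ennreal (cmod (\<phi> T - \<psi> T) + cmod (\<psi> T - \<rho> T))"
    using norm_triangle_ineq[of "\<phi> T - \<psi> T" "\<psi> T - \<rho> T"] by (intro ennreal_leI) simp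
  also have "\<dots> = ennreal (cmod (\<phi> T - \<psi> T)) + ennreal (cmod (\<psi> T - \<rho> T))" by simp
  also have "\<dots> \<le> spectral_dist E W D \<phi> \<psi> + spectral_dist E W D \<psi> \<rho>"
    by (intro add_mono spectral_dist_ge T)
  finally show "ennreal (cmod (\<phi> T - \<rho> T)) \<le> \<dots>" .
qed

lemma circle_state_bound:
  assumes \<phi>: "\<phi> \<in> circle_states" and f: "f \<in> cont_circle" and le: "\<And>t. cmod (f t) \<le> c"
  shows "cmod (\<phi> (mult_op f)) \<le> c"
proof -
  have c: "0 \<le> c" using le[of 0] norm_ge_zero order_trans by blast
  have "op_norm UNIV (mult_op f) \<le> ennreal c"
    unfolding op_norm_le_iff[OF c]
  proof (intro ballI impI)
    fix \<xi> :: L2_circle assume "norm \<xi> \<le> 1"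
    then show "norm (mult_op f \<xi>) \<le> c"
      using norm_mult_op_bound[OF f le, of \<xi>] mult_left_mono[of "norm \<xi>" 1 c] c by simp
  qed
  then show ?thesis
    by (rule circle.state_bound[OF \<phi>[unfolded circle_states_def] imageI[OF f] _ c])
qed

lemma circle_state_diff:
  assumes \<phi>: "\<phi> \<in> circle_states" and f: "f \<in> cont_circle" and g: "g \<in> cont_circle"
  shows "\<phi> (mult_op (\<lambda>x. f x - g x)) = \<phi> (mult_op f) - \<phi> (mult_op g)"
proof -
  have "mult_op (\<lambda>x. f x - g x) = (\<lambda>\<xi>. mult_op f \<xi> - mult_op g \<xi>)"
    using mult_op_diff_fun[OF f g] by (simp add: fun_eq_iff)
  then show ?thesis
    using circle.state_diff[OF \<phi>[unfolded circle_states_def]] f g by simp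
qed

text \<open>States of a constant function agree, and \<open>f\<close> differs by at most \<open>\<pi>\<close> from the constant \<open>f 0\<close>. Some
  such bound is needed because the distances of a metric space are finite.\<close>

lemma circle_dist_le_2pi:
  assumes \<phi>: "\<phi> \<in> circle_states" and \<psi>: "\<psi> \<in> circle_states"
  shows "circle_dist \<phi> \<psi> \<le> ennreal (2 * pi)"
  unfolding circle_dist_def
proof (rule spectral_dist_le)
  fix A assume "A \<in> mult_op ` smooth_circle" and comm: "commutator_norm D_dom D_op A \<le> 1"
  then obtain f where A: "A = mult_op f" and "f \<in> smooth_circle" by blast
  then obtain f' where f: "f \<in> cont_circle" "f' \<in> cont_circle" "\<And>t. (f has_vector_derivative f' t) (at t)"
    using smooth_circle_deriv by blast
  have f'_le: "cmod (f' t) \<le> 1" for t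
    using commutator_norm_circle_ge[OF f, of 1] comm A by simp
  have osc: "cmod (f t - f 0) \<le> pi" for t
  proof -
    have "cmod (f 0 - f t) \<le> pi / 2 * cmod (fourier 1 (t - 0) - 1)"
      by (rule circle_lipschitz[OF f(1,3) f'_le])
    also have "\<dots> \<le> pi / 2 * 2"
      using norm_triangle_ineq4[of "fourier 1 (t - 0)" 1] by (intro mult_left_mono) auto
    finally show ?thesis by (simp add: norm_minus_commute)
  qed
  have g: "(\<lambda>x. f x - f 0) \<in> cont_circle" by (intro cont_circle_diff cont_circle_const f)
  have "\<rho> (mult_op f) = \<rho> (mult_op (\<lambda>x. f x - f 0)) + f 0" if "\<rho> \<in> circle_states" for \<rho>
  proof -
    have "mult_op (\<lambda>x. f 0) = (\<lambda>\<xi>. f 0 *\<^sub>c mult_op (\<lambda>x. 1) \<xi>)" by (simp add: fun_eq_iff mult_op_const)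
    then have "\<rho> (mult_op (\<lambda>x. f 0)) = f 0"
      using circle.state_scale[OF that[unfolded circle_states_def] circle.unit, of "f 0"]
        circle.state_unit[OF that[unfolded circle_states_def]] by simp
    then show ?thesis
      using circle_state_diff[OF that f(1) cont_circle_const[of "f 0"]] by simp
  qed
  from this[OF \<phi>] this[OF \<psi>] have "cmod (\<phi> A - \<psi> A) = cmod (\<phi> (mult_op (\<lambda>x. f x - f 0)) - \<psi> (mult_op (\<lambda>x. f x - f 0)))"
    unfolding A by (simp only: add_diff_cancel_right)
  also have "\<dots> \<le> pi + pi"
    using circle_state_bound[OF \<phi> g osc] circle_state_bound[OF \<psi> g osc]
      norm_triangle_ineq4[of "\<phi> (mult_op (\<lambda>x. f x - f 0))" "\<psi> (mult_op (\<lambda>x. f x - f 0))"] by linarith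
  finally show "ennreal (cmod (\<phi> A - \<psi> A)) \<le> ennreal (2 * pi)" by (intro ennreal_leI) simp
qed

lemma cont_circle_bounded:
  assumes "f \<in> cont_circle"
  shows "\<exists>M>0. \<forall>t. cmod (f t) \<le> M"
proof -
  obtain B where B: "\<forall>x t. cmod (f x - f t) \<le> 1 + B * cmod (fourier 1 (t - x) - 1)"
    using cont_circle_modulus[OF assms, of 1] zero_less_one by blast
  have "cmod (f t) \<le> cmod (f 0) + 1 + 2 * \<bar>B\<bar>" for t
  proof -
    have "cmod (fourier 1 (t - 0) - 1) \<le> 2"
      using norm_triangle_ineq4[of "fourier 1 (t - 0)" 1] by simp
    then have "B * cmod (fourier 1 (t - 0) - 1) \<le> \<bar>B\<bar> * 2"
      by (rule mult_mono[OF abs_ge_self]) simp_all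
    moreover have "cmod (f t) \<le> cmod (f 0) + cmod (f 0 - f t)"
      using norm_triangle_sub[of "f t" "f 0"] by (simp only: norm_minus_commute[of "f t"])
    ultimately show ?thesis using spec[OF spec[OF B, of 0], of t] by linarith
  qed
  moreover have "0 < cmod (f 0) + 1 + 2 * \<bar>B\<bar>" using norm_ge_zero[of "f 0"] by linarith
  ultimately show ?thesis by blast
qed

text \<open>Functions with bounded derivative become admissible test functions after scaling.\<close>

lemma circle_dist_zero_imp_eq_smooth:
  assumes \<phi>: "\<phi> \<in> circle_states" and \<psi>: "\<psi> \<in> circle_states" and zero: "circle_dist \<phi> \<psi> = 0"
    and T: "clinear T"
  shows "\<phi> (mult_op (symbol n T)) = \<psi> (mult_op (symbol n T))"
proof -
  let ?f = "symbol n T"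
  have f: "?f \<in> cont_circle" by (rule symbol_cont_circle[OF T])
  have f': "(\<lambda>x. \<i> * symbol n (ad n T) x) \<in> cont_circle"
    by (intro cont_circle_cmult symbol_cont_circle clinear_ad T)
  obtain M where M: "M > 0" "\<And>t. cmod (\<i> * symbol n (ad n T) t) \<le> M"
    using cont_circle_bounded[OF f'] by blast
  define c where "c = complex_of_real (1 / M)"
  have c: "c \<noteq> 0" using M(1) by (simp add: c_def)
  have sym: "(\<lambda>x. c * ?f x) = symbol n (\<lambda>\<xi>. c *\<^sub>c T \<xi>)" by (simp add: symbol_def[abs_def])
  have "clinear (\<lambda>\<xi>. c *\<^sub>c T \<xi>)"
    using T by (simp add: clinear_def cscale_add_right mult.commute)
  then have smooth: "(\<lambda>x. c * ?f x) \<in> smooth_circle"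
    unfolding sym by (rule symbol_smooth_circle)
  have "commutator_norm D_dom D_op (mult_op (\<lambda>x. c * ?f x)) \<le> ennreal 1"
  proof (rule commutator_norm_circle_le)
    show "((\<lambda>x. c * ?f x) has_vector_derivative c * (\<i> * symbol n (ad n T) x)) (at x)" for x
      by (intro has_vector_derivative_mult_right symbol_has_vector_derivative T)
    show "cmod (c * (\<i> * symbol n (ad n T) x)) \<le> 1" for x
      using M(2)[of x] M(1) by (simp add: c_def norm_mult norm_divide)
  qed (intro cont_circle_cmult f f')+
  then have "ennreal (cmod (\<phi> (mult_op (\<lambda>x. c * ?f x)) - \<psi> (mult_op (\<lambda>x. c * ?f x)))) \<le> circle_dist \<phi> \<psi>"
    unfolding circle_dist_def using smooth by (intro spectral_dist_ge) auto
  then have eq: "\<phi> (mult_op (\<lambda>x. c * ?f x)) = \<psi> (mult_op (\<lambda>x. c * ?f x))"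
    unfolding zero by simp
  have "\<rho> (mult_op (\<lambda>x. c * ?f x)) = c * \<rho> (mult_op ?f)" if "\<rho> \<in> circle_states" for \<rho>
    using circle.state_scale[OF that[unfolded circle_states_def], of "mult_op ?f" c] f
    by (simp add: mult_op_cmult_fun[OF f, abs_def])
  from eq[unfolded this[OF \<phi>] this[OF \<psi>]] c show ?thesis by simp
qed

text \<open>Fejer means approximate every continuous function uniformly.\<close>

lemma circle_dist_zero_imp_eq:
  assumes \<phi>: "\<phi> \<in> circle_states" and \<psi>: "\<psi> \<in> circle_states" and zero: "circle_dist \<phi> \<psi> = 0"
  shows "\<phi> = \<psi>"
proof (rule extensionalityI[where A = "mult_op ` cont_circle"])
  show "\<phi> \<in> extensional (mult_op ` cont_circle)" "\<psi> \<in> extensional (mult_op ` cont_circle)"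
    using \<phi> \<psi> circle.state_extensional unfolding circle_states_def by auto
  fix A assume "A \<in> mult_op ` cont_circle"
  then obtain f where f: "f \<in> cont_circle" "A = mult_op f" by blast
  have "cmod (\<phi> A - \<psi> A) \<le> 0"
  proof (rule field_le_epsilon)
    fix e :: real assume "e > 0"
    then obtain n where n: "\<And>x. cmod (f x - symbol n (mult_op f) x) \<le> e / 2"
      using fejer_uniform_convergence[OF f(1), of "e / 2"] by auto
    let ?s = "symbol n (mult_op f)"
    have s: "?s \<in> cont_circle" by (intro symbol_cont_circle clinear_mult_op)
    have "\<phi> (mult_op ?s) = \<psi> (mult_op ?s)"
      by (rule circle_dist_zero_imp_eq_smooth[OF \<phi> \<psi> zero clinear_mult_op])
    then have "\<phi> A - \<psi> A = \<phi> (mult_op (\<lambda>x. f x - ?s x)) - \<psi> (mult_op (\<lambda>x. f x - ?s x))"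
      unfolding f(2) circle_state_diff[OF \<phi> f(1) s] circle_state_diff[OF \<psi> f(1) s] by simp
    also have "cmod \<dots> \<le> e / 2 + e / 2"
      by (intro order_trans[OF norm_triangle_ineq4] add_mono circle_state_bound \<phi> \<psi> n cont_circle_diff f s)
    finally show "cmod (\<phi> A - \<psi> A) \<le> 0 + e" by simp
  qed
  then show "\<phi> A = \<psi> A" by simp
qed

lemma circle_dist_dilate_le:
  "circle_dist (dilate_state n \<phi>) (dilate_state n \<psi>) \<le> toeplitz_dist n \<phi> \<psi>"
  unfolding circle_dist_def
proof (rule spectral_dist_le)
  fix A assume "A \<in> mult_op ` smooth_circle" and comm: "commutator_norm D_dom D_op A \<le> 1"
  then obtain f where A: "A = mult_op f" and f: "f \<in> smooth_circle" by blast
  have cont: "f \<in> cont_circle" by (rule smooth_imp_cont_circle[OF f])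
  have "commutator_norm (range (proj n)) (compress n D_op) (compress n A) \<le> 1"
    using commutator_norm_compress_le[OF f, of n] comm unfolding A by (rule order_trans)
  then have "ennreal (cmod (\<phi> (compress n A) - \<psi> (compress n A))) \<le> toeplitz_dist n \<phi> \<psi>"
    unfolding toeplitz_dist_def using cont by (intro spectral_dist_ge) (auto simp: toeplitz_system_def A)
  then show "ennreal (cmod (dilate_state n \<phi> A - dilate_state n \<psi> A)) \<le> toeplitz_dist n \<phi> \<psi>"
    using cont by (simp add: dilate_state_def A)
qed

text \<open>A Toeplitz matrix \<open>T\<close> is the truncation of its symbol plus a remainder of norm at most \<open>1/\<surd>n\<close>, and the
  symbol is an admissible test function on the circle.\<close>

lemma toeplitz_dist_le:
  assumes n: "n \<ge> 1" and \<phi>: "\<phi> \<in> toeplitz_states n" and \<psi>: "\<psi> \<in> toeplitz_states n"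
  shows "toeplitz_dist n \<phi> \<psi> \<le> circle_dist (dilate_state n \<phi>) (dilate_state n \<psi>) + ennreal (2 / sqrt n)"
  unfolding toeplitz_dist_def
proof (rule spectral_dist_le)
  fix T assume T_in: "T \<in> toeplitz_system n" and comm: "commutator_norm (range (proj n)) (compress n D_op) T \<le> 1"
  then obtain f where f: "f \<in> cont_circle" and T: "T = compress n (mult_op f)"
    by (auto simp: toeplitz_system_def)
  have lin: "clinear T" unfolding T by (intro clinear_compress clinear_mult_op)
  let ?s = "symbol n T"
  have s: "?s \<in> cont_circle" by (rule symbol_cont_circle[OF lin])
  have ad: "op_norm (range (proj n)) (ad n T) \<le> 1"
  proof -
    have "T \<xi> \<in> range (proj n)" for \<xi> by (simp add: T compress_def)
    from commutator_norm_toeplitz[of T n, OF this] comm show ?thesis by (simp only:)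
  qed
  let ?R = "compress n (mult_op (\<lambda>x. f x - ?s x))"
  have R: "op_norm (range (proj n)) ?R \<le> ennreal (1 / sqrt n)"
    unfolding T by (rule toeplitz_remainder_norm[OF f n ad[unfolded T]])
  have R_in: "?R \<in> toeplitz_system n"
    unfolding toeplitz_system_def by (rule imageI[OF cont_circle_diff[OF f s]])
  have s_in: "compress n (mult_op ?s) \<in> toeplitz_system n"
    unfolding toeplitz_system_def by (rule imageI[OF s])
  have R_eq: "?R = (\<lambda>\<xi>. T \<xi> - compress n (mult_op ?s) \<xi>)"
  proof
    show "?R \<xi> = T \<xi> - compress n (mult_op ?s) \<xi>" for \<xi>
      using mult_op_diff_fun[OF f s, of "proj n \<xi>"] arg_cong[OF T, of "\<lambda>S. S \<xi>"]
      by (simp add: compress_def proj_diff)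
  qed
  have T_split: "\<rho> T = \<rho> ?R + dilate_state n \<rho> (mult_op ?s)" "cmod (\<rho> ?R) \<le> 1 / sqrt n"
    if "\<rho> \<in> toeplitz_states n" for \<rho>
  proof -
    show "\<rho> T = \<rho> ?R + dilate_state n \<rho> (mult_op ?s)"
      unfolding R_eq toeplitz.state_diff[OF that[unfolded toeplitz_states_def] T_in s_in]
      using s by (simp add: dilate_state_def)
    show "cmod (\<rho> ?R) \<le> 1 / sqrt n"
      by (rule toeplitz.state_bound[OF that[unfolded toeplitz_states_def] R_in R]) simp
  qed
  have "commutator_norm D_dom D_op (mult_op ?s) \<le> 1"
    using commutator_norm_symbol_le[OF lin n, of 1] ad by simp
  then have d: "ennreal (cmod (dilate_state n \<phi> (mult_op ?s) - dilate_state n \<psi> (mult_op ?s)))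
      \<le> circle_dist (dilate_state n \<phi>) (dilate_state n \<psi>)"
    unfolding circle_dist_def by (rule spectral_dist_ge[OF imageI[OF symbol_smooth_circle[OF lin]]])
  have diff: "\<phi> T - \<psi> T = (dilate_state n \<phi> (mult_op ?s) - dilate_state n \<psi> (mult_op ?s)) + (\<phi> ?R - \<psi> ?R)"
    by (simp only: T_split(1)[OF \<phi>] T_split(1)[OF \<psi>] add_diff_add add.commute)
  have "cmod (\<phi> T - \<psi> T) \<le> cmod (dilate_state n \<phi> (mult_op ?s) - dilate_state n \<psi> (mult_op ?s)) + 2 / sqrt n"
  proof -
    have "cmod (\<phi> ?R - \<psi> ?R) \<le> 1 / sqrt n + 1 / sqrt n"
      by (rule order_trans[OF norm_triangle_ineq4 add_mono[OF T_split(2)[OF \<phi>] T_split(2)[OF \<psi>]]])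
    then have "cmod (\<phi> ?R - \<psi> ?R) \<le> 2 / sqrt n" by simp
    then show ?thesis
      unfolding diff by (rule order_trans[OF norm_triangle_ineq add_left_mono])
  qed
  then have "ennreal (cmod (\<phi> T - \<psi> T)) \<le>
      ennreal (cmod (dilate_state n \<phi> (mult_op ?s) - dilate_state n \<psi> (mult_op ?s)) + 2 / sqrt n)"
    by (rule ennreal_leI)
  also have "\<dots> = ennreal (cmod (dilate_state n \<phi> (mult_op ?s) - dilate_state n \<psi> (mult_op ?s))) + ennreal (2 / sqrt n)"
    by (rule ennreal_plus) auto
  also have "\<dots> \<le> circle_dist (dilate_state n \<phi>) (dilate_state n \<psi>) + ennreal (2 / sqrt n)"
    by (intro add_right_mono d)
  finally show "ennreal (cmod (\<phi> T - \<psi> T)) \<le> \<dots>" .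
qed

lemma circle_dist_dilate_truncate:
  assumes n: "n \<ge> 1" and \<phi>: "\<phi> \<in> circle_states"
  shows "circle_dist (dilate_state n (truncate_state n \<phi>)) \<phi> \<le> ennreal (pi / sqrt n)"
  unfolding circle_dist_def
proof (rule spectral_dist_le)
  fix A assume "A \<in> mult_op ` smooth_circle" and comm: "commutator_norm D_dom D_op A \<le> 1"
  then obtain f where A: "A = mult_op f" and "f \<in> smooth_circle" by blast
  then obtain f' where f: "f \<in> cont_circle" "f' \<in> cont_circle" "\<And>t. (f has_vector_derivative f' t) (at t)"
    using smooth_circle_deriv by blast
  have f'_le: "cmod (f' t) \<le> 1" for t
    using commutator_norm_circle_ge[OF f, of 1] comm A by simp
  let ?s = "symbol n (mult_op f)"
  have s: "?s \<in> cont_circle" by (intro symbol_cont_circle clinear_mult_op)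
  have "symbol n (compress n (mult_op f)) = ?s" by (simp add: fun_eq_iff symbol_compress)
  then have "dilate_state n (truncate_state n \<phi>) A = \<phi> (mult_op ?s)"
    using f(1) by (simp add: dilate_state_def truncate_state_def A toeplitz_system_def)
  then have "cmod (dilate_state n (truncate_state n \<phi>) A - \<phi> A) = cmod (\<phi> (mult_op (\<lambda>x. f x - ?s x)))"
    by (simp add: circle_state_diff[OF \<phi> f(1) s] A norm_minus_commute)
  also have "\<dots> \<le> pi / sqrt n"
    by (intro circle_state_bound[OF \<phi>] cont_circle_diff f s lipschitz_fejer[OF f(1,3) f'_le n])
  finally show "ennreal (cmod (dilate_state n (truncate_state n \<phi>) A - \<phi> A)) \<le> ennreal (pi / sqrt n)"
    by (rule ennreal_leI)
qed


section \<open>Gromov--Hausdorff convergence\<close>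

text \<open>The common metric on the disjoint union joins \<open>x\<close> to \<open>y\<close> by \<open>\<epsilon> + dY (R x) y\<close>: one walks from \<open>x\<close> to
  \<open>R x\<close> over a bridge of length \<open>\<epsilon>\<close> and continues in \<open>Y\<close>. A round trip \<open>x\<close>, \<open>y\<close>, \<open>x'\<close> crosses two bridges, so
  the triangle inequality tolerates that \<open>R\<close> shortens distances by \<open>2 * \<epsilon>\<close>. Positivity of \<open>\<epsilon>\<close> keeps the two
  spaces disjoint.\<close>

lemma gromov_hausdorff_dist_le:
  fixes X :: "'a set" and Y :: "'b set" and R :: "'a \<Rightarrow> 'b"
  assumes X_commute: "\<And>x x'. dX x x' = dX x' x"
    and X_triangle: "\<And>x x' x''. dX x x'' \<le> dX x x' + dX x' x''"
    and Y_refl: "\<And>y. dY y y = 0"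
    and Y_commute: "\<And>y y'. dY y y' = dY y' y"
    and Y_triangle: "\<And>y y' y''. dY y y'' \<le> dY y y' + dY y' y''"
    and Y_finite: "\<And>y y'. y \<in> Y \<Longrightarrow> y' \<in> Y \<Longrightarrow> dY y y' < \<infinity>"
    and Y_zero: "\<And>y y'. y \<in> Y \<Longrightarrow> y' \<in> Y \<Longrightarrow> dY y y' = 0 \<Longrightarrow> y = y'"
    and X_refl: "\<And>x. dX x x = 0"
    and R: "\<And>x. x \<in> X \<Longrightarrow> R x \<in> Y" and inj: "inj_on R X"
    and R_le: "\<And>x x'. x \<in> X \<Longrightarrow> x' \<in> X \<Longrightarrow> dY (R x) (R x') \<le> dX x x'"
    and R_ge: "\<And>x x'. x \<in> X \<Longrightarrow> x' \<in> X \<Longrightarrow> dX x x' \<le> dY (R x) (R x') + ennreal (2 * \<epsilon>)"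
    and dense: "\<And>y. y \<in> Y \<Longrightarrow> \<exists>x\<in>X. dY (R x) y \<le> ennreal \<delta>"
    and \<epsilon>: "0 < \<epsilon>" and \<delta>: "0 \<le> \<delta>"
  shows "gromov_hausdorff_dist X dX Y dY \<le> ennreal (\<epsilon> + \<delta>)"
proof -
  define rX where "rX x x' = enn2real (dX x x')" for x x'
  define rY where "rY y y' = enn2real (dY y y')" for y y'
  have X_finite: "dX x x' < \<infinity>" if "x \<in> X" "x' \<in> X" for x x'
    using R_ge[OF that] Y_finite[OF R[OF that(1)] R[OF that(2)]]
    by (auto intro: le_less_trans simp: ennreal_add_eq_top less_top)
  have rX: "ennreal (rX x x') = dX x x'" if "x \<in> X" "x' \<in> X" for x x'
    using X_finite[OF that] by (simp add: rX_def)
  have rY: "ennreal (rY y y') = dY y y'" if "y \<in> Y" "y' \<in> Y" for y y'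
    using Y_finite[OF that] by (simp add: rY_def)
  have nn [simp]: "0 \<le> rX x x'" "0 \<le> rY y y'" for x x' y y'
    by (simp_all add: rX_def rY_def)
  have comm: "rX x x' = rX x' x" "rY y y' = rY y' y" for x x' y y'
    using X_commute[of x x'] Y_commute[of y y'] by (simp_all add: rX_def rY_def)
  have rX_tri: "rX x x'' \<le> rX x x' + rX x' x''" if "x \<in> X" "x' \<in> X" "x'' \<in> X" for x x' x''
    using X_triangle[of x x'' x'] that by (simp flip: rX ennreal_plus)
  have rY_tri: "rY y y'' \<le> rY y y' + rY y' y''" if "y \<in> Y" "y' \<in> Y" "y'' \<in> Y" for y y' y''
    using Y_triangle[of y y'' y'] that by (simp flip: rY ennreal_plus)
  have rR_le: "rY (R x) (R x') \<le> rX x x'" if "x \<in> X" "x' \<in> X" for x x'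
    using R_le[OF that] that R by (simp flip: rX rY)
  have rR_ge: "rX x x' \<le> rY (R x) (R x') + 2 * \<epsilon>" if "x \<in> X" "x' \<in> X" for x x'
    using R_ge[OF that] that R \<epsilon> by (simp flip: rX rY ennreal_plus)
  have rY_zero: "rY y y' = 0 \<longleftrightarrow> y = y'" if "y \<in> Y" "y' \<in> Y" for y y'
    using Y_zero[OF that] rY[OF that] Y_refl[of y] by (auto simp: rY_def)
  have rX_zero: "rX x x' = 0 \<longleftrightarrow> x = x'" if "x \<in> X" "x' \<in> X" for x x'
  proof
    assume "rX x x' = 0"
    then have "rY (R x) (R x') = 0" using rR_le[OF that] nn(2)[of "R x" "R x'"] by linarith
    then show "x = x'" using rY_zero R that inj by (auto dest: inj_onD)
  qed (simp add: rX_def X_refl)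
  define dZ where "dZ z w = (case (z, w) of
      (Inl x, Inl x') \<Rightarrow> rX x x' | (Inr y, Inr y') \<Rightarrow> rY y y'
    | (Inl x, Inr y) \<Rightarrow> \<epsilon> + rY (R x) y | (Inr y, Inl x) \<Rightarrow> \<epsilon> + rY (R x) y)" for z w :: "'a + 'b"
  have dZ [simp]: "dZ (Inl x) (Inl x') = rX x x'" "dZ (Inr y) (Inr y') = rY y y'"
    "dZ (Inl x) (Inr y) = \<epsilon> + rY (R x) y" "dZ (Inr y) (Inl x) = \<epsilon> + rY (R x) y" for x x' y y'
    by (simp_all add: dZ_def)
  define Z where "Z = Inl ` X \<union> Inr ` Y"
  have "Metric_space Z dZ"
  proof
    show "0 \<le> dZ z w" for z w
      using \<epsilon> by (cases z; cases w) (auto intro: add_nonneg_nonneg)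
    show "dZ z w = dZ w z" for z w
      by (cases z; cases w) (auto simp: comm)
    show "dZ z w = 0 \<longleftrightarrow> z = w" if "z \<in> Z" "w \<in> Z" for z w
      using that \<epsilon> by (auto simp: Z_def rX_zero rY_zero add_nonneg_eq_0_iff)
    show "dZ z v \<le> dZ z w + dZ w v" if zwv: "z \<in> Z" "w \<in> Z" "v \<in> Z" for z w v
    proof -
      have tri:
        "dZ (Inl x) (Inl x'') \<le> dZ (Inl x) (Inl x') + dZ (Inl x') (Inl x'')"
        "dZ (Inl x) (Inr y) \<le> dZ (Inl x) (Inl x') + dZ (Inl x') (Inr y)"
        "dZ (Inl x) (Inl x') \<le> dZ (Inl x) (Inr y) + dZ (Inr y) (Inl x')"
        "dZ (Inl x) (Inr y') \<le> dZ (Inl x) (Inr y) + dZ (Inr y) (Inr y')"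
        "dZ (Inr y) (Inl x') \<le> dZ (Inr y) (Inl x) + dZ (Inl x) (Inl x')"
        "dZ (Inr y) (Inr y') \<le> dZ (Inr y) (Inl x) + dZ (Inl x) (Inr y')"
        "dZ (Inr y) (Inl x) \<le> dZ (Inr y) (Inr y') + dZ (Inr y') (Inl x)"
        "dZ (Inr y) (Inr y'') \<le> dZ (Inr y) (Inr y') + dZ (Inr y') (Inr y'')"
        if "x \<in> X" "x' \<in> X" "x'' \<in> X" "y \<in> Y" "y' \<in> Y" "y'' \<in> Y" for x x' x'' y y' y''
        using that \<epsilon> R[of x] R[of x'] rX_tri[of x x' x''] rY_tri[of y y' y''] rR_le[of x x'] rR_ge[of x x']
          rY_tri[of "R x" "R x'" y] rY_tri[of "R x'" "R x" y] rY_tri[of "R x" y "R x'"] rY_tri[of "R x" y y']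
          rY_tri[of y "R x" y'] rY_tri[of "R x" y' y]
          comm(2)[of "R x" "R x'"] comm(2)[of "R x'" y] comm(2)[of "R x" y] comm(2)[of y y']
        by simp_all
      show ?thesis
      proof (cases "X = {} \<or> Y = {}")
        case True
        then show ?thesis
          using zwv rX_tri rY_tri by (auto simp: Z_def)
      next
        case False
        \<comment> \<open>The family \<open>tri\<close> quantifies over points of both spaces, so each must have one.\<close>
        then obtain x0 y0 where 0: "x0 \<in> X" "y0 \<in> Y" by blast
        from zwv 0 show ?thesis
          unfolding Z_def
          by (elim UnE imageE; hypsubst) (rule tri; assumption)+
      qed
    qed
  qed
  moreover have "isometric_embedding X dX Z dZ Inl" "isometric_embedding Y dY Z dZ Inr"
    by (auto simp: isometric_embedding_def Z_def rX rY)
  moreover have "hausdorff_dist dZ (Inl ` X) (Inr ` Y) \<le> ennreal (\<epsilon> + \<delta>)"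
    unfolding hausdorff_dist_def
  proof (intro max.boundedI SUP_least; clarify)
    fix x assume x: "x \<in> X"
    have "(INF b\<in>Inr ` Y. ennreal (dZ (Inl x) b)) \<le> ennreal (dZ (Inl x) (Inr (R x)))"
      using R[OF x] by (intro INF_lower) auto
    also have "\<dots> \<le> ennreal (\<epsilon> + \<delta>)"
      using \<delta> rY_zero[OF R[OF x] R[OF x]] by (intro ennreal_leI) simp
    finally show "(INF b\<in>Inr ` Y. ennreal (dZ (Inl x) b)) \<le> ennreal (\<epsilon> + \<delta>)" .
  next
    fix y assume y: "y \<in> Y"
    obtain x where x: "x \<in> X" "dY (R x) y \<le> ennreal \<delta>" using dense[OF y] by blast
    have "rY (R x) y \<le> \<delta>"
      using x(2) R[OF x(1)] y \<delta> by (simp flip: rY)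
    have "(INF a\<in>Inl ` X. ennreal (dZ a (Inr y))) \<le> ennreal (dZ (Inl x) (Inr y))"
      using x(1) by (intro INF_lower) auto
    also have "\<dots> \<le> ennreal (\<epsilon> + \<delta>)"
      using \<open>rY (R x) y \<le> \<delta>\<close> by (intro ennreal_leI) simp
    finally show "(INF a\<in>Inl ` X. ennreal (dZ a (Inr y))) \<le> ennreal (\<epsilon> + \<delta>)" .
  qed
  ultimately show ?thesis
    unfolding gromov_hausdorff_dist_def by (intro Inf_lower2) blast+
qed

lemma inj_on_dilate_state: "inj_on (dilate_state n) (toeplitz_states n)"
proof (rule inj_onI)
  fix \<phi> \<psi> assume \<phi>: "\<phi> \<in> toeplitz_states n" and \<psi>: "\<psi> \<in> toeplitz_states n"
    and eq: "dilate_state n \<phi> = dilate_state n \<psi>"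
  have ext: "\<phi> \<in> extensional (toeplitz_system n)" "\<psi> \<in> extensional (toeplitz_system n)"
    using \<phi> \<psi> toeplitz.state_extensional unfolding toeplitz_states_def by auto
  have "\<phi> T = \<psi> T" if "T \<in> toeplitz_system n" for T
  proof -
    from that obtain f where f: "f \<in> cont_circle" "T = compress n (mult_op f)"
      unfolding toeplitz_system_def by blast
    have "dilate_state n \<rho> (mult_op f) = \<rho> T" for \<rho>
      using f by (simp add: dilate_state_def)
    from this[of \<phi>] this[of \<psi>] show ?thesis
      unfolding eq by simp
  qed
  with ext show "\<phi> = \<psi>"
    by (rule extensionalityI)
qed

lemma gromov_hausdorff_toeplitz_le:
  assumes n: "n \<ge> 1"
  shows "gromov_hausdorff_dist (toeplitz_states n) (toeplitz_dist n) circle_states circle_dist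
    \<le> ennreal (1 / sqrt n + pi / sqrt n)"
proof (rule gromov_hausdorff_dist_le[where R = "dilate_state n" and X = "toeplitz_states n" and Y = circle_states
    and dX = "toeplitz_dist n" and dY = circle_dist and \<epsilon> = "1 / sqrt n" and \<delta> = "pi / sqrt n"])
  show "circle_dist \<phi> \<psi> < \<infinity>" if "\<phi> \<in> circle_states" "\<psi> \<in> circle_states" for \<phi> \<psi>
    using circle_dist_le_2pi[OF that] by (rule le_less_trans) simp
  show "toeplitz_dist n \<phi> \<psi> \<le> circle_dist (dilate_state n \<phi>) (dilate_state n \<psi>) + ennreal (2 * (1 / sqrt n))"
    if "\<phi> \<in> toeplitz_states n" "\<psi> \<in> toeplitz_states n" for \<phi> \<psi>
    using toeplitz_dist_le[OF n that] by simp
  show "\<exists>\<psi>\<in>toeplitz_states n. circle_dist (dilate_state n \<psi>) \<phi> \<le> ennreal (pi / sqrt n)"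
    if "\<phi> \<in> circle_states" for \<phi>
    using circle_dist_dilate_truncate[OF n that] truncate_state_in[OF n that] by blast
  show "toeplitz_dist n \<phi> \<psi> = toeplitz_dist n \<psi> \<phi>" "toeplitz_dist n \<phi> \<phi> = 0"
    "toeplitz_dist n \<phi> \<rho> \<le> toeplitz_dist n \<phi> \<psi> + toeplitz_dist n \<psi> \<rho>" for \<phi> \<psi> \<rho>
    unfolding toeplitz_dist_def
    by (fact spectral_dist_commute spectral_dist_refl spectral_dist_triangle)+
  show "circle_dist \<phi> \<psi> = circle_dist \<psi> \<phi>" "circle_dist \<phi> \<phi> = 0"
    "circle_dist \<phi> \<rho> \<le> circle_dist \<phi> \<psi> + circle_dist \<psi> \<rho>" for \<phi> \<psi> \<rho>
    unfolding circle_dist_def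
    by (fact spectral_dist_commute spectral_dist_refl spectral_dist_triangle)+
  show "\<phi> = \<psi>" if "\<phi> \<in> circle_states" "\<psi> \<in> circle_states" "circle_dist \<phi> \<psi> = 0" for \<phi> \<psi>
    using that by (rule circle_dist_zero_imp_eq)
  show "circle_dist (dilate_state n \<phi>) (dilate_state n \<psi>) \<le> toeplitz_dist n \<phi> \<psi>" for \<phi> \<psi>
    by (rule circle_dist_dilate_le)
  show "dilate_state n \<phi> \<in> circle_states" if "\<phi> \<in> toeplitz_states n" for \<phi>
    using that by (rule dilate_state_in)
qed (use n in \<open>simp_all add: inj_on_dilate_state\<close>)

theorem proposition13:
  shows "(\<lambda>n. gromov_hausdorff_dist (toeplitz_states n) (toeplitz_dist n) circle_states circle_dist)
    \<longlonglongrightarrow> 0"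
proof (rule tendsto_sandwich[where f = "\<lambda>_. 0"])
  show "\<forall>\<^sub>F n in sequentially. gromov_hausdorff_dist (toeplitz_states n) (toeplitz_dist n) circle_states circle_dist
    \<le> ennreal (1 / sqrt (real n) + pi / sqrt (real n))"
    using eventually_ge_at_top[of "1::nat"] by eventually_elim (rule gromov_hausdorff_toeplitz_le)
  have "(\<lambda>n. 1 / sqrt (real n) + pi / sqrt (real n)) \<longlonglongrightarrow> 0"
    by real_asymp
  from tendsto_ennrealI[OF this]
  show "(\<lambda>n. ennreal (1 / sqrt (real n) + pi / sqrt (real n))) \<longlonglongrightarrow> 0"
    by (simp only: ennreal_0)
  show "\<forall>\<^sub>F n in sequentially. 0 \<le> gromov_hausdorff_dist (toeplitz_states n) (toeplitz_dist n) circle_states circle_dist"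
    by simp
qed (rule tendsto_const)

end
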